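(* There exists a function $f:\mathbb{N}\to\mathbb{N}$ with the following property. Let $k$ and $m$ be positive integers and let $G$ be a profinite group such that $|\mathcal{U}_k(G)|\le m$. Then $\gamma_k(G)$ is finite and $|\gamma_k(G)|\le f(m)$.
   Context: Subgroups of profinite groups are closed unless otherwise specified; in particular $\gamma_k(G)$, the $k$-th term of the lower central series of a profinite group $G$, is the closed subgroup generated by all values $[g_1,\dots,g_k]$, $g_i\in G$. Commutators: $[x,y]=x^{-1}y^{-1}xy$, $[x_1,\dots,x_k]=[[x_1,\dots,x_{k-1}],x_k]$ (left-normed), and $[x_1]=x_1$. For $g$ in a profinite group, $|g|$ is the order (a Steinitz number) of the procyclic subgroup topologically generated by $g$, and $\pi(g)$ is the set of prime divisors of $|g|$. $\mathcal{U}_k(G)$ denotes the set of uniform $k$-step commutators of $G$, i.e. elements of the form $[x_1,\dots,x_k]$ with $x_1,\dots,x_k\in G$ and $\pi(x_1)=\dots=\pi(x_k)$. *)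

theory Defs
  imports
    "HOL-Analysis.Analysis"
    "HOL-Algebra.Generated_Groups"
    "HOL-Computational_Algebra.Primes"
    "HOL-Library.Extended_Nat"
begin

text \<open>
  Profinite groups are compact Hausdorff totally disconnected topological groups.  They are
  given by a group record together with an abstract topology on its carrier.
\<close>

locale topological_group = group G for G (structure) +
  fixes T :: "'a topology"
  assumes topspace_eq: "topspace T = carrier G"
    and continuous_mult: "continuous_map (prod_topology T T) T (\<lambda>(x, y). x \<otimes> y)"
    and continuous_inv: "continuous_map T T (\<lambda>x. inv x)"

locale profinite_group = topological_group +
  assumes compact: "compact_space T"
    and Hausdorff: "Hausdorff_space T"
    and totally_disconnected: "\<And>S. connectedin T S \<Longrightarrow> \<exists>a. S \<subseteq> {a}"

definition closed_generate :: "('a, 'b) monoid_scheme \<Rightarrow> 'a topology \<Rightarrow> 'a set \<Rightarrow> 'a set"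
  where "closed_generate G T S = T closure_of (generate G S)"

text \<open>
  The order of a profinite group \<open>(H, T)\<close> is the Steinitz number given by the least common
  multiple of the orders of the quotients \<open>H / N\<close> for \<open>N\<close> an open normal subgroup (these are finite by
  compactness).  A Steinitz number \<open>\<Prod>p. p ^ n(p)\<close> is encoded by its exponent function
  \<open>n :: nat \<Rightarrow> enat\<close>, which is set to \<open>0\<close> off the primes.
\<close>

definition steinitz_order :: "('a, 'b) monoid_scheme \<Rightarrow> 'a topology \<Rightarrow> nat \<Rightarrow> enat"
  where "steinitz_order H T p =
    (if prime p then (SUP N \<in> {N. N \<lhd> H \<and> openin T N}. enat (multiplicity p (order (H Mod N)))) else 0)"

definition elt_steinitz_order :: "('a, 'b) monoid_scheme \<Rightarrow> 'a topology \<Rightarrow> 'a \<Rightarrow> nat \<Rightarrow> enat"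
  where "elt_steinitz_order G T g =
    (let C = closed_generate G T {g} in steinitz_order (G\<lparr>carrier := C\<rparr>) (subtopology T C))"

definition prime_set :: "('a, 'b) monoid_scheme \<Rightarrow> 'a topology \<Rightarrow> 'a \<Rightarrow> nat set"
  where "prime_set G T g = {p. prime p \<and> elt_steinitz_order G T g p \<noteq> 0}"

definition commutator :: "('a, 'b) monoid_scheme \<Rightarrow> 'a \<Rightarrow> 'a \<Rightarrow> 'a"
  where "commutator G x y = inv\<^bsub>G\<^esub> x \<otimes>\<^bsub>G\<^esub> inv\<^bsub>G\<^esub> y \<otimes>\<^bsub>G\<^esub> x \<otimes>\<^bsub>G\<^esub> y"

text \<open>
  \<open>[x\<^sub>1, \<dots>, x\<^sub>k] = [[x\<^sub>1, \<dots>, x\<^sub>k\<^sub>-\<^sub>1], x\<^sub>k]\<close> and \<open>[x\<^sub>1] = x\<^sub>1\<close>; only used for nonempty lists.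
\<close>

definition left_normed :: "('a, 'b) monoid_scheme \<Rightarrow> 'a list \<Rightarrow> 'a"
  where "left_normed G xs = foldl (commutator G) (hd xs) (tl xs)"

definition uniform_commutators :: "nat \<Rightarrow> ('a, 'b) monoid_scheme \<Rightarrow> 'a topology \<Rightarrow> 'a set"
  where "uniform_commutators k G T =
    {left_normed G xs | xs. length xs = k \<and> set xs \<subseteq> carrier G \<and>
       (\<forall>x\<in>set xs. \<forall>y\<in>set xs. prime_set G T x = prime_set G T y)}"

definition lower_central :: "nat \<Rightarrow> ('a, 'b) monoid_scheme \<Rightarrow> 'a topology \<Rightarrow> 'a set"
  where "lower_central k G T =
    closed_generate G T {left_normed G xs | xs. length xs = k \<and> set xs \<subseteq> carrier G}"

text \<open>
  \<open>lower_central_bound TYPE('a) f\<close>: the function \<open>f\<close> has the required property for all profinite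
  groups whose elements are drawn from the type \<open>'a\<close>.
\<close>

definition lower_central_bound :: "'a itself \<Rightarrow> (nat \<Rightarrow> nat) \<Rightarrow> bool"
  where "lower_central_bound _ f \<longleftrightarrow>
    (\<forall>k m. \<forall>(G :: 'a monoid) T. k > 0 \<longrightarrow> m > 0 \<longrightarrow> profinite_group G T \<longrightarrow>
       finite (uniform_commutators k G T) \<longrightarrow> card (uniform_commutators k G T) \<le> m \<longrightarrow>
       finite (lower_central k G T) \<and> card (lower_central k G T) \<le> f m)"

text \<open>
  HOL cannot quantify over types inside a formula, so \<open>\<exists>f. lower_central_bound TYPE('a) f\<close> alone
  would let \<open>f\<close> depend on \<open>'a\<close>.  Independence is expressed by additionally requiring, for arbitrary
  \<open>'a\<close>, that every \<open>f\<close> with the property for groups on the fixed type \<open>nat\<close> has it for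
  groups on \<open>'a\<close>: then any \<open>f\<close> obtained for \<open>nat\<close> serves all profinite groups at once.
\<close>

end

theory Submission
  imports Defs "HOL-Algebra.Multiplicative_Group" "HOL-Algebra.Sylow" "HOL-Algebra.Group_Action"
begin

text \<open>
  Let \<open>G\<close> be finite, and let \<open>V\<close> be the set of commutators \<open>[x\<^sub>1, \<dots>, x\<^sub>k]\<close> in which all \<open>x\<^sub>i\<close> are
  \<open>p\<close>-elements for one prime \<open>p\<close>; they are uniform, and in a quotient where all of them are trivial the
  \<open>p\<close>-elements form nilpotent normal subgroups that centralize one another, so \<open>V\<close> generates
  \<open>\<gamma>\<^sub>k(G)\<close>.  As \<open>V\<close> is normal with at most \<open>m\<close> elements, by Dietzmann's argument it suffices to bound
  the order of each \<open>v \<in> V\<close> in terms of \<open>m\<close>.  The centre \<open>Z\<close> of \<open>H = \<langle>V\<rangle>\<close> has index at most \<open>m\<^sup>m\<close>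
  in \<open>H\<close>, and the transfer \<open>H \<rightarrow> Z\<close> is a \<open>G\<close>-equivariant homomorphism that is a power map on \<open>Z\<close>, so only the
  image of \<open>v\<close> matters, one prime \<open>q\<close> at a time.  On the \<open>q\<close>-part of \<open>Z\<close> the elements of order prime to
  \<open>q\<close> act trivially after raising to the power \<open>m!\<close>, because for an \<open>r\<close>-element \<open>x\<close> the group
  \<open>[Z\<^sub>q, x]\<close> consists of commutators of conjugates of \<open>x\<close> and thus lies in \<open>V\<close>.  Hence modulo the kernel of
  the \<open>q\<close>-part of the transfer the \<open>q\<close>-elements form a nilpotent group, where
  \<open>\<gamma>\<^bsub>k+1\<^esub>\<close>-values are \<open>\<gamma>\<^sub>k\<close>-values, and a descending induction along the lower central series applies.
  Both steps use that \<open>[c, x\<^sup>i] \<in> V\<close> for all \<open>i\<close> forces \<open>[c, x\<^sup>l] = 1\<close> for some \<open>0 < l \<le> m\<close>.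

  In a profinite group, an element of a finite quotient lifts to an element with the same set of primes, by
  compactness, so the bound passes from the finite quotients to the group.
\<close>

section \<open>Commutators\<close>

text \<open>The exponent must depend neither on \<open>k\<close> nor on the order of
  \<open>G\<close>. The only finiteness at hand is that of \<open>V\<close>, so the factors
  \<open>fact m\<close> come from the pigeonhole principle: a coincidence among \<open>m + 1\<close>
  indexed elements of \<open>V\<close> yields some \<open>l\<close> with
  \<open>0 < l \<le> m\<close>, a divisor of \<open>fact m\<close>.

  For \<open>v = [c, x]\<close> one would like \<open>[c, x^i] = v^i\<close>, but this needs
  \<open>x\<close> to centralize \<open>v\<close>. After the transfer, and one prime
  \<open>q\<close> at a time, the equation holds up to errors that can be controlled. If
  \<open>x\<close> is not a \<open>q\<close>-element, \<open>x\<close> centralizes the image. If it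
  is, the errors are longer commutators, which the descending induction has already treated. That
  induction takes at most \<open>m\<close> steps whatever the nilpotency class is, since in a
  nilpotent group the sets of values of lengths \<open>k\<close>, \<open>k + 1\<close>, ... shrink
  strictly until they are trivial.

  The index bound \<open>m ^ m\<close> arises because an element of
  \<open>\<langle>V\<rangle>\<close> is determined modulo \<open>Z\<close> by the permutation that
  it induces on \<open>V\<close>. For \<open>k = 1\<close> no transfer is used, since powers of
  \<open>p\<close>-elements are \<open>p\<close>-elements.\<close>

definition comm_values :: "nat \<Rightarrow> ('a, 'b) monoid_scheme \<Rightarrow> 'a set \<Rightarrow> 'a set"
  where "comm_values k G X = {left_normed G xs | xs. length xs = k \<and> set xs \<subseteq> X}"

definition p_elements :: "('a, 'b) monoid_scheme \<Rightarrow> nat \<Rightarrow> 'a set"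
  where "p_elements G p = {x \<in> carrier G. \<exists>a. x [^]\<^bsub>G\<^esub> (p ^ a) = \<one>\<^bsub>G\<^esub>}"

text \<open>This is \<open>V\<close> of the overview. The union over primes stands outside: the
  entries of one commutator all belong to the same prime.\<close>

definition p_comm_values :: "nat \<Rightarrow> ('a, 'b) monoid_scheme \<Rightarrow> 'a set"
  where "p_comm_values k G = (\<Union>p\<in>{p. prime p}. comm_values k G (p_elements G p))"

definition conj_by :: "('a, 'b) monoid_scheme \<Rightarrow> 'a \<Rightarrow> 'a \<Rightarrow> 'a"
  where "conj_by G g x = inv\<^bsub>G\<^esub> g \<otimes>\<^bsub>G\<^esub> x \<otimes>\<^bsub>G\<^esub> g"

definition conj_closed :: "('a, 'b) monoid_scheme \<Rightarrow> 'a set \<Rightarrow> bool"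
  where "conj_closed G X \<longleftrightarrow> X \<subseteq> carrier G \<and> (\<forall>g\<in>carrier G. \<forall>x\<in>X. conj_by G g x \<in> X)"

lemma left_normed_snoc:
  "xs \<noteq> [] \<Longrightarrow> left_normed G (xs @ [x]) = commutator G (left_normed G xs) x"
  by (cases xs) (auto simp: left_normed_def)

lemma comm_values_1 [simp]: "comm_values (Suc 0) G X = X"
proof -
  have "\<exists>xs. x = left_normed G xs \<and> length xs = Suc 0 \<and> set xs \<subseteq> X" if "x \<in> X" for x
    by (rule exI[of _ "[x]"]) (use that in \<open>auto simp: left_normed_def\<close>)
  then show ?thesis
    by (auto simp: comm_values_def left_normed_def length_Suc_conv)
qed

lemma comm_values_Suc:
  assumes "k > 0"
  shows "comm_values (Suc k) G X = {commutator G c x | c x. c \<in> comm_values k G X \<and> x \<in> X}"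
proof (intro equalityI subsetI)
  fix v assume "v \<in> comm_values (Suc k) G X"
  then obtain xs where xs: "v = left_normed G xs" "length xs = Suc k" "set xs \<subseteq> X"
    by (auto simp: comm_values_def)
  then obtain ys y where ys: "xs = ys @ [y]"
    by (metis length_Suc_conv_rev)
  then have "ys \<noteq> []" using xs assms by auto
  then have "v = commutator G (left_normed G ys) y" "left_normed G ys \<in> comm_values k G X" "y \<in> X"
    using xs ys by (auto simp: left_normed_snoc comm_values_def)
  then show "v \<in> {commutator G c x | c x. c \<in> comm_values k G X \<and> x \<in> X}" by blast
next
  fix v assume "v \<in> {commutator G c x | c x. c \<in> comm_values k G X \<and> x \<in> X}"
  then obtain ys x where v: "v = commutator G (left_normed G ys) x" "length ys = k" "set ys \<subseteq> X" "x \<in> X"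
    by (auto simp: comm_values_def)
  with assms have "v = left_normed G (ys @ [x])" "length (ys @ [x]) = Suc k" "set (ys @ [x]) \<subseteq> X"
    by (auto simp: left_normed_snoc)
  then show "v \<in> comm_values (Suc k) G X"
    unfolding comm_values_def by blast
qed

lemma comm_values_SucI:
  assumes "k > 0" "c \<in> comm_values k G X" "x \<in> X"
  shows "commutator G c x \<in> comm_values (Suc k) G X"
  using assms by (auto simp: comm_values_Suc)

lemma comm_values_mono: "X \<subseteq> Y \<Longrightarrow> comm_values k G X \<subseteq> comm_values k G Y"
  by (auto simp: comm_values_def)

context group begin

lemma l_inv_cancel [simp]: "x \<in> carrier G \<Longrightarrow> y \<in> carrier G \<Longrightarrow> inv x \<otimes> (x \<otimes> y) = y"
  by (simp flip: m_assoc)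

lemma r_inv_cancel [simp]: "x \<in> carrier G \<Longrightarrow> y \<in> carrier G \<Longrightarrow> x \<otimes> (inv x \<otimes> y) = y"
  by (simp flip: m_assoc)

lemmas group_simps = m_assoc inv_mult_group

lemma conj_by_closed [simp, intro]:
  "g \<in> carrier G \<Longrightarrow> x \<in> carrier G \<Longrightarrow> conj_by G g x \<in> carrier G"
  by (simp add: conj_by_def)

lemma conj_by_mult:
  "g \<in> carrier G \<Longrightarrow> x \<in> carrier G \<Longrightarrow> y \<in> carrier G \<Longrightarrow>
    conj_by G g (x \<otimes> y) = conj_by G g x \<otimes> conj_by G g y"
  by (simp add: conj_by_def group_simps)

lemma conj_by_one [simp]: "g \<in> carrier G \<Longrightarrow> conj_by G g \<one> = \<one>"
  by (simp add: conj_by_def)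

lemma conj_by_inv:
  "g \<in> carrier G \<Longrightarrow> x \<in> carrier G \<Longrightarrow> conj_by G g (inv x) = inv (conj_by G g x)"
  by (simp add: conj_by_def group_simps)

lemma conj_by_pow:
  assumes "g \<in> carrier G" "x \<in> carrier G"
  shows "conj_by G g (x [^] (n::nat)) = conj_by G g x [^] n"
  by (induction n) (use assms in \<open>auto simp: conj_by_mult\<close>)

lemma conj_by_conj_by:
  "g \<in> carrier G \<Longrightarrow> h \<in> carrier G \<Longrightarrow> x \<in> carrier G \<Longrightarrow>
    conj_by G h (conj_by G g x) = conj_by G (g \<otimes> h) x"
  by (simp add: conj_by_def group_simps)

lemma conj_by_one_left [simp]: "x \<in> carrier G \<Longrightarrow> conj_by G \<one> x = x"
  by (simp add: conj_by_def)

lemma conj_by_inv_cancel [simp]: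
  "g \<in> carrier G \<Longrightarrow> x \<in> carrier G \<Longrightarrow> conj_by G g (conj_by G (inv g) x) = x"
  "g \<in> carrier G \<Longrightarrow> x \<in> carrier G \<Longrightarrow> conj_by G (inv g) (conj_by G g x) = x"
  by (simp_all add: conj_by_def group_simps)

lemma conj_by_eq_self_iff:
  assumes "g \<in> carrier G" "x \<in> carrier G"
  shows "conj_by G g x = x \<longleftrightarrow> x \<otimes> g = g \<otimes> x"
proof -
  have "conj_by G g x = x \<longleftrightarrow> inv g \<otimes> (x \<otimes> g) = x"
    using assms by (simp add: conj_by_def m_assoc)
  also have "\<dots> \<longleftrightarrow> x \<otimes> g = g \<otimes> x"
    using assms inv_solve_left'[of x g "x \<otimes> g"] by auto
  finally show ?thesis .
qed

lemma inj_on_conj_by: "g \<in> carrier G \<Longrightarrow> inj_on (conj_by G g) (carrier G)"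
  by (rule inj_on_inverseI[where g = "conj_by G (inv g)"]) simp

lemma commutator_closed [simp, intro]:
  "x \<in> carrier G \<Longrightarrow> y \<in> carrier G \<Longrightarrow> commutator G x y \<in> carrier G"
  by (simp add: commutator_def)

lemma commutator_conv_conj_by:
  "x \<in> carrier G \<Longrightarrow> y \<in> carrier G \<Longrightarrow> commutator G x y = inv x \<otimes> conj_by G y x"
  by (simp add: commutator_def conj_by_def m_assoc)

lemma conj_by_conv_commutator:
  "x \<in> carrier G \<Longrightarrow> y \<in> carrier G \<Longrightarrow> conj_by G y x = x \<otimes> commutator G x y"
  by (simp add: commutator_conv_conj_by)

lemma commutator_eq_one_iff:
  assumes "x \<in> carrier G" "y \<in> carrier G"
  shows "commutator G x y = \<one> \<longleftrightarrow> x \<otimes> y = y \<otimes> x"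
proof -
  have "commutator G x y = \<one> \<longleftrightarrow> x \<otimes> commutator G x y = x"
    using assms by simp
  also have "\<dots> \<longleftrightarrow> x \<otimes> y = y \<otimes> x"
    using assms conj_by_eq_self_iff[of y x] conj_by_conv_commutator[of x y] by simp
  finally show ?thesis .
qed

lemma commutator_inv: 
  "x \<in> carrier G \<Longrightarrow> y \<in> carrier G \<Longrightarrow> inv (commutator G x y) = commutator G y x"
  by (simp add: commutator_def group_simps)

lemma commutator_one [simp]:
  "x \<in> carrier G \<Longrightarrow> commutator G x \<one> = \<one>" "x \<in> carrier G \<Longrightarrow> commutator G \<one> x = \<one>"
  by (simp_all add: commutator_eq_one_iff)

lemma commutator_mult_left:
  "a \<in> carrier G \<Longrightarrow> b \<in> carrier G \<Longrightarrow> x \<in> carrier G \<Longrightarrow>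
    commutator G (a \<otimes> b) x = conj_by G b (commutator G a x) \<otimes> commutator G b x"
  by (simp add: commutator_def conj_by_def group_simps)

lemma commutator_mult_right:
  "a \<in> carrier G \<Longrightarrow> b \<in> carrier G \<Longrightarrow> x \<in> carrier G \<Longrightarrow>
    commutator G x (a \<otimes> b) = commutator G x b \<otimes> conj_by G b (commutator G x a)"
  by (simp add: commutator_def conj_by_def group_simps)

lemma conj_by_commutator:
  "g \<in> carrier G \<Longrightarrow> x \<in> carrier G \<Longrightarrow> y \<in> carrier G \<Longrightarrow>
    conj_by G g (commutator G x y) = commutator G (conj_by G g x) (conj_by G g y)"
  by (simp add: commutator_def conj_by_def group_simps)

lemma comm_values_closed:
  assumes "X \<subseteq> carrier G" "k > 0"
  shows "comm_values k G X \<subseteq> carrier G"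
  using assms(2)
  by (induction k rule: nat_induct_non_zero) (use assms(1) in \<open>auto simp: comm_values_Suc\<close>)

lemma conj_closedD:
  assumes "conj_closed G X"
  shows "X \<subseteq> carrier G" "\<And>g x. g \<in> carrier G \<Longrightarrow> x \<in> X \<Longrightarrow> conj_by G g x \<in> X"
  using assms by (auto simp: conj_closed_def)

lemma conj_closed_comm_values:
  assumes X: "conj_closed G X" and "k > 0"
  shows "conj_closed G (comm_values k G X)"
  using assms(2)
proof (induction k rule: nat_induct_non_zero)
  case (Suc k)
  have "conj_by G g (commutator G c x) \<in> comm_values (Suc k) G X"
    if "g \<in> carrier G" "c \<in> comm_values k G X" "x \<in> X" for g c x
    using that Suc X conj_closedD[OF X] conj_closedD[OF Suc.IH]
    by (auto simp: conj_by_commutator subset_iff intro!: comm_values_SucI)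
  then show ?case
    using Suc conj_closedD[OF X] by (auto simp: conj_closed_def comm_values_Suc)
qed (use assms in auto)

lemma conj_closed_p_elements: "conj_closed G (p_elements G p)"
proof -
  have "conj_by G g x [^] (p ^ a) = \<one>" if "g \<in> carrier G" "x \<in> carrier G" "x [^] (p ^ a) = \<one>" for g x a
    using that by (simp flip: conj_by_pow)
  then show ?thesis
    unfolding conj_closed_def p_elements_def by blast
qed

lemma p_elements_closed: "p_elements G p \<subseteq> carrier G"
  by (auto simp: p_elements_def)

lemma one_p_elements [simp]: "\<one> \<in> p_elements G p"
  by (auto simp: p_elements_def)

lemma conj_closed_UN:
  assumes "\<And>i. i \<in> I \<Longrightarrow> conj_closed G (X i)"
  shows "conj_closed G (\<Union>i\<in>I. X i)"
  using assms unfolding conj_closed_def by blast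

lemma conj_closed_p_comm_values: "k > 0 \<Longrightarrow> conj_closed G (p_comm_values k G)"
  unfolding p_comm_values_def
  by (rule conj_closed_UN) (rule conj_closed_comm_values[OF conj_closed_p_elements])

lemma one_comm_values: 
  assumes "\<one> \<in> X" "k > 0" 
  shows "\<one> \<in> comm_values k G X"
  using assms(2)
proof (induction k rule: nat_induct_non_zero)
  case (Suc k)
  then show ?case using assms(1) comm_values_SucI[of k \<one> G X \<one>] by simp
qed (use assms in auto)

lemma one_p_comm_values: "k > 0 \<Longrightarrow> \<one> \<in> p_comm_values k G"
  unfolding p_comm_values_def
  by (rule UN_I[of 2]) (auto intro: one_comm_values two_is_prime_nat)

text \<open>\<open>[x_1, x_2]\<close> lies in the subgroup \<open>P\<close> again, so the first two
  entries can be merged into one. For a mere normal subset this may fail, which is why the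
  \<open>q\<close>-elements must first be shown to form a subgroup modulo the kernel of the
  transfer.\<close>

lemma comm_values_decreasing:
  assumes P: "subgroup P G" and "k > 0"
  shows "comm_values (Suc k) G P \<subseteq> comm_values k G P"
  using assms(2)
proof (induction k rule: nat_induct_non_zero)
  case 1
  then show ?case 
    by (auto simp: comm_values_Suc commutator_def intro!: subgroup.m_closed[OF P] subgroup.m_inv_closed[OF P])
next
  case (Suc n)
  have "comm_values (Suc (Suc n)) G P = {commutator G c x | c x. c \<in> comm_values (Suc n) G P \<and> x \<in> P}"
    by (rule comm_values_Suc) simp
  also have "\<dots> \<subseteq> {commutator G c x | c x. c \<in> comm_values n G P \<and> x \<in> P}"
    using Suc.IH by auto
  finally show ?case using Suc.hyps by (simp add: comm_values_Suc)
qed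

lemma normal_conj_by:
  assumes "N \<lhd> G" "g \<in> carrier G" "x \<in> N"
  shows "conj_by G g x \<in> N"
  using normal.inv_op_closed1[OF assms] by (simp add: conj_by_def)

lemma normalI_conj_by:
  assumes "subgroup N G" "\<And>g x. g \<in> carrier G \<Longrightarrow> x \<in> N \<Longrightarrow> conj_by G g x \<in> N"
  shows "N \<lhd> G"
proof (rule normal_invI[OF assms(1)])
  fix g x assume "g \<in> carrier G" "x \<in> N"
  then show "g \<otimes> x \<otimes> inv g \<in> N"
    using assms(2)[of "inv g" x] by (simp add: conj_by_def)
qed

lemma commutator_in_normal:
  assumes "N \<lhd> G" "g \<in> carrier G" "x \<in> N"
  shows "commutator G x g \<in> N" "commutator G g x \<in> N"
proof -
  interpret N: normal N G by fact
  show "commutator G x g \<in> N"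
    using assms normal_conj_by[OF assms] by (simp add: commutator_conv_conj_by)
  then show "commutator G g x \<in> N"
    using assms commutator_inv[of x g] N.m_inv_closed[of "commutator G x g"] N.mem_carrier[of x] by simp
qed

lemma conj_closed_generate_normal:
  assumes "conj_closed G X"
  shows "generate G X \<lhd> G"
proof (rule normal_generateI)
  fix h g assume "h \<in> X" "g \<in> carrier G"
  then show "g \<otimes> h \<otimes> inv g \<in> X"
    using conj_closedD(2)[OF assms, of "inv g" h] by (auto simp: conj_by_def)
qed (use conj_closedD[OF assms] in auto)

lemma subgroup_nat_pow_closed: "subgroup H G \<Longrightarrow> x \<in> H \<Longrightarrow> x [^] (n::nat) \<in> H"
  using subgroup_int_pow_closed[of H x "int n"] by (simp add: int_pow_int)

lemma coprime_pow_in_subgroup: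
  assumes H: "subgroup H G" and x: "x \<in> carrier G" and "x [^] (a::nat) \<in> H" "x [^] (b::nat) \<in> H"
    and "coprime a b"
  shows "x \<in> H"
proof -
  obtain u v where uv: "int a * u + int b * v = 1"
    using assms(5) bezout_int[of "int a" "int b"] by (auto simp: mult.commute)
  have "x = x [^] (int a * u + int b * v)" using uv x by simp
  also have "\<dots> = (x [^] a) [^] u \<otimes> (x [^] b) [^] v"
    using x by (simp add: int_pow_mult int_pow_pow flip: int_pow_int)
  also have "\<dots> \<in> H"
    using assms by (intro subgroup.m_closed[OF H] subgroup_int_pow_closed[OF H])
  finally show ?thesis .
qed

lemma coprime_pow_eq_one:
  assumes "x \<in> carrier G" "x [^] (a::nat) = \<one>" "x [^] (b::nat) = \<one>" "coprime a b"
  shows "x = \<one>"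
  using coprime_pow_in_subgroup[OF triv_subgroup, of x a b] assms by simp

lemma commutator_pow_left:
  assumes xg: "x \<in> carrier G" "g \<in> carrier G"
    and c: "commutator G x g \<otimes> x = x \<otimes> commutator G x g"
  shows "commutator G (x [^] (n::nat)) g = commutator G x g [^] n"
proof (induction n)
  case (Suc n)
  have "conj_by G x (commutator G x g [^] n) = commutator G x g [^] n"
    using xg c by (simp add: conj_by_pow iffD2[OF conj_by_eq_self_iff])
  then show ?case
    using xg Suc by (simp add: commutator_mult_left)
qed (use xg in simp)

lemma commutator_pow_right:
  assumes xg: "x \<in> carrier G" "g \<in> carrier G"
    and c: "commutator G x g \<otimes> g = g \<otimes> commutator G x g"
  shows "commutator G x (g [^] (n::nat)) = commutator G x g [^] n"
proof (induction n)
  case (Suc n)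
  have "conj_by G g (commutator G x g [^] n) = commutator G x g [^] n"
    using xg c by (simp add: conj_by_pow iffD2[OF conj_by_eq_self_iff])
  then show ?case
    using xg Suc by (simp add: commutator_mult_right flip: nat_pow_Suc2)
qed (use xg in simp)

text \<open>A commutator that commutes with both arguments turns powers of either one into powers of
  itself, so both \<open>a\<close> and \<open>b\<close> kill it.\<close>

lemma coprime_commutator_eq_one:
  assumes "x \<in> carrier G" "g \<in> carrier G" 
    and "commutator G x g \<otimes> x = x \<otimes> commutator G x g" "commutator G x g \<otimes> g = g \<otimes> commutator G x g"
    and "x [^] (a::nat) = \<one>" "g [^] (b::nat) = \<one>" "coprime a b"
  shows "commutator G x g = \<one>"
proof (rule coprime_pow_eq_one[OF _ _ _ assms(7)])
  show "commutator G x g [^] a = \<one>"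
    unfolding commutator_pow_left[OF assms(1-3), symmetric] assms(5) using assms(2) by simp
  show "commutator G x g [^] b = \<one>"
    unfolding commutator_pow_right[OF assms(1,2,4), symmetric] assms(6) using assms(1) by simp
qed (use assms(1,2) in simp)

end

section \<open>Commutators under homomorphisms\<close>

context group_hom begin

lemma hom_commutator:
  "x \<in> carrier G \<Longrightarrow> y \<in> carrier G \<Longrightarrow> h (commutator G x y) = commutator H (h x) (h y)"
  by (simp add: commutator_def)

lemma hom_conj_by:
  "x \<in> carrier G \<Longrightarrow> y \<in> carrier G \<Longrightarrow> h (conj_by G x y) = conj_by H (h x) (h y)"
  by (simp add: conj_by_def)

lemma image_comm_values:
  assumes "X \<subseteq> carrier G" "k > 0"
  shows "h ` comm_values k G X = comm_values k H (h ` X)"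
  using assms(2)
proof (induction k rule: nat_induct_non_zero)
  case (Suc k)
  have "h ` comm_values (Suc k) G X = {commutator H (h c) (h x) | c x. c \<in> comm_values k G X \<and> x \<in> X}"
  proof -
    have "h (commutator G c x) = commutator H (h c) (h x)" if "c \<in> comm_values k G X" "x \<in> X" for c x
      using that assms(1) G.comm_values_closed[OF assms(1) Suc.hyps] by (intro hom_commutator) auto
    then show ?thesis
      unfolding comm_values_Suc[OF Suc.hyps] image_Collect by (intro Collect_cong) metis
  qed
  also have "\<dots> = comm_values (Suc k) H (h ` X)"
    unfolding comm_values_Suc[OF Suc.hyps] Suc.IH[symmetric] by blast
  finally show ?case .
qed auto

end

section \<open>Torsion elements and relative upper central series\<close>

context group begin

lemma quotient_hom: "N \<lhd> G \<Longrightarrow> group_hom G (G Mod N) (\<lambda>a. N #> a)"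
  by (simp add: group_hom_def group_hom_axioms_def normal.factorgroup_is_group normal.r_coset_hom_Mod is_group)

lemma quotient_eq_one_iff: 
  assumes "N \<lhd> G" "a \<in> carrier G"
  shows "N #> a = \<one>\<^bsub>G Mod N\<^esub> \<longleftrightarrow> a \<in> N"
proof -
  have N: "subgroup N G" using assms(1) by (rule normal_imp_subgroup)
  have "N #> a = N \<longleftrightarrow> a \<in> N"
    using coset_join1[OF _ _ N, of a] coset_join2[OF _ N, of a] assms(2) subgroup.subset[OF N] by blast
  then show ?thesis by simp
qed

lemma finite_quotient: "finite (carrier G) \<Longrightarrow> finite (carrier (G Mod N))"
  by (simp add: carrier_FactGroup)

lemma subgroup_pow_carrier_update: "x [^]\<^bsub>G\<lparr>carrier := H\<rparr>\<^esub> (n::nat) = x [^] n"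
  by (simp add: nat_pow_def)

end

text \<open>\<open>a\<close> collects the primes that \<open>n\<close> shares with \<open>s\<close>,
  and \<open>b\<close> the others; \<open>gcd n s\<close> is split off repeatedly.\<close>

lemma coprime_part:
  assumes "n > (0::nat)" "s > 0"
  shows "\<exists>a b j. n = a * b \<and> coprime b s \<and> a dvd s ^ j"
  using assms(1)
proof (induction n rule: less_induct)
  case (less n)
  show ?case
  proof (cases "coprime n s")
    case True
    then show ?thesis by (intro exI[of _ 1] exI[of _ n] exI[of _ 0]) auto
  next
    case False
    define d where "d = gcd n s"
    obtain m where m: "n = d * m" unfolding d_def by (meson dvdE gcd_dvd1)
    have "d > 1" using False less.prems unfolding d_def coprime_iff_gcd_eq_1
      by (metis One_nat_def gcd_pos_nat less_one linorder_neqE_nat neq0_conv)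
    then have "m < n" "m > 0" using m less.prems by auto
    with less.IH obtain a b j where abj: "m = a * b" "coprime b s" "a dvd s ^ j" by blast
    have "d * a dvd s ^ Suc j" using abj(3) by (simp add: d_def mult_dvd_mono)
    with abj m show ?thesis by (metis mult.assoc)
  qed
qed

text \<open>An \<open>e\<close>-th power with \<open>e\<close> congruent to 1 modulo
  \<open>s\<close> fixes every element killed by \<open>s\<close>, and turns an element killed by
  \<open>n\<close> into one killed by a power of \<open>s\<close>. Raising a preimage to the power
  \<open>e\<close> thus corrects its order without moving its image.\<close>

lemma torsion_exponent:
  assumes "n > (0::nat)" "s > 0"
  shows "\<exists>e v j. e = s * v + 1 \<and> n dvd e * s ^ j"
proof -
  obtain a b j where abj: "n = a * b" "coprime b s" "a dvd s ^ j"
    using coprime_part[OF assms] by blast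
  have "b \<noteq> 0" using assms(1) abj by auto
  then obtain u v where uv: "b * u = s * v + 1"
    using bezout_nat[of b s] abj(2) by auto
  have "n dvd (b * u) * s ^ j"
    unfolding abj(1) mult.commute[of a b] mult.assoc using abj(3) by (intro mult_dvd_mono dvd_mult) auto
  then show ?thesis using uv by blast
qed

lemma (in group_hom) lift_torsion_element:
  assumes "finite (carrier G)" "x \<in> carrier G" "s > 0" "h x [^]\<^bsub>H\<^esub> (s::nat) = \<one>\<^bsub>H\<^esub>"
  shows "\<exists>n j. h (x [^] (n::nat)) = h x \<and> (x [^] n) [^] (s ^ j) = \<one>"
proof -
  have "order G > 0" using assms(1) G.order_gt_0_iff_finite by simp
  then obtain e v j where e: "e = s * v + 1" "order G dvd e * s ^ j"
    using torsion_exponent assms(3) by blast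
  have "h (x [^] e) = (h x [^]\<^bsub>H\<^esub> s) [^]\<^bsub>H\<^esub> v \<otimes>\<^bsub>H\<^esub> h x"
    using assms(2) by (simp add: e(1) hom_nat_pow H.nat_pow_pow)
  then have "h (x [^] e) = h x"
    using assms(2,4) by simp
  moreover obtain w where w: "e * s ^ j = order G * w" using e(2) by (elim dvdE)
  have "(x [^] e) [^] (s ^ j) = (x [^] order G) [^] w"
    using assms(2) by (simp add: G.nat_pow_pow w)
  then have "(x [^] e) [^] (s ^ j) = \<one>"
    using assms(2) by (simp add: G.pow_order_eq_1)
  ultimately show ?thesis by blast
qed

lemma (in group_hom) lift_p_element:
  assumes "finite (carrier G)" "h ` carrier G = carrier H" "y \<in> p_elements H p" "p > 0"
  shows "\<exists>x\<in>p_elements G p. h x = y"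
proof -
  obtain a where a: "y \<in> carrier H" "y [^]\<^bsub>H\<^esub> (p ^ a) = \<one>\<^bsub>H\<^esub>"
    using assms(3) by (auto simp: p_elements_def)
  then obtain x where x: "x \<in> carrier G" "h x = y"
    unfolding assms(2)[symmetric] by (elim imageE) simp
  obtain n j where "h (x [^] (n::nat)) = h x" "(x [^] n) [^] ((p ^ a) ^ j) = \<one>"
    using lift_torsion_element[OF assms(1) x(1), of "p ^ a"] a x assms(4) by auto
  then show ?thesis
    using x by (intro bexI[of _ "x [^] n"]) (auto simp: p_elements_def simp flip: power_mult)
qed

lemma (in group_hom) image_p_elements:
  assumes "finite (carrier G)" "h ` carrier G = carrier H" "p > 0"
  shows "h ` p_elements G p = p_elements H p"
proof (intro equalityI subsetI)
  fix y assume "y \<in> h ` p_elements G p"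
  then obtain x a where x: "x \<in> carrier G" "x [^] (p ^ a) = \<one>" "y = h x"
    by (auto simp: p_elements_def)
  then have "y [^]\<^bsub>H\<^esub> (p ^ a) = \<one>\<^bsub>H\<^esub>"
    using hom_nat_pow[of x "p ^ a"] by simp
  then show "y \<in> p_elements H p"
    using x by (auto simp: p_elements_def)
next
  fix y assume "y \<in> p_elements H p"
  then show "y \<in> h ` p_elements G p"
    using lift_p_element[OF assms(1,2) _ assms(3)] by blast
qed

text \<open>The acting elements are restricted to \<open>X\<close>, so that the vanishing of
  commutators with entries in \<open>X\<close> can be exploited before \<open>X\<close> is known to
  be a subgroup. The choice \<open>X = carrier G\<close> gives the usual upper central
  series.\<close>

primrec upper_central :: "('a, 'b) monoid_scheme \<Rightarrow> 'a set \<Rightarrow> nat \<Rightarrow> 'a set" where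
  "upper_central G X 0 = {\<one>\<^bsub>G\<^esub>}"
| "upper_central G X (Suc n) = {c \<in> carrier G. \<forall>x\<in>X. commutator G c x \<in> upper_central G X n}"

context group begin

lemma commutator_inv_left:
  assumes "c \<in> carrier G" "x \<in> carrier G"
  shows "commutator G (inv c) x = conj_by G (inv c) (inv (commutator G c x))"
  using assms by (simp add: commutator_def conj_by_def group_simps)

lemma commutator_inv_right:
  assumes "c \<in> carrier G" "x \<in> carrier G"
  shows "commutator G c (inv x) = conj_by G (inv x) (inv (commutator G c x))"
  using assms by (simp add: commutator_def conj_by_def group_simps)

text \<open>Stability under conjugation rests on \<open>[c^g, x] = [c, x^h]^g\<close> with
  \<open>h = inv g\<close>: conjugation permutes \<open>X\<close>.\<close>

lemma normal_upper_central:
  assumes X: "conj_closed G X"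
  shows "upper_central G X n \<lhd> G"
proof (induction n)
  case 0
  then show ?case by (simp add: one_is_normal)
next
  case (Suc n)
  note N = Suc.IH
  interpret N: normal "upper_central G X n" G by (rule N)
  have Xc: "X \<subseteq> carrier G" using X by (rule conj_closedD)
  have *: "x \<in> X \<Longrightarrow> x \<in> carrier G" for x using Xc by auto
  show ?case
  proof (rule normalI_conj_by)
    show "subgroup (upper_central G X (Suc n)) G"
    proof (rule subgroupI)
      show "upper_central G X (Suc n) \<subseteq> carrier G" by auto
      show "upper_central G X (Suc n) \<noteq> {}" using * by (auto intro!: exI[of _ \<one>])
    next
      fix a assume "a \<in> upper_central G X (Suc n)"
      then show "inv a \<in> upper_central G X (Suc n)"
        using * by (auto simp: commutator_inv_left intro!: normal_conj_by[OF N])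
    next
      fix a b assume "a \<in> upper_central G X (Suc n)" "b \<in> upper_central G X (Suc n)"
      then show "a \<otimes> b \<in> upper_central G X (Suc n)"
        using * by (auto simp: commutator_mult_left intro!: normal_conj_by[OF N])
    qed
  next
    fix g c assume g: "g \<in> carrier G" and c: "c \<in> upper_central G X (Suc n)"
    have "commutator G (conj_by G g c) x \<in> upper_central G X n" if "x \<in> X" for x
    proof -
      have "conj_by G (inv g) x \<in> X" using g that conj_closedD(2)[OF X] by simp
      then have "conj_by G g (commutator G c (conj_by G (inv g) x)) \<in> upper_central G X n"
        using c g by (intro normal_conj_by[OF N]) auto
      then show ?thesis using g c that * by (simp add: conj_by_commutator)
    qed
    then show "conj_by G g c \<in> upper_central G X (Suc n)" using g c by auto
  qed
qed

text \<open>The \<open>g\<close> with \<open>[c, g]\<close> in \<open>N\<close> form the centralizer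
  of \<open>c\<close> modulo \<open>N\<close>, a subgroup.\<close>

lemma commutator_generate_in_normal:
  assumes N: "N \<lhd> G" and X: "X \<subseteq> carrier G" and c: "c \<in> carrier G" 
    and "\<And>x. x \<in> X \<Longrightarrow> commutator G c x \<in> N" and "g \<in> generate G X"
  shows "commutator G c g \<in> N"
  using assms(5)
proof (induction g rule: generate.induct)
  interpret N: normal N G by (rule N)
  {
    case one
    then show ?case using c by simp
  next
    case (incl h)
    then show ?case by (rule assms(4))
  next
    case (inv h)
    then have h: "h \<in> carrier G" using X by auto
    show ?case unfolding commutator_inv_right[OF c h]
      using h by (intro normal_conj_by[OF N] N.m_inv_closed assms(4) inv) simp
  next
    case (eng h1 h2)
    then have h: "h1 \<in> carrier G" "h2 \<in> carrier G" using generate_in_carrier[OF X] by auto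
    show ?case unfolding commutator_mult_right[OF h c]
      using h by (intro normal_conj_by[OF N] N.m_closed eng) simp
  }
qed

lemma upper_central_commutator:
  assumes X: "conj_closed G X" and "c \<in> upper_central G X (Suc n)" "g \<in> generate G X"
  shows "commutator G c g \<in> upper_central G X n"
  using assms conj_closedD(1)[OF X]
  by (intro commutator_generate_in_normal[OF normal_upper_central[OF X] _ _ _ assms(3)]) auto

text \<open>A value of length \<open>k - i\<close> lies in level \<open>i\<close> because all its
  prolongations by elements of \<open>X\<close> lie in the level below. Length 1 is reached at level
  \<open>k - 1\<close>.\<close>

lemma subset_upper_central:
  assumes X: "conj_closed G X" and k: "k > 0" and triv: "comm_values k G X \<subseteq> {\<one>}"
  shows "X \<subseteq> upper_central G X (k - 1)"
proof -
  have "comm_values (k - i) G X \<subseteq> upper_central G X i" if "i < k" for i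
    using that
  proof (induction i)
    case 0
    then show ?case using triv by simp
  next
    case (Suc i)
    have "commutator G c x \<in> upper_central G X i" if c: "c \<in> comm_values (k - Suc i) G X" "x \<in> X" for c x
    proof -
      have "commutator G c x \<in> comm_values (Suc (k - Suc i)) G X"
        using Suc.prems that by (intro comm_values_SucI) auto
      then show ?thesis using Suc by (auto simp: Suc_diff_Suc)
    qed
    moreover have "comm_values (k - Suc i) G X \<subseteq> carrier G"
      using Suc.prems by (intro comm_values_closed conj_closedD[OF X]) auto
    ultimately show ?case by auto
  qed
  from this[of "k - 1"] show ?thesis using k by simp
qed

text \<open>If \<open>[x, g]\<close> lies in level \<open>n + 1\<close>, it commutes with
  \<open>x\<close> and \<open>g\<close> modulo level \<open>n\<close>, so the coprime orders push it
  down into level \<open>n\<close>.\<close>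

lemma coprime_commute_upper_central:
  assumes X: "conj_closed G X" and s: "X \<subseteq> upper_central G X s"
    and x: "x \<in> X" "x [^] (a::nat) = \<one>" and g: "g \<in> generate G X" "g [^] (b::nat) = \<one>" and "coprime a b"
  shows "commutator G x g = \<one>"
proof -
  have Xc: "X \<subseteq> carrier G" using X by (rule conj_closedD)
  have c: "x \<in> carrier G" "g \<in> carrier G" using x g generate_in_carrier[OF Xc] Xc by auto
  \<comment> \<open>The subtraction is truncated: after level 0 is reached, the induction step is
    trivial.\<close>
  have "commutator G x g \<in> upper_central G X (s - i)" for i
  proof (induction i)
    case 0
    show ?case using commutator_in_normal(1)[OF normal_upper_central[OF X], of g x s] c s x by auto
  next
    case (Suc i)
    show ?case
    proof (cases "s - i")
      case (Suc n)
      define N where "N = upper_central G X n"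
      have N: "N \<lhd> G" unfolding N_def by (rule normal_upper_central[OF X])
      interpret q: group_hom G "G Mod N" "\<lambda>a. N #> a" by (rule quotient_hom[OF N])
      let ?w = "commutator G x g"
      have w: "?w \<in> upper_central G X (Suc n)" using Suc.IH Suc by simp
      have comm: "(N #> ?w) \<otimes>\<^bsub>G Mod N\<^esub> (N #> y) = (N #> y) \<otimes>\<^bsub>G Mod N\<^esub> (N #> ?w)"
        if "y \<in> generate G X" for y
      proof -
        have y: "y \<in> carrier G" using that generate_in_carrier[OF Xc] by auto
        have "commutator G ?w y \<in> N" unfolding N_def by (rule upper_central_commutator[OF X w that])
        then have "N #> commutator G ?w y = \<one>\<^bsub>G Mod N\<^esub>"
          using c y by (subst quotient_eq_one_iff[OF N]) auto
        then have "commutator (G Mod N) (N #> ?w) (N #> y) = \<one>\<^bsub>G Mod N\<^esub>"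
          using q.hom_commutator[of ?w y] c y by simp
        then show ?thesis
          using q.H.commutator_eq_one_iff[of "N #> ?w" "N #> y"] c y q.hom_closed by blast
      qed
      have w': "N #> ?w = commutator (G Mod N) (N #> x) (N #> g)"
        using q.hom_commutator[of x g] c by simp
      have pw: "(N #> x) [^]\<^bsub>G Mod N\<^esub> a = \<one>\<^bsub>G Mod N\<^esub>" "(N #> g) [^]\<^bsub>G Mod N\<^esub> b = \<one>\<^bsub>G Mod N\<^esub>"
        using q.hom_nat_pow[of x a] q.hom_nat_pow[of g b] c x(2) g(2) q.hom_one by (simp_all del: one_FactGroup)
      have "commutator (G Mod N) (N #> x) (N #> g) = \<one>\<^bsub>G Mod N\<^esub>"
        using comm[OF generate.incl[OF x(1)]] comm[OF g(1)] q.hom_closed c pw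
        unfolding w' by (intro q.H.coprime_commutator_eq_one[OF _ _ _ _ _ _ \<open>coprime a b\<close>])
      then have "?w \<in> N"
        using w' quotient_eq_one_iff[OF N, of ?w] c by (simp del: one_FactGroup)
      then show ?thesis using Suc by (simp add: N_def Suc_diff_Suc diff_Suc)
    next
      case 0
      then show ?thesis using Suc.IH by (simp add: diff_Suc)
    qed
  qed
  from this[of s] show ?thesis by simp
qed

end

section \<open>Sylow subgroups and groups generated by \<open>p\<close>-elements\<close>

context group begin

lemma sylow_subgroup_ex:
  assumes "finite (carrier G)" "prime q"
  shows "\<exists>R. subgroup R G \<and> card R = q ^ multiplicity q (order G)"
proof -
  obtain m where "order G = q ^ multiplicity q (order G) * m"
    using multiplicity_dvd by blast
  then show ?thesis
    using sylow_thm[OF assms(2) is_group _ assms(1)] by blast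
qed

lemma p_subgroup_subset_p_elements:
  assumes "subgroup R G" "card R = p ^ a" 
  shows "R \<subseteq> p_elements G p"
proof
  fix x assume x: "x \<in> R"
  interpret R: group "G\<lparr>carrier := R\<rparr>" using subgroup_imp_group[OF assms(1)] .
  have "x [^] (p ^ a) = \<one>"
    using R.pow_order_eq_1[of x] x assms(2) by (simp add: order_def subgroup_pow_carrier_update)
  then show "x \<in> p_elements G p"
    using x subgroup.mem_carrier[OF assms(1)] by (auto simp: p_elements_def)
qed

lemma card_subgroup_dvd:
  assumes "subgroup R G" "subgroup S G" "R \<subseteq> S"
  shows "card R dvd card S"
proof -
  interpret S: group "G\<lparr>carrier := S\<rparr>" using subgroup_imp_group[OF assms(2)] .
  have "subgroup R (G\<lparr>carrier := S\<rparr>)" using subgroup_incl[OF assms] .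
  from S.lagrange[OF this] have "card S = card (rcosets\<^bsub>G\<lparr>carrier := S\<rparr>\<^esub> R) * card R"
    by (simp add: order_def)
  then show ?thesis by (metis dvd_triv_right)
qed

text \<open>For every prime \<open>q\<close> the full \<open>q\<close>-part of
  \<open>order G\<close> divides \<open>card S\<close>, hence \<open>order G\<close> does.\<close>

lemma subgroup_containing_sylows_eq_carrier:
  assumes fin: "finite (carrier G)" and S: "subgroup S G"
    and R: "\<And>q. prime q \<Longrightarrow> \<exists>R. subgroup R G \<and> card R = q ^ multiplicity q (order G) \<and> R \<subseteq> S"
  shows "S = carrier G"
proof -
  have sub: "S \<subseteq> carrier G" using S by (rule subgroup.subset)
  have pos: "order G > 0" "card S > 0"
    using fin order_gt_0_iff_finite subgroup.finite_imp_card_positive[OF S fin] by auto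
  have "order G dvd card S"
  proof (rule multiplicity_le_imp_dvd)
    fix q :: nat assume q: "prime q"
    then obtain R where "subgroup R G" "card R = q ^ multiplicity q (order G)" "R \<subseteq> S"
      using R by blast
    then have "q ^ multiplicity q (order G) dvd card S"
      using card_subgroup_dvd[OF _ S] by metis
    then show "multiplicity q (order G) \<le> multiplicity q (card S)"
      using pos q by (intro multiplicity_geI) auto
  qed (use pos in auto)
  then have "card (carrier G) \<le> card S"
    using pos dvd_imp_le by (auto simp: order_def)
  then show ?thesis using card_seteq[OF fin sub] by simp
qed

lemma generate_p_elements:
  assumes fin: "finite (carrier G)" 
  shows "generate G (\<Union>p\<in>{p. prime p}. p_elements G p) = carrier G"
proof (rule subgroup_containing_sylows_eq_carrier[OF fin])
  show "subgroup (generate G (\<Union>p\<in>{p. prime p}. p_elements G p)) G"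
    by (rule generate_is_subgroup) (use p_elements_closed in blast)
next
  fix q :: nat assume q: "prime q"
  then obtain R where R: "subgroup R G" "card R = q ^ multiplicity q (order G)"
    using sylow_subgroup_ex[OF fin] by blast
  have "R \<subseteq> p_elements G q" using p_subgroup_subset_p_elements R by blast
  also have "\<dots> \<subseteq> (\<Union>p\<in>{p. prime p}. p_elements G p)" using q by auto
  also have "\<dots> \<subseteq> generate G (\<Union>p\<in>{p. prime p}. p_elements G p)" by (auto intro: generate.incl)
  finally show "\<exists>R. subgroup R G \<and> card R = q ^ multiplicity q (order G) \<and>
      R \<subseteq> generate G (\<Union>p\<in>{p. prime p}. p_elements G p)"
    using R by blast
qed

lemma pow_mult_exponent_one:
  assumes "x \<in> carrier G" "x [^] (a::nat) = \<one>" "a dvd b"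
  shows "x [^] b = \<one>"
proof -
  obtain c where "b = a * c" using assms(3) ..
  then have "x [^] b = (x [^] a) [^] c" using assms(1) by (simp add: nat_pow_pow)
  then show ?thesis using assms(2) by simp
qed

text \<open>The group \<open>K\<close> generated by the \<open>r\<close>-elements turns out to be
  the product of a Sylow \<open>r\<close>-subgroup \<open>R\<close> and the group \<open>A\<close>
  of its elements of order prime to \<open>r\<close>. As the two factors commute, every
  \<open>r\<close>-element lies in \<open>R\<close>.\<close>

lemma subgroup_p_elements:
  assumes fin: "finite (carrier G)" and r: "prime r" and s: "s > 0"
    and triv: "comm_values s G (p_elements G r) \<subseteq> {\<one>}"
  shows "subgroup (p_elements G r) G"
proof -
  define X where "X = p_elements G r"
  define K where "K = generate G X"
  have X: "conj_closed G X" unfolding X_def by (rule conj_closed_p_elements)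
  have Xc: "X \<subseteq> carrier G" using X by (rule conj_closedD)
  have Xs: "X \<subseteq> upper_central G X (s - 1)"
    using subset_upper_central[OF X s] triv by (simp add: X_def)
  have K: "subgroup K G" unfolding K_def by (rule generate_is_subgroup[OF Xc])
  have Kc: "K \<subseteq> carrier G" using K by (rule subgroup.subset)
  have XK: "X \<subseteq> K" unfolding K_def by (auto intro: generate.incl)
  have finK: "finite K" using finite_subset[OF Kc fin] .
  let ?K = "G\<lparr>carrier := K\<rparr>"
  interpret K: group ?K using subgroup_imp_group[OF K] .
  have finK': "finite (carrier ?K)" using finK by simp
  obtain R where R: "subgroup R ?K" "card R = r ^ multiplicity r (order ?K)"
    using K.sylow_subgroup_ex[OF finK' r] by blast
  have RG: "subgroup R G" using incl_subgroup[OF K R(1)] .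
  have RX: "R \<subseteq> X" unfolding X_def using p_subgroup_subset_p_elements[OF RG R(2)] .
  \<comment> \<open>By coprimality along the relative upper central series, elements of
    \<open>A\<close> commute with \<open>X\<close> and so with all of \<open>K\<close>. Only this
    makes \<open>A\<close> closed under products.\<close>
  define A where "A = {g \<in> K. \<exists>t. coprime t r \<and> g [^] (t::nat) = \<one>}"
  have AX: "g \<otimes> x = x \<otimes> g" if "g \<in> A" "x \<in> X" for g x
  proof -
    obtain t where t: "coprime t r" "g [^] t = \<one>" "g \<in> K" using \<open>g \<in> A\<close> by (auto simp: A_def)
    obtain a where a: "x [^] (r ^ a) = \<one>" using \<open>x \<in> X\<close> by (auto simp: X_def p_elements_def)
    have "commutator G x g = \<one>"
      using t by (intro coprime_commute_upper_central[OF X Xs that(2) a _ t(2)])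
        (auto simp: K_def coprime_commute)
    then show ?thesis
      using commutator_eq_one_iff[OF subsetD[OF Xc that(2)] subsetD[OF Kc t(3)]] by metis
  qed
  have AK1: "commutator G g x = \<one>" if "g \<in> A" "x \<in> K" for g x
  proof -
    have g: "g \<in> carrier G" using that Kc by (auto simp: A_def)
    have "commutator G g x \<in> {\<one>}"
    proof (rule commutator_generate_in_normal[OF one_is_normal Xc g])
      fix y assume "y \<in> X"
      then show "commutator G g y \<in> {\<one>}"
        using AX[OF that(1)] commutator_eq_one_iff[OF g subsetD[OF Xc]] by blast
    qed (use that K_def in auto)
    then show ?thesis by simp
  qed
  have AK: "g \<otimes> x = x \<otimes> g" if "g \<in> A" "x \<in> K" for g x
  proof -
    have "g \<in> K" using that by (simp add: A_def)
    then show ?thesis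
      using AK1[OF that] commutator_eq_one_iff[of g x] that Kc by (simp add: subset_iff)
  qed
  have A: "subgroup A G"
  proof (rule subgroupI)
    show "A \<subseteq> carrier G" using Kc by (auto simp: A_def)
    have "\<one> \<in> A" using subgroup.one_closed[OF K] by (auto simp: A_def intro!: exI[of _ 1])
    then show "A \<noteq> {}" by auto
  next
    fix g assume "g \<in> A"
    then obtain t where t: "g \<in> K" "coprime t r" "g [^] t = \<one>" by (auto simp: A_def)
    then show "inv g \<in> A" 
      using Kc subgroup.m_inv_closed[OF K] by (auto simp: A_def nat_pow_inv subset_iff intro!: exI[of _ t])
  next
    fix g h assume gh: "g \<in> A" "h \<in> A"
    then obtain t u where t: "g \<in> K" "coprime t r" "g [^] t = \<one>" and u: "h \<in> K" "coprime u r" "h [^] u = \<one>"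
      by (auto simp: A_def)
    have c: "g \<in> carrier G" "h \<in> carrier G" using t u Kc by auto
    have "(g \<otimes> h) [^] (t * u) = g [^] (t * u) \<otimes> h [^] (t * u)"
      using AK[OF gh(1) u(1)] c by (intro pow_mult_distrib)
    also have "\<dots> = \<one>"
      using c pow_mult_exponent_one[OF c(1) t(3), of "t * u"] pow_mult_exponent_one[OF c(2) u(3), of "t * u"] by simp
    finally have "\<exists>v. coprime v r \<and> (g \<otimes> h) [^] (v::nat) = \<one>"
      using t u by (intro exI[of _ "t * u"]) (simp add: coprime_mult_left_iff)
    then show "g \<otimes> h \<in> A" using t u subgroup.m_closed[OF K] by (auto simp: A_def)
  qed
  have AsubK: "A \<subseteq> K" by (auto simp: A_def)
  have RK: "R \<subseteq> K" using RX XK by auto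
  have comm: "a \<otimes> x = x \<otimes> a" if "a \<in> A" "x \<in> R" for a x
    using AK that RK by auto
  \<comment> \<open>\<open>S\<close> contains \<open>R\<close>, and for every other prime the Sylow
    subgroups lie in \<open>A\<close>; so \<open>S\<close> is all of \<open>K\<close>.\<close>
  define S where "S = {x \<otimes> a | x a. x \<in> R \<and> a \<in> A}"
  have cR: "x \<in> carrier G" if "x \<in> R" for x using that RK Kc by auto
  have cA: "x \<in> carrier G" if "x \<in> A" for x using that AsubK Kc by auto
  have SK: "S \<subseteq> K" using RK AsubK subgroup.m_closed[OF K] by (auto simp: S_def)
  have S: "subgroup S G"
  proof (rule subgroupI)
    show "S \<subseteq> carrier G" using SK Kc by auto
    show "S \<noteq> {}" using subgroup.one_closed[OF RG] subgroup.one_closed[OF A] by (auto simp: S_def)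
  next
    fix y assume "y \<in> S"
    then obtain x a where xa: "y = x \<otimes> a" "x \<in> R" "a \<in> A" by (auto simp: S_def)
    have i: "inv x \<in> R" "inv a \<in> A" 
      using xa subgroup.m_inv_closed[OF RG] subgroup.m_inv_closed[OF A] by auto
    have "inv y = inv a \<otimes> inv x" using xa cR cA by (simp add: inv_mult_group)
    then have "inv y = inv x \<otimes> inv a" using comm[OF i(2,1)] by simp
    then show "inv y \<in> S" using i S_def by blast
  next
    fix y z assume "y \<in> S" "z \<in> S"
    then obtain x a x' a' where xa: "y = x \<otimes> a" "x \<in> R" "a \<in> A" "z = x' \<otimes> a'" "x' \<in> R" "a' \<in> A"
      by (auto simp: S_def)
    have "y \<otimes> z = x \<otimes> (a \<otimes> x') \<otimes> a'" using xa cR cA by (simp add: m_assoc)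
    also have "\<dots> = (x \<otimes> x') \<otimes> (a \<otimes> a')" 
      unfolding comm[OF xa(3,5)] using xa cR cA by (simp add: m_assoc)
    finally show "y \<otimes> z \<in> S"
      using xa subgroup.m_closed[OF RG] subgroup.m_closed[OF A] S_def by blast
  qed
  have "S = carrier ?K"
  proof (rule K.subgroup_containing_sylows_eq_carrier[OF finK'])
    show "subgroup S ?K" using subgroup_incl[OF S K SK] .
  next
    fix q :: nat assume q: "prime q"
    obtain Q where Q: "subgroup Q ?K" "card Q = q ^ multiplicity q (order ?K)"
      using K.sylow_subgroup_ex[OF finK' q] by blast
    have QG: "subgroup Q G" using incl_subgroup[OF K Q(1)] .
    show "\<exists>Q. subgroup Q ?K \<and> card Q = q ^ multiplicity q (order ?K) \<and> Q \<subseteq> S"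
    proof (cases "q = r")
      case True
      have "R \<subseteq> S"
      proof
        fix x assume "x \<in> R"
        then show "x \<in> S" using subgroup.one_closed[OF A] cR[of x] unfolding S_def 
          by (intro CollectI exI[of _ x] exI[of _ \<one>]) auto
      qed
      then show ?thesis using R True by blast
    next
      case False
      have "Q \<subseteq> S"
      proof
        fix x assume x: "x \<in> Q"
        then obtain b where b: "x [^] (q ^ b) = \<one>" "x \<in> carrier G"
          using p_subgroup_subset_p_elements[OF QG Q(2)] by (auto simp: p_elements_def)
        have "coprime (q ^ b) r" using False q r by (simp add: primes_coprime)
        then have "\<exists>t. coprime t r \<and> x [^] (t::nat) = \<one>" using b(1) by blast
        then have "x \<in> A" using x subgroup.subset[OF Q(1)] by (auto simp: A_def)
        then show "x \<in> S" using subgroup.one_closed[OF RG] b(2) unfolding S_def 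
          by (intro CollectI exI[of _ \<one>] exI[of _ x]) auto
      qed
      then show ?thesis using Q by blast
    qed
  qed
  then have SK: "S = K" by simp
  \<comment> \<open>In \<open>x = y a\<close> the factor \<open>a\<close> is killed by a power of
    \<open>r\<close> and by a number prime to \<open>r\<close>, so it is trivial.\<close>
  have "X \<subseteq> R"
  proof
    fix x assume x: "x \<in> X"
    then obtain y a where ya: "x = y \<otimes> a" "y \<in> R" "a \<in> A" using XK SK unfolding S_def by blast
    obtain b where b: "x [^] (r ^ b) = \<one>" using x by (auto simp: X_def p_elements_def)
    obtain c where c: "y [^] (r ^ c) = \<one>" using ya RX by (auto simp: X_def p_elements_def)
    obtain t where t: "coprime t r" "a [^] t = \<one>" using ya A_def by auto
    have car: "y \<in> carrier G" "a \<in> carrier G" "x \<in> carrier G" using ya cR cA x Xc by auto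
    have "x [^] (r ^ (b + c)) = y [^] (r ^ (b + c)) \<otimes> a [^] (r ^ (b + c))"
      unfolding ya(1) using car comm[OF ya(3,2)] by (intro pow_mult_distrib) auto
    moreover have "x [^] (r ^ (b + c)) = \<one>" "y [^] (r ^ (b + c)) = \<one>"
      using pow_mult_exponent_one[OF car(3) b] pow_mult_exponent_one[OF car(1) c]
      by (auto simp: power_add)
    ultimately have "a [^] (r ^ (b + c)) = \<one>" using car by simp
    then have "a = \<one>" using t car by (intro coprime_pow_eq_one[of a _ t]) (auto simp: coprime_commute)
    then show "x \<in> R" using ya car by simp
  qed
  then have "X = R" using RX by auto
  then show ?thesis using RG X_def by simp
qed

text \<open>The \<open>p\<close>-elements form a normal subgroup for each prime \<open>p\<close>,
  and those for distinct primes commute. So values with entries in the union \<open>Y\<close>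
  vanish, and since \<open>Y\<close> generates \<open>G\<close>, the series relative to
  \<open>Y\<close> controls commutators with arbitrary entries.\<close>

lemma comm_values_trivial:
  assumes fin: "finite (carrier G)" and k: "k > 0"
    and triv: "\<And>p. prime p \<Longrightarrow> comm_values k G (p_elements G p) \<subseteq> {\<one>}"
  shows "comm_values k G (carrier G) \<subseteq> {\<one>}"
proof -
  define Y where "Y = (\<Union>p\<in>{p. prime p}. p_elements G p)"
  have Y: "conj_closed G Y" unfolding Y_def by (intro conj_closed_UN conj_closed_p_elements)
  have genY: "generate G Y = carrier G" unfolding Y_def by (rule generate_p_elements[OF fin])
  have N: "p_elements G p \<lhd> G" if "prime p" for p
    using subgroup_p_elements[OF fin that k triv[OF that]] conj_closedD(2)[OF conj_closed_p_elements]
    by (rule normalI_conj_by)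
  have cop: "commutator G x y = \<one>" if "x \<in> p_elements G p" "y \<in> p_elements G q" "prime p" "prime q" "p \<noteq> q"
    for x y p q
  proof -
    have xy: "x \<in> carrier G" "y \<in> carrier G" using that p_elements_closed by blast+
    have "commutator G x y \<in> p_elements G p" "commutator G x y \<in> p_elements G q"
      using commutator_in_normal(1)[OF N[OF that(3)] xy(2) that(1)]
        commutator_in_normal(2)[OF N[OF that(4)] xy(1) that(2)] by simp_all
    then obtain a b where ab: "commutator G x y [^] (p ^ a) = \<one>" "commutator G x y [^] (q ^ b) = \<one>"
      by (auto simp: p_elements_def)
    have "coprime (p ^ a) (q ^ b)" using that by (simp add: primes_coprime)
    then show ?thesis by (rule coprime_pow_eq_one[OF _ ab, OF commutator_closed[OF xy]])
  qed
  \<comment> \<open>A value survives only as long as all its entries belong to one prime. That it is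
    itself a \<open>p\<close>-element is recorded so that an entry for another prime commutes with
    it.\<close>
  have "\<forall>c\<in>comm_values j G Y. c = \<one> \<or> (\<exists>p. prime p \<and> c \<in> comm_values j G (p_elements G p) \<and> c \<in> p_elements G p)"
    if "j > 0" for j
    using that
  proof (induction j rule: nat_induct_non_zero)
    case 1
    then show ?case by (auto simp: Y_def)
  next
    case (Suc j)
    have "commutator G c y = \<one> \<or> (\<exists>p. prime p \<and> commutator G c y \<in> comm_values (Suc j) G (p_elements G p) 
        \<and> commutator G c y \<in> p_elements G p)"
      if c: "c \<in> comm_values j G Y" and "y \<in> Y" for c y
    proof -
      obtain q where q: "prime q" "y \<in> p_elements G q" using \<open>y \<in> Y\<close> by (auto simp: Y_def)
      have y: "y \<in> carrier G" using q p_elements_closed by blast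
      consider "c = \<one>" | p where "prime p" "c \<in> comm_values j G (p_elements G p)" "c \<in> p_elements G p"
        using Suc.IH c by blast
      then show ?thesis
      proof cases
        case 1
        then show ?thesis using y by simp
      next
        case 2
        show ?thesis
        proof (cases "p = q")
          case True
          then show ?thesis using 2 q y Suc.hyps commutator_in_normal(1)[OF N[OF 2(1)] y 2(3)]
            by (intro disjI2 exI[of _ p]) (auto intro: comm_values_SucI)
        next
          case False
          then show ?thesis using cop[OF 2(3) q(2) 2(1) q(1)] by simp
        qed
      qed
    qed
    then show ?case unfolding comm_values_Suc[OF Suc.hyps] by blast
  qed
  from this[OF k] have "comm_values k G Y \<subseteq> {\<one>}" using triv by blast
  then have "Y \<subseteq> upper_central G Y (k - 1)" by (rule subset_upper_central[OF Y k])
  then have all: "carrier G \<subseteq> upper_central G Y (k - 1)"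
    using generate_subgroup_incl[OF _ normal_imp_subgroup[OF normal_upper_central[OF Y]]] genY by blast
  have "comm_values (Suc i) G (carrier G) \<subseteq> upper_central G Y (k - 1 - i)" if "i < k" for i
    using that
  proof (induction i)
    case 0
    then show ?case using all by simp
  next
    case (Suc i)
    have "commutator G c g \<in> upper_central G Y (k - 1 - Suc i)"
      if "c \<in> comm_values (Suc i) G (carrier G)" "g \<in> carrier G" for c g
    proof (rule upper_central_commutator[OF Y])
      show "c \<in> upper_central G Y (Suc (k - 1 - Suc i))"
        using Suc that by (auto simp: Suc_diff_Suc)
    qed (use that genY in simp)
    then show ?case by (subst comm_values_Suc) auto
  qed
  from this[of "k - 1"] k show ?thesis by simp
qed

text \<open>\<open>comm_values_trivial\<close> applies to the quotient by the right-hand side,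
  because every \<open>p\<close>-element of a quotient of a finite group is the image of a
  \<open>p\<close>-element.\<close>

lemma generate_comm_values_eq:
  assumes fin: "finite (carrier G)" and k: "k > 0"
  shows "generate G (comm_values k G (carrier G)) = generate G (p_comm_values k G)"
proof
  define H where "H = generate G (p_comm_values k G)"
  have H: "H \<lhd> G" unfolding H_def by (intro conj_closed_generate_normal conj_closed_p_comm_values k)
  interpret q: group_hom G "G Mod H" "\<lambda>a. H #> a" by (rule quotient_hom[OF H])
  have surj: "(\<lambda>a. H #> a) ` carrier G = carrier (G Mod H)" by (simp add: carrier_FactGroup)
  have "comm_values k (G Mod H) (carrier (G Mod H)) \<subseteq> {\<one>\<^bsub>G Mod H\<^esub>}"
  proof (rule q.H.comm_values_trivial[OF finite_quotient[OF fin] k])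
    fix p :: nat assume p: "prime p"
    then have "p > 0" by (rule prime_gt_0_nat)
    have c1: "H #> c = \<one>\<^bsub>G Mod H\<^esub>" if "c \<in> comm_values k G (p_elements G p)" for c
    proof -
      have "c \<in> H" unfolding H_def p_comm_values_def using that p by (intro generate.incl) blast
      moreover have "c \<in> carrier G" using that comm_values_closed[OF p_elements_closed k] by blast
      ultimately show ?thesis using quotient_eq_one_iff[OF H] by blast
    qed
    show "comm_values k (G Mod H) (p_elements (G Mod H) p) \<subseteq> {\<one>\<^bsub>G Mod H\<^esub>}"
      unfolding q.image_p_elements[OF fin surj \<open>p > 0\<close>, symmetric] q.image_comm_values[OF p_elements_closed k, symmetric]
      by (rule image_subsetI) (simp only: c1 singleton_iff)
  qed
  then have "(\<lambda>a. H #> a) ` comm_values k G (carrier G) \<subseteq> {\<one>\<^bsub>G Mod H\<^esub>}"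
    unfolding q.image_comm_values[OF subset_refl k] surj .
  then have "comm_values k G (carrier G) \<subseteq> H"
    using quotient_eq_one_iff[OF H] comm_values_closed[OF subset_refl k] by blast
  then show "generate G (comm_values k G (carrier G)) \<subseteq> generate G (p_comm_values k G)"
    using generate_subgroup_incl[OF _ normal_imp_subgroup[OF H]] unfolding H_def by blast
  show "generate G (p_comm_values k G) \<subseteq> generate G (comm_values k G (carrier G))"
    by (rule mono_generate) (use comm_values_mono[OF p_elements_closed] p_comm_values_def in fast)
qed

end

section \<open>Nilpotent groups with few commutators\<close>

lemma pigeonhole_nat:
  assumes "finite V" "card V \<le> m" "\<And>i::nat. f i \<in> V"
  shows "\<exists>i j. i < j \<and> j \<le> m \<and> f i = f j"
proof -
  have "\<not> inj_on f {0..m}"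
  proof
    assume "inj_on f {0..m}"
    then have "card {0..m} \<le> card V"
      using assms by (intro card_inj_on_le) auto
    then show False using assms(2) by simp
  qed
  then obtain a b where "a \<in> {0..m}" "b \<in> {0..m}" "a \<noteq> b" "f a = f b"
    unfolding inj_on_def by blast
  then show ?thesis
    by (metis atLeastAtMost_iff linorder_neqE_nat)
qed

lemma card_neq_1: "x \<in> A \<Longrightarrow> A \<noteq> {x} \<Longrightarrow> card A \<noteq> 1"
  by (auto simp: card_1_singleton_iff)

context group begin

text \<open>If \<open>[c, x^i] = [c, x^j]\<close> with \<open>i < j\<close>, expanding
  \<open>[c, x^(j-i) x^i]\<close> leaves a conjugate of \<open>[c, x^(j-i)]\<close> equal to
  \<open>\<one>\<close>.\<close>

lemma commutator_pow_eq_one_ex: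
  assumes c: "c \<in> carrier G" and x: "x \<in> carrier G" and V: "finite V" "card V \<le> m"
    and in_V: "\<And>i. commutator G c (x [^] (i::nat)) \<in> V"
  shows "\<exists>l. 0 < l \<and> l \<le> m \<and> commutator G c (x [^] l) = \<one>"
proof -
  obtain i j where ij: "i < j" "j \<le> m" "commutator G c (x [^] i) = commutator G c (x [^] j)"
    using pigeonhole_nat[of V m "\<lambda>i. commutator G c (x [^] i)", OF V in_V] by (elim exE conjE)
  let ?l = "j - i"
  have "x [^] j = x [^] ?l \<otimes> x [^] i" using ij x by (simp add: nat_pow_mult)
  then have "commutator G c (x [^] i) \<otimes> conj_by G (x [^] i) (commutator G c (x [^] ?l)) = commutator G c (x [^] i)"
    using c x ij(3) by (simp add: commutator_mult_right)
  then have "conj_by G (x [^] i) (commutator G c (x [^] ?l)) = \<one>"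
    using c x by simp
  then have "conj_by G (inv (x [^] i)) (conj_by G (x [^] i) (commutator G c (x [^] ?l))) = \<one>"
    using x by (simp del: conj_by_inv_cancel)
  then have "commutator G c (x [^] ?l) = \<one>"
    using c x by simp
  then show ?thesis using ij by (intro exI[of _ ?l]) auto
qed

lemma comm_values_antimono:
  assumes P: "subgroup P G" and i: "0 < i" "i \<le> j"
  shows "comm_values j G P \<subseteq> comm_values i G P"
  using i(2)
proof (induction j rule: dec_induct)
  case (step n)
  then show ?case using comm_values_decreasing[OF P, of n] i(1) by auto
qed auto

text \<open>This removes the nilpotency class \<open>s\<close> from all bounds. If the values of two
  consecutive lengths coincide, they coincide for all later lengths and are trivial by nilpotency;
  otherwise each further length loses at least one value.\<close>

lemma nilpotent_comm_values_collapse: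
  assumes P: "subgroup P G" and k: "k > 0" and W: "finite (comm_values k G P)" "card (comm_values k G P) \<le> m"
    and s: "s > 0" "comm_values s G P \<subseteq> {\<one>}"
  shows "comm_values (k + m) G P \<subseteq> {\<one>}"
proof -
  let ?W = "\<lambda>i. comm_values (k + i) G P"
  have sub: "?W (Suc i) \<subseteq> ?W i" for i using comm_values_decreasing[OF P, of "k + i"] k by simp
  have stable: "?W i \<subseteq> {\<one>}" if "?W (Suc i) = ?W i" for i
  proof -
    have "?W (i + j) = ?W i" for j
    proof (induction j)
      case (Suc j)
      have "?W (i + Suc j) = {commutator G c x | c x. c \<in> ?W (i + j) \<and> x \<in> P}"
        using comm_values_Suc[of "k + (i + j)" G P] k by simp
      also have "\<dots> = {commutator G c x | c x. c \<in> ?W i \<and> x \<in> P}" unfolding Suc.IH ..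
      also have "\<dots> = ?W (Suc i)"
        using comm_values_Suc[of "k + i" G P] k by simp
      finally show ?case using that by simp
    qed simp
    moreover have "?W (i + s) \<subseteq> comm_values s G P"
      by (rule comm_values_antimono[OF P]) (use s in auto)
    ultimately show ?thesis using s(2) by blast
  qed
  \<comment> \<open>At \<open>i = m\<close> the second alternative leaves the empty set.\<close>
  have "?W i \<subseteq> {\<one>} \<or> finite (?W i) \<and> card (?W i) + i \<le> m" for i
  proof (induction i)
    case (Suc i)
    show ?case
    proof (cases "?W i \<subseteq> {\<one>}")
      case False
      then have *: "finite (?W i)" "card (?W i) + i \<le> m" using Suc.IH by auto
      have "?W (Suc i) \<subset> ?W i" using stable[of i] False sub[of i] by blast
      then have "card (?W (Suc i)) < card (?W i)" using *(1) by (rule psubset_card_mono[rotated])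
      then show ?thesis using * finite_subset[OF sub *(1)] by simp
    qed (use sub[of i] in blast)
  qed (use W in simp)
  from this[of m] show ?thesis by auto
qed

text \<open>Descending induction on the length, each step costing one factor \<open>fact m\<close>.
  For \<open>v = [c, x]\<close> the element \<open>[c, x^n]\<close> equals \<open>v^n\<close> up to
  longer values, which are already killed by \<open>e\<close>; the abelian group \<open>A\<close>
  allows the errors to be collected.\<close>

lemma nilpotent_comm_values_exponent:
  assumes P: "subgroup P G" and k: "k \<ge> 2" 
    and W: "finite (comm_values k G P)" "card (comm_values k G P) \<le> m"
    and A: "subgroup A G" "comm_values k G P \<subseteq> A" "\<And>a b. a \<in> A \<Longrightarrow> b \<in> A \<Longrightarrow> a \<otimes> b = b \<otimes> a"
    and s: "s > 0" "comm_values s G P \<subseteq> {\<one>}"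
    and w: "w \<in> comm_values k G P"
  shows "w [^] (fact m ^ m :: nat) = \<one>"
proof -
  have Pc: "P \<subseteq> carrier G" using P by (rule subgroup.subset)
  have Ac: "a \<in> carrier G" if "a \<in> A" for a using that A(1) by (rule subgroup.mem_carrier[rotated])
  \<comment> \<open>At \<open>i = 0\<close> the values are trivial by the collapse;
    \<open>i = m\<close> is the claim.\<close>
  have "\<forall>w\<in>comm_values (k + m - i) G P. w [^] (fact m ^ i :: nat) = \<one>" if "i \<le> m" for i
    using that
  proof (induction i)
    case 0
    then show ?case using nilpotent_comm_values_collapse[OF P _ W s] k Ac A(2) by auto
  next
    case (Suc i)
    define e :: nat where "e = fact m ^ i"
    define j where "j = k + m - Suc i"
    have j: "j \<ge> k" "Suc j = k + m - i" using Suc.prems by (auto simp: j_def)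
    have subA: "comm_values (Suc j) G P \<subseteq> A"
      using comm_values_antimono[OF P, of k "Suc j"] A(2) j k by auto
    have IH: "u [^] e = \<one>" if "u \<in> comm_values (Suc j) G P" for u
      using Suc that j by (auto simp: e_def)
    have "v [^] (fact m * e) = \<one>" if "v \<in> comm_values j G P" for v
    proof -
      have "j = Suc (j - 1)" "j - 1 > 0" using j k by auto
      then obtain c x where cx: "v = commutator G c x" "c \<in> comm_values (j - 1) G P" "x \<in> P"
        using \<open>v \<in> comm_values j G P\<close> comm_values_Suc[of "j - 1" G P] by auto
      have car: "c \<in> carrier G" "x \<in> carrier G"
        using cx comm_values_closed[OF Pc \<open>j - 1 > 0\<close>] Pc by auto
      have vA: "v \<in> A" using that comm_values_antimono[OF P, of k j] A(2) j k by auto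
      have xi: "x [^] i \<in> P" for i :: nat by (rule subgroup_nat_pow_closed[OF P cx(3)])
      have "commutator G c (x [^] i) \<in> comm_values k G P" for i :: nat
        using comm_values_SucI[OF \<open>j - 1 > 0\<close> cx(2) xi] comm_values_antimono[OF P, of k j] j k by auto
      then obtain l where l: "0 < l" "l \<le> m" "commutator G c (x [^] l) = \<one>"
        using commutator_pow_eq_one_ex[OF car W] by blast
      \<comment> \<open>\<open>u\<close> is the accumulated error: passing from \<open>n\<close> to
        \<open>n + 1\<close> contributes \<open>v [v, x^n]\<close>, and \<open>[v, x^n]\<close> is a
        longer value. At \<open>n = l\<close> the left side vanishes, so \<open>v^l\<close> is the
        inverse of an error.\<close>
      have "\<exists>u\<in>A. u [^] e = \<one> \<and> commutator G c (x [^] n) = v [^] n \<otimes> u" for n :: nat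
      proof (induction n)
        case 0
        then show ?case using subgroup.one_closed[OF A(1)] car by (intro bexI[of _ \<one>]) auto
      next
        case (Suc n)
        then obtain u where u: "u \<in> A" "u [^] e = \<one>" "commutator G c (x [^] n) = v [^] n \<otimes> u" by blast
        let ?t = "commutator G v (x [^] n)"
        have t: "?t \<in> comm_values (Suc j) G P" using that xi j k by (intro comm_values_SucI) auto
        then have tA: "?t \<in> A" using subA by auto
        have te: "?t [^] e = \<one>" using IH[OF t] .
        have c1: "u \<in> carrier G" "v \<in> carrier G" "?t \<in> carrier G" using u vA tA Ac by auto
        have "x [^] Suc n = x \<otimes> x [^] n" using car by (simp add: nat_pow_Suc2[symmetric])
        then have "commutator G c (x [^] Suc n) = commutator G c (x [^] n) \<otimes> conj_by G (x [^] n) v"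
          using car by (simp add: commutator_mult_right cx(1))
        also have "conj_by G (x [^] n) v = v \<otimes> ?t" using car c1 by (simp add: conj_by_conv_commutator)
        also have "commutator G c (x [^] n) \<otimes> (v \<otimes> ?t) = v [^] n \<otimes> (u \<otimes> v) \<otimes> ?t"
          unfolding u(3) using c1 by (simp add: m_assoc)
        also have "\<dots> = v [^] Suc n \<otimes> (u \<otimes> ?t)"
          unfolding A(3)[OF u(1) vA] using c1 by (simp add: m_assoc)
        finally have eq: "commutator G c (x [^] Suc n) = v [^] Suc n \<otimes> (u \<otimes> ?t)" .
        have "(u \<otimes> ?t) [^] e = u [^] e \<otimes> ?t [^] e"
          by (rule pow_mult_distrib[OF A(3)[OF u(1) tA] c1(1,3)])
        then have "(u \<otimes> ?t) [^] e = \<one>" using u(2) te by simp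
        then show ?case using eq subgroup.m_closed[OF A(1) u(1) tA] by blast
      qed
      then obtain u where u: "u \<in> A" "u [^] e = \<one>" "\<one> = v [^] l \<otimes> u" using l(3) by metis
      have vc: "v \<in> carrier G" "u \<in> carrier G" using Ac vA u by auto
      have "v [^] l = inv u" using u(3) vc by (metis inv_equality inv_inv nat_pow_closed inv_closed)
      then have "v [^] (l * e) = \<one>" using vc u(2) by (simp add: nat_pow_pow[symmetric] nat_pow_inv)
      moreover have "l * e dvd fact m * e" using l by (intro mult_dvd_mono dvd_fact) auto
      ultimately show ?thesis using pow_mult_exponent_one[OF vc(1)] by blast
    qed
    then show ?case unfolding j_def[symmetric] by (simp add: e_def)
  qed
  from this[of m] w show ?thesis by simp
qed

text \<open>\<open>G\<close> need not be an \<open>r\<close>-group, but its elements of other prime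
  power orders fix \<open>D\<close> pointwise, so the class equation still works: without a
  nontrivial fixed point, \<open>r\<close> divides every orbit length on
  \<open>D - {\<one>}\<close>, hence \<open>card D - 1\<close> as well as
  \<open>card D\<close>.\<close>

lemma fixed_point_normal_p_subgroup:
  assumes fin: "finite (carrier G)" and r: "prime r" and D: "D \<lhd> G" "D \<subseteq> p_elements G r" "D \<noteq> {\<one>}"
    and cent: "\<And>q x d. prime q \<Longrightarrow> q \<noteq> r \<Longrightarrow> x \<in> p_elements G q \<Longrightarrow> d \<in> D \<Longrightarrow> commutator G d x = \<one>"
  shows "\<exists>d\<in>D - {\<one>}. \<forall>g\<in>carrier G. commutator G d g = \<one>"
proof (rule ccontr)
  assume no: "\<not> ?thesis"
  have Ds: "subgroup D G" using D(1) by (rule normal_imp_subgroup)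
  have Dc: "D \<subseteq> carrier G" using Ds by (rule subgroup.subset)
  have finD: "finite D" using finite_subset[OF Dc fin] .
  let ?\<phi> = "\<lambda>g. \<lambda>h\<in>carrier G. g \<otimes> h \<otimes> inv g"
  interpret act: group_action G "carrier G" ?\<phi> by (rule action_by_conjugation)
  let ?orb = "orbit G ?\<phi>"
  have orb: "?orb d = {conj_by G g d | g. g \<in> carrier G}" if "d \<in> carrier G" for d
  proof -
    have "?orb d = {conj_by G (inv g) d | g. g \<in> carrier G}"
      unfolding orbit_def 
      by (rule Collect_cong, rule ex_cong1) (use that in \<open>auto simp: conj_by_def\<close>)
    also have "\<dots> = {conj_by G g d | g. g \<in> carrier G}"
      by (metis (no_types, opaque_lifting) inv_closed inv_inv)
    finally show ?thesis .
  qed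
  have r_dvd: "r dvd card (?orb d)" if d: "d \<in> D - {\<one>}" for d
  proof -
    have dc: "d \<in> carrier G" using d Dc by auto
    let ?S = "stabilizer G ?\<phi> d"
    have S: "subgroup ?S G" by (rule act.stabilizer_subgroup[OF dc])
    have card: "card (?orb d) * card ?S = order G" by (rule act.orbit_stabilizer_theorem[OF dc])
    obtain g where g: "g \<in> carrier G" "commutator G d g \<noteq> \<one>" using no d by blast
    have "?orb d \<noteq> {d}"
    proof
      assume "?orb d = {d}"
      then have "conj_by G g d = d" using orb[OF dc] g by blast
      then show False using g dc by (simp add: commutator_conv_conj_by)
    qed
    moreover have "d \<in> ?orb d" 
      unfolding orb[OF dc] using dc by (intro CollectI exI[of _ \<one>]) simp
    ultimately have "card (?orb d) \<noteq> 1" by (intro card_neq_1)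
    then obtain q where q: "prime q" "q dvd card (?orb d)" using prime_factor_nat by blast
    have "q = r"
    proof (rule ccontr)
      assume "q \<noteq> r"
      \<comment> \<open>A Sylow \<open>q\<close>-subgroup fixes \<open>d\<close>. If
        \<open>q\<close> also divided the orbit length, \<open>order G\<close> would contain
        \<open>q\<close> once too often.\<close>
      obtain R where R: "subgroup R G" "card R = q ^ multiplicity q (order G)"
        using sylow_subgroup_ex[OF fin q(1)] by blast
      have "R \<subseteq> ?S"
      proof
        fix x assume "x \<in> R"
        then have x: "x \<in> p_elements G q" using p_subgroup_subset_p_elements[OF R] by auto
        then have xc: "x \<in> carrier G" by (simp add: p_elements_def)
        have "commutator G d x = \<one>" using cent[OF q(1) \<open>q \<noteq> r\<close> x] d by simp
        then have "d \<otimes> x = x \<otimes> d" using commutator_eq_one_iff dc xc by simp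
        then have "x \<otimes> d \<otimes> inv x = d" using dc xc by (metis inv_solve_right m_closed)
        then show "x \<in> ?S" using xc dc by (simp add: stabilizer_def)
      qed
      then have "q ^ multiplicity q (order G) dvd card ?S" using card_subgroup_dvd[OF R(1) S] R(2) by simp
      then have "q ^ Suc (multiplicity q (order G)) dvd order G"
        using q(2) card mult_dvd_mono[of q "card (?orb d)" "q ^ multiplicity q (order G)" "card ?S"] by simp
      moreover have "order G \<noteq> 0" using fin order_gt_0_iff_finite by simp
      ultimately have "Suc (multiplicity q (order G)) \<le> multiplicity q (order G)"
        using q(1) by (intro multiplicity_geI) auto
      then show False by simp
    qed
    then show ?thesis using q by simp
  qed
  have "r dvd card (\<Union> (?orb ` (D - {\<one>})))"
  proof (rule dvd_partition)
    have "?orb d \<subseteq> carrier G" if "d \<in> D - {\<one>}" for d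
      using orb[OF subsetD[OF Dc, of d]] that Dc by auto
    then show "finite (\<Union> (?orb ` (D - {\<one>})))" 
      by (intro finite_subset[OF _ fin]) blast
    show "\<forall>c\<in>?orb ` (D - {\<one>}). r dvd card c" using r_dvd by blast
    have "?orb ` (D - {\<one>}) \<subseteq> orbits G (carrier G) ?\<phi>"
      using Dc unfolding orbits_def by blast
    then show "\<forall>c1\<in>?orb ` (D - {\<one>}). \<forall>c2\<in>?orb ` (D - {\<one>}). c1 \<noteq> c2 \<longrightarrow> c1 \<inter> c2 = {}"
      using act.disjoint_union by (meson subsetD)
  qed
  moreover have "\<Union> (?orb ` (D - {\<one>})) = D - {\<one>}"
  proof (intro equalityI subsetI)
    fix y assume "y \<in> \<Union> (?orb ` (D - {\<one>}))"
    then obtain d where d: "d \<in> D - {\<one>}" "y \<in> ?orb d" by blast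
    then obtain g where g: "g \<in> carrier G" "y = conj_by G g d" using orb[OF subsetD[OF Dc, of d]] by auto
    have "y \<in> D" using normal_conj_by[OF D(1) g(1)] g d by auto
    moreover have "y \<noteq> \<one>"
    proof
      assume "y = \<one>"
      then have "conj_by G (inv g) (conj_by G g d) = \<one>" using g by (simp del: conj_by_inv_cancel)
      then show False using d g Dc by auto
    qed
    ultimately show "y \<in> D - {\<one>}" by simp
  next
    fix y assume y: "y \<in> D - {\<one>}"
    then have "y \<in> carrier G" using Dc by auto
    then have "y \<in> ?orb y" unfolding orb[OF \<open>y \<in> carrier G\<close>] by (intro CollectI exI[of _ \<one>]) simp
    then show "y \<in> \<Union> (?orb ` (D - {\<one>}))" using y by blast
  qed
  ultimately have 1: "r dvd card D - 1" using subgroup.one_closed[OF Ds] by simp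
  have oneD: "\<one> \<in> D" by (rule subgroup.one_closed[OF Ds])
  have "card D \<noteq> 1" using D(3) oneD by (intro card_neq_1)
  then obtain q where q: "prime q" "q dvd card D" using prime_factor_nat by blast
  \<comment> \<open>A Sylow \<open>q\<close>-subgroup of \<open>D\<close> for another prime would
    consist of elements that are both \<open>q\<close>- and \<open>r\<close>-elements.\<close>
  have "q = r"
  proof (rule ccontr)
    assume "q \<noteq> r"
    interpret D: group "G\<lparr>carrier := D\<rparr>" using subgroup_imp_group[OF Ds] .
    obtain R where R: "subgroup R (G\<lparr>carrier := D\<rparr>)" "card R = q ^ multiplicity q (order (G\<lparr>carrier := D\<rparr>))"
      using D.sylow_subgroup_ex[OF _ q(1)] finD by auto
    have RG: "subgroup R G" using incl_subgroup[OF Ds R(1)] .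
    have "x = \<one>" if x: "x \<in> R" for x
    proof -
      have "x \<in> p_elements G q" "x \<in> p_elements G r"
        using p_subgroup_subset_p_elements[OF RG R(2)] subgroup.subset[OF R(1)] D(2) x by auto
      then obtain a b where "x \<in> carrier G" "x [^] (q ^ a) = \<one>" "x [^] (r ^ b) = \<one>"
        by (auto simp: p_elements_def)
      then show ?thesis using \<open>q \<noteq> r\<close> q r
        by (intro coprime_pow_eq_one[of x "q ^ a" "r ^ b"]) (auto simp: primes_coprime)
    qed
    then have "R \<subseteq> {\<one>}" by auto
    then have "card R \<le> 1" using card_mono[of "{\<one>}" R] by simp
    moreover have "multiplicity q (card D) \<ge> 1"
      using q finD oneD by (intro multiplicity_geI) auto
    then have "q ^ 1 \<le> q ^ multiplicity q (card D)" using prime_gt_0_nat[OF q(1)] by (intro power_increasing) auto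
    ultimately show False using R(2) prime_gt_1_nat[OF q(1)] by (simp add: order_def)
  qed
  then have "r dvd card D" using q by simp
  moreover have "card D > 0" using finD oneD by (auto simp: card_gt_0_iff)
  ultimately have "r dvd 1" using 1 by (metis One_nat_def Suc_pred' dvd_add_right_iff plus_1_eq_Suc add.commute)
  then show False using r by simp
qed

text \<open>A fixed point in the image of \<open>D\<close> modulo level \<open>i\<close> enlarges
  the intersection of \<open>D\<close> with the next level. The crude count \<open>card D\<close>
  does no harm, because \<open>nilpotent_comm_values_collapse\<close> later eliminates the
  class.\<close>

lemma normal_p_subgroup_hypercentral:
  assumes fin: "finite (carrier G)" and r: "prime r" and D: "D \<lhd> G" "D \<subseteq> p_elements G r"
    and cent: "\<And>q x d. prime q \<Longrightarrow> q \<noteq> r \<Longrightarrow> x \<in> p_elements G q \<Longrightarrow> d \<in> D \<Longrightarrow> commutator G d x = \<one>"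
  shows "D \<subseteq> upper_central G (carrier G) (card D)"
proof -
  let ?Z = "upper_central G (carrier G)"
  have cc: "conj_closed G (carrier G)" by (auto simp: conj_closed_def)
  have Ds: "subgroup D G" using D(1) by (rule normal_imp_subgroup)
  have Dc: "D \<subseteq> carrier G" using Ds by (rule subgroup.subset)
  have finD: "finite D" using finite_subset[OF Dc fin] .
  have "D \<subseteq> ?Z i \<or> card (D \<inter> ?Z i) > i" for i
  proof (induction i)
    case 0
    then show ?case using subgroup.one_closed[OF Ds] finD by (auto simp: card_gt_0_iff)
  next
    case (Suc i)
    define N where "N = ?Z i"
    have N: "N \<lhd> G" unfolding N_def by (rule normal_upper_central[OF cc])
    have mono: "N \<subseteq> ?Z (Suc i)"
      using commutator_in_normal(1)[OF N] subgroup.mem_carrier[OF normal_imp_subgroup[OF N]]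
      by (auto simp: N_def)
    show ?case
    proof (cases "D \<subseteq> N")
      case True
      then show ?thesis using mono by blast
    next
      case False
      interpret q: group_hom G "G Mod N" "\<lambda>a. N #> a" by (rule quotient_hom[OF N])
      have surj: "(\<lambda>a. N #> a) ` carrier G = carrier (G Mod N)" by (simp add: carrier_FactGroup)
      let ?D = "(\<lambda>a. N #> a) ` D"
      have "\<exists>d\<in>?D - {\<one>\<^bsub>G Mod N\<^esub>}. \<forall>g\<in>carrier (G Mod N). commutator (G Mod N) d g = \<one>\<^bsub>G Mod N\<^esub>"
      proof (rule q.H.fixed_point_normal_p_subgroup[OF finite_quotient[OF fin] r])
        show "?D \<lhd> G Mod N"
        proof (rule q.H.normalI_conj_by)
          show "subgroup ?D (G Mod N)" by (rule q.subgroup_img_is_subgroup[OF Ds])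
          fix g x assume "g \<in> carrier (G Mod N)" "x \<in> ?D"
          then obtain h d where h: "h \<in> carrier G" "g = N #> h" "d \<in> D" "x = N #> d"
            unfolding surj[symmetric] by (elim imageE) simp
          then have "conj_by (G Mod N) g x = N #> conj_by G h d"
            using q.hom_conj_by[of h d] Dc by auto
          then show "conj_by (G Mod N) g x \<in> ?D" using normal_conj_by[OF D(1) h(1,3)] by (rule image_eqI)
        qed
        show "?D \<subseteq> p_elements (G Mod N) r"
          using q.image_p_elements[OF fin surj] D(2) prime_gt_0_nat[OF r] by blast
        obtain d where d: "d \<in> D" "d \<notin> N" using False by blast
        then have "N #> d \<noteq> \<one>\<^bsub>G Mod N\<^esub>" using quotient_eq_one_iff[OF N] Dc by blast
        then show "?D \<noteq> {\<one>\<^bsub>G Mod N\<^esub>}" using d(1) by blast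
      next
        fix q x d assume q: "prime q" "q \<noteq> r" "x \<in> p_elements (G Mod N) q" "d \<in> ?D"
        have "q > 0" using prime_gt_0_nat[OF q(1)] .
        then obtain y where y: "y \<in> p_elements G q" "x = N #> y"
          using q(3) unfolding q.image_p_elements[OF fin surj \<open>q > 0\<close>, symmetric] by (elim imageE)
        obtain e where e: "e \<in> D" "d = N #> e" using q(4) by (elim imageE)
        have ec: "e \<in> carrier G" "y \<in> carrier G" using e Dc y by (auto simp: p_elements_def)
        have "commutator (G Mod N) d x = N #> commutator G e y"
          using q.hom_commutator[OF ec] e y by simp
        also have "\<dots> = \<one>\<^bsub>G Mod N\<^esub>" using cent[OF q(1,2) y(1) e(1)] q.hom_one by simp
        finally show "commutator (G Mod N) d x = \<one>\<^bsub>G Mod N\<^esub>" .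
      qed
      then obtain d where d: "d \<in> D" "N #> d \<noteq> \<one>\<^bsub>G Mod N\<^esub>" 
        and dg: "\<And>g. g \<in> carrier (G Mod N) \<Longrightarrow> commutator (G Mod N) (N #> d) g = \<one>\<^bsub>G Mod N\<^esub>" by blast
      have dc: "d \<in> carrier G" using d Dc by auto
      have dN: "d \<notin> N" using d quotient_eq_one_iff[OF N dc] by blast
      have "commutator G d g \<in> N" if g: "g \<in> carrier G" for g
      proof -
        have "N #> commutator G d g = \<one>\<^bsub>G Mod N\<^esub>"
          using q.hom_commutator[OF dc g] dg[OF q.hom_closed[OF g]] by simp
        then show ?thesis using quotient_eq_one_iff[OF N, of "commutator G d g"] dc g by blast
      qed
      then have "d \<in> ?Z (Suc i)" using dc by (auto simp: N_def)
      then have "D \<inter> N \<subset> D \<inter> ?Z (Suc i)" using mono d dN by blast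
      then have "card (D \<inter> N) < card (D \<inter> ?Z (Suc i))" using finD by (intro psubset_card_mono) auto
      then show ?thesis using Suc.IH False by (auto simp: N_def)
    qed
  qed
  from this[of "card D"] show ?thesis
    using card_mono[OF finD, of "D \<inter> ?Z (card D)"] by auto
qed

end

section \<open>Finite normal sets of torsion elements and coprime action\<close>

context group begin

lemma pow_eq_one_ex:
  assumes "x \<in> carrier G" "finite V" "card V \<le> m" "\<And>i. x [^] (i::nat) \<in> V"
  shows "\<exists>l. 0 < l \<and> l \<le> m \<and> x [^] l = \<one>"
proof -
  obtain i j where ij: "i < j" "j \<le> m" "x [^] i = x [^] j"
    using pigeonhole_nat[of V m "\<lambda>i. x [^] i"] assms by blast
  have "x [^] i \<otimes> x [^] (j - i) = x [^] j" using assms(1) ij(1) by (simp add: nat_pow_mult)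
  then have "x [^] i \<otimes> x [^] (j - i) = x [^] i \<otimes> \<one>" using assms(1) ij(3) by simp
  then have "x [^] (j - i) = \<one>" using assms(1) by simp
  then show ?thesis using ij by (intro exI[of _ "j - i"]) auto
qed

lemma fact_pow_eq_one:
  assumes "x \<in> carrier G" "0 < l" "l \<le> m" "x [^] (l::nat) = \<one>"
  shows "x [^] (fact m :: nat) = \<one>"
  using assms by (intro pow_mult_exponent_one[OF assms(1,4)] dvd_fact) auto

text \<open>All conjugates of \<open>v\<close> lie in \<open>V\<close>, so the
  \<open>[v, g^i]\<close> lie in the translate of \<open>V\<close> by \<open>inv v\<close>, which
  has at most \<open>m\<close> elements.\<close>

lemma fact_pow_centralizes:
  assumes V: "conj_closed G V" "finite V" "card V \<le> m" and v: "v \<in> V" and g: "g \<in> carrier G"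
  shows "commutator G v (g [^] (fact m :: nat)) = \<one>"
proof -
  have vc: "v \<in> carrier G" using conj_closedD(1)[OF V(1)] v by auto
  have "finite ((\<lambda>u. inv v \<otimes> u) ` V)" "card ((\<lambda>u. inv v \<otimes> u) ` V) \<le> m"
    using V(2) order_trans[OF card_image_le[OF V(2)] V(3)] by simp_all
  moreover have "commutator G v (g [^] (i::nat)) \<in> (\<lambda>u. inv v \<otimes> u) ` V" for i
    using vc g conj_closedD(2)[OF V(1) _ v] by (simp add: commutator_conv_conj_by)
  ultimately obtain l where l: "0 < l" "l \<le> m" "commutator G v (g [^] l) = \<one>"
    using commutator_pow_eq_one_ex[OF vc g] by blast
  obtain w :: nat where w: "fact m = l * w" using dvd_fact[of l m] l by (auto simp: dvd_def)
  have "v \<otimes> g [^] l = g [^] l \<otimes> v" using l(3) commutator_eq_one_iff[OF vc, of "g [^] l"] g by simp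
  then have "g [^] l \<otimes> v = v \<otimes> g [^] l" by simp
  then have "(g [^] l) [^] w \<otimes> v = v \<otimes> (g [^] l) [^] w"
    using g vc group_commutes_pow[of "g [^] l" v w] by simp
  then have "v \<otimes> g [^] (fact m :: nat) = g [^] (fact m :: nat) \<otimes> v" using g by (simp add: w nat_pow_pow)
  then show ?thesis using commutator_eq_one_iff[OF vc, of "g [^] (fact m :: nat)"] g by simp
qed

section \<open>Words in a finite normal set\<close>

definition word_prod :: "'a list \<Rightarrow> 'a" where
  "word_prod ws = foldr (\<otimes>) ws \<one>"

lemma word_prod_simps [simp]:
  "word_prod [] = \<one>" "word_prod (u # ws) = u \<otimes> word_prod ws"
  by (simp_all add: word_prod_def)

lemma word_prod_closed: "set ws \<subseteq> carrier G \<Longrightarrow> word_prod ws \<in> carrier G"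
  by (induction ws) auto

lemma word_prod_append:
  "set ws \<subseteq> carrier G \<Longrightarrow> set vs \<subseteq> carrier G \<Longrightarrow> word_prod (ws @ vs) = word_prod ws \<otimes> word_prod vs"
  by (induction ws) (auto simp: word_prod_closed m_assoc)

lemma word_prod_replicate: "v \<in> carrier G \<Longrightarrow> word_prod (replicate n v) = v [^] n"
  by (induction n) (auto simp flip: nat_pow_Suc2)

text \<open>Moving a letter \<open>u\<close> to the right past a power of \<open>v\<close> replaces
  \<open>u\<close> by a conjugate, which is a letter again; the length is unchanged.\<close>

lemma word_prod_collect:
  assumes V: "conj_closed G V" and v: "v \<in> V"
  shows "set ws \<subseteq> V \<Longrightarrow>
    \<exists>ws'. set ws' \<subseteq> V \<and> length ws = count_list ws v + length ws' \<and>
      word_prod ws = v [^] count_list ws v \<otimes> word_prod ws'"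
proof (induction ws)
  case Nil
  then show ?case by (intro exI[of _ "[]"]) auto
next
  case (Cons u ws)
  then obtain ws' where ws': "set ws' \<subseteq> V" "length ws = count_list ws v + length ws'"
    "word_prod ws = v [^] count_list ws v \<otimes> word_prod ws'" by auto
  let ?c = "count_list ws v"
  note Vc = conj_closedD(1)[OF V]
  have car: "u \<in> carrier G" "v \<in> carrier G" "word_prod ws' \<in> carrier G"
    using Vc v Cons.prems ws'(1) word_prod_closed[of ws'] by auto
  show ?case
  proof (cases "u = v")
    case True
    then have "word_prod (u # ws) = v [^] count_list (u # ws) v \<otimes> word_prod ws'"
      using car ws'(3) by (simp add: m_assoc[symmetric] nat_pow_Suc2[symmetric])
    then show ?thesis using True ws' by (intro exI[of _ ws']) auto
  next
    case False
    let ?u = "conj_by G (v [^] ?c) u"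
    have "?u \<in> V" using conj_closedD(2)[OF V, of "v [^] ?c" u] car Cons.prems by simp
    moreover have "word_prod (u # ws) = v [^] ?c \<otimes> word_prod (?u # ws')"
      using car ws'(3) by (simp add: conj_by_def m_assoc)
    ultimately show ?thesis using False ws' by (intro exI[of _ "?u # ws'"]) auto
  qed
qed

text \<open>Dietzmann's argument: in a shortest word no letter can occur as often as the common
  exponent, because its occurrences can be collected on the left at the cost of conjugating the
  other letters.\<close>

lemma dietzmann:
  assumes V: "conj_closed G V" "finite V" "card V \<le> m" "\<one> \<in> V"
    and E: "E > 0" "\<And>v. v \<in> V \<Longrightarrow> v [^] (E::nat) = \<one>"
  shows "finite (generate G V) \<and> card (generate G V) \<le> m ^ (m * E)"
proof -
  note Vc = conj_closedD(1)[OF V(1)]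
  have gen: "\<exists>ws. set ws \<subseteq> V \<and> g = word_prod ws" if "g \<in> generate G V" for g
    using that
  proof (induction rule: generate.induct)
    case one
    show ?case by (intro exI[of _ "[]"]) auto
  next
    case (incl h)
    then show ?case using Vc by (intro exI[of _ "[h]"]) auto
  next
    case (inv h)
    then have h: "h \<in> carrier G" using Vc by auto
    \<comment> \<open>Inverses are positive powers, so words in \<open>V\<close> alone reach the
      whole generated subgroup.\<close>
    have "h [^] (E - 1) \<otimes> h = \<one>" using E h inv by (metis Suc_diff_1 nat_pow_Suc)
    then have "inv h = h [^] (E - 1)" using h by (metis inv_equality nat_pow_closed)
    then show ?case using inv h 
      by (intro exI[of _ "replicate (E - 1) h"]) 
        (simp add: word_prod_replicate set_replicate_conv_if)
  next
    case (eng h1 h2)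
    then obtain ws vs where "set ws \<subseteq> V" "h1 = word_prod ws" "set vs \<subseteq> V" "h2 = word_prod vs" by blast
    then show ?case using Vc by (intro exI[of _ "ws @ vs"]) (auto simp: word_prod_append)
  qed
  have shrink: "\<exists>ws'. set ws' \<subseteq> V \<and> length ws' < length ws \<and> word_prod ws' = word_prod ws"
    if ws: "set ws \<subseteq> V" "length ws \<ge> m * E" for ws
  proof -
    \<comment> \<open>Otherwise the word would have fewer than \<open>card V * E\<close>
      letters.\<close>
    have "\<exists>v\<in>V. count_list ws v \<ge> E"
    proof (rule ccontr)
      assume "\<not> ?thesis"
      then have "(\<Sum>v\<in>V. count_list ws v) < (\<Sum>v\<in>V. E)"
        using V(2,4) by (intro sum_strict_mono) auto
      then have "length ws < card V * E" using sum_count_set[OF ws(1) V(2)] by simp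
      also have "\<dots> \<le> m * E" using V(3) by simp
      finally show False using ws(2) by simp
    qed
    then obtain v where v: "v \<in> V" "count_list ws v \<ge> E" by blast
    obtain ws' where ws': "set ws' \<subseteq> V" "length ws = count_list ws v + length ws'"
      "word_prod ws = v [^] count_list ws v \<otimes> word_prod ws'"
      using word_prod_collect[OF V(1) v(1) ws(1)] by blast
    have vc: "v \<in> carrier G" using v Vc by auto
    let ?d = "count_list ws v - E"
    have "v [^] count_list ws v = v [^] E \<otimes> v [^] ?d" using vc v(2) by (simp add: nat_pow_mult)
    then have "word_prod ws = word_prod (replicate ?d v @ ws')"
      using ws' vc E(2)[OF v(1)] Vc by (auto simp: word_prod_append word_prod_replicate set_replicate_conv_if)
    moreover have "set (replicate ?d v @ ws') \<subseteq> V" using ws' v by (auto simp: set_replicate_conv_if)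
    moreover have "length (replicate ?d v @ ws') < length ws" using ws'(2) v(2) E(1) by simp
    ultimately show ?thesis by metis
  qed
  have short: "\<exists>ws'. set ws' \<subseteq> V \<and> length ws' < m * E \<and> word_prod ws' = word_prod ws"
    if "set ws \<subseteq> V" for ws
    using that
  proof (induction ws rule: length_induct)
    case (1 ws)
    show ?case
    proof (cases "length ws < m * E")
      case False
      then obtain ws' where "set ws' \<subseteq> V" "length ws' < length ws" "word_prod ws' = word_prod ws"
        using shrink 1 by (metis not_less)
      then show ?thesis using 1 by metis
    qed (use 1 in blast)
  qed
  \<comment> \<open>Short words are padded with the letter \<open>\<one>\<close> to the exact length
    \<open>m * E\<close>, so that lists of one length are counted.\<close>
  let ?L = "{ws. set ws \<subseteq> V \<and> length ws = m * E}"
  have "generate G V \<subseteq> word_prod ` ?L"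
  proof
    fix g assume "g \<in> generate G V"
    then obtain ws where ws: "set ws \<subseteq> V" "length ws < m * E" "g = word_prod ws"
      using gen short by metis
    let ?ws = "ws @ replicate (m * E - length ws) \<one>"
    have "g = word_prod ?ws" 
      using ws Vc word_prod_append[of ws "replicate (m * E - length ws) \<one>"] word_prod_closed[of ws]
      by (auto simp: word_prod_replicate set_replicate_conv_if)
    moreover have "?ws \<in> ?L" using ws V(4) by (auto simp: set_replicate_conv_if)
    ultimately show "g \<in> word_prod ` ?L" by blast
  qed
  moreover have "finite ?L" "card ?L \<le> m ^ (m * E)"
    using finite_lists_length_eq[OF V(2)] card_lists_length_eq[OF V(2)] V(3) by (auto simp: power_mono)
  ultimately show ?thesis
    using surj_card_le[of ?L "generate G V" word_prod] finite_subset[of "generate G V" "word_prod ` ?L"]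
    by auto
qed

text \<open>The image of the endomorphism \<open>b \<mapsto> [b, x]\<close> of an abelian \<open>r'\<close>-group equals its own
  image, and \<open>x\<^sup>g = x [x, g]\<close> turns its elements into commutators of conjugates of \<open>x\<close>.\<close>

lemma coprime_action_exponent:
  assumes Z: "Z \<lhd> G" "\<And>a b. a \<in> Z \<Longrightarrow> b \<in> Z \<Longrightarrow> a \<otimes> b = b \<otimes> a" "finite Z"
    and k: "k \<ge> 2" and V: "finite (comm_values k G (p_elements G r))" "card (comm_values k G (p_elements G r)) \<le> m"
    and x: "x \<in> p_elements G r" and z: "z \<in> Z" "z [^] (t::nat) = \<one>" "coprime t r"
  shows "commutator G z x [^] (fact m :: nat) = \<one>"
proof -
  have Zs: "subgroup Z G" using Z(1) by (rule normal_imp_subgroup)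
  have Zc: "b \<in> carrier G" if "b \<in> Z" for b using subgroup.mem_carrier[OF Zs that] .
  obtain e where e: "x \<in> carrier G" "x [^] (r ^ e) = \<one>" using x by (auto simp: p_elements_def)
  \<comment> \<open>The subgroup of \<open>Z\<close> killed by \<open>t\<close>, on which
    \<open>x\<close> acts with coprime order. As \<open>Z\<close> is abelian and normal,
    \<open>\<theta>\<close> below is an endomorphism of it.\<close>
  define B where "B = {b \<in> Z. b [^] t = \<one>}"
  define \<theta> where "\<theta> = (\<lambda>b. commutator G b x)"
  have \<theta>Z: "\<theta> b \<in> Z" if "b \<in> Z" for b using commutator_in_normal(1)[OF Z(1) e(1) that] by (simp add: \<theta>_def)
  have conjZ: "conj_by G b a = a" if "a \<in> Z" "b \<in> Z" for a b
    using conj_by_eq_self_iff[of b a] Z(2)[OF that] Zc that by simp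
  have \<theta>_mult: "\<theta> (a \<otimes> b) = \<theta> a \<otimes> \<theta> b" if "a \<in> Z" "b \<in> Z" for a b
    using commutator_mult_left[of a b x] conjZ[OF \<theta>Z[OF that(1)] that(2)] e(1) Zc that by (simp add: \<theta>_def)
  have \<theta>_one: "\<theta> \<one> = \<one>" using e by (simp add: \<theta>_def)
  have \<theta>_pow: "\<theta> (a [^] (n::nat)) = \<theta> a [^] n" if "a \<in> Z" for a n
    by (induction n) (use that \<theta>_one \<theta>_mult subgroup_nat_pow_closed[OF Zs that] in auto)
  have \<theta>_inv: "\<theta> (inv a) = inv (\<theta> a)" if "a \<in> Z" for a
  proof -
    have "\<theta> (inv a) \<otimes> \<theta> a = \<one>"
      using \<theta>_mult[of "inv a" a] \<theta>_one Zc that subgroup.m_inv_closed[OF Zs] by simp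
    then show ?thesis using Zc \<theta>Z that subgroup.m_inv_closed[OF Zs] by (metis inv_equality)
  qed
  have BZ: "B \<subseteq> Z" by (auto simp: B_def)
  have \<theta>B: "\<theta> b \<in> B" if "b \<in> B" for b
    using that \<theta>Z \<theta>_pow[of b t] \<theta>_one by (auto simp: B_def)
  \<comment> \<open>If \<open>x\<close> centralizes \<open>[b, x]\<close>, coprimality kills
    \<open>[b, x]\<close>. So \<open>\<theta>\<close> is injective on its image, and by finiteness
    maps this image onto itself.\<close>
  have ker: "\<theta> b = \<one>" if "b \<in> B" "\<theta> (\<theta> b) = \<one>" for b
  proof -
    have b: "b \<in> Z" "b [^] t = \<one>" using that by (auto simp: B_def)
    show ?thesis unfolding \<theta>_def
    proof (rule coprime_commutator_eq_one[OF Zc[OF b(1)] e(1) _ _ b(2) e(2)])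
      show "commutator G b x \<otimes> b = b \<otimes> commutator G b x"
        using Z(2)[OF \<theta>Z[OF b(1)] b(1)] by (simp add: \<theta>_def)
      show "commutator G b x \<otimes> x = x \<otimes> commutator G b x"
        using that(2) commutator_eq_one_iff[of "\<theta> b" x] \<theta>Z[OF b(1)] Zc e(1) by (simp add: \<theta>_def)
      show "coprime t (r ^ e)" using z(3) by simp
    qed
  qed
  have mB: "a \<otimes> inv b \<in> B" if "a \<in> B" "b \<in> B" for a b
  proof -
    have ab: "a \<in> Z" "b \<in> Z" "inv b \<in> Z" "a [^] t = \<one>" "b [^] t = \<one>"
      using that subgroup.m_inv_closed[OF Zs] by (auto simp: B_def)
    then have "(a \<otimes> inv b) [^] t = a [^] t \<otimes> (inv b) [^] t"
      by (intro pow_mult_distrib Z(2) Zc)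
    also have "\<dots> = \<one>" using ab Zc by (simp add: nat_pow_inv)
    finally show ?thesis using ab subgroup.m_closed[OF Zs] by (auto simp: B_def)
  qed
  have "inj_on \<theta> (\<theta> ` B)"
  proof (rule inj_onI)
    fix y y' assume "y \<in> \<theta> ` B" "y' \<in> \<theta> ` B" and eq: "\<theta> y = \<theta> y'"
    then obtain b b' where b: "b \<in> B" "y = \<theta> b" "b' \<in> B" "y' = \<theta> b'" by blast
    have bZ: "b \<in> Z" "b' \<in> Z" "inv b' \<in> Z" "y \<in> Z" "y' \<in> Z" "inv y' \<in> Z" 
      using b BZ subgroup.m_inv_closed[OF Zs] \<theta>Z by auto
    have yc: "y \<in> carrier G" "y' \<in> carrier G" "\<theta> y' \<in> carrier G" using bZ Zc \<theta>Z by auto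
    have d: "\<theta> (b \<otimes> inv b') = y \<otimes> inv y'" using bZ b \<theta>_mult \<theta>_inv by simp
    have "\<theta> (y \<otimes> inv y') = \<theta> y \<otimes> inv (\<theta> y')" using bZ \<theta>_mult \<theta>_inv by simp
    also have "\<dots> = \<one>" using eq yc by simp
    finally have "\<theta> (b \<otimes> inv b') = \<one>" using ker[OF mB[OF b(1,3)]] d by simp
    then have "y \<otimes> inv y' = \<one>" using d by simp
    then show "y = y'" using yc by (metis inv_inv inv_equality inv_closed)
  qed
  moreover have finB: "finite (\<theta> ` B)" using finite_subset[OF BZ Z(3)] by simp
  moreover have "\<theta> ` \<theta> ` B \<subseteq> \<theta> ` B" using \<theta>B by blast
  ultimately have \<theta>\<theta>: "\<theta> ` \<theta> ` B = \<theta> ` B" by (simp add: endo_inj_surj)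
  have "\<theta> ` B \<subseteq> comm_values k G (p_elements G r)"
    using k
  proof (induction k rule: dec_induct)
    case base
    show ?case
    proof
      fix y assume "y \<in> \<theta> ` B"
      then have "y \<in> \<theta> ` \<theta> ` B" using \<theta>\<theta> by simp
      then obtain b where b: "b \<in> B" "y = \<theta> (\<theta> b)" by blast
      have bZ: "b \<in> Z" "inv b \<in> Z" "\<theta> b \<in> Z" using b BZ subgroup.m_inv_closed[OF Zs] \<theta>Z by auto
      have car: "b \<in> carrier G" "inv b \<in> carrier G" "\<theta> b \<in> carrier G" using bZ Zc by auto
      \<comment> \<open>With \<open>g = inv b\<close> one gets \<open>[x, g] = \<theta> b\<close>,
        whence \<open>[x^g, x] = [x (\<theta> b), x] = [\<theta> b, x] = y\<close>.\<close>
      have "commutator G x (inv b) = inv (\<theta> (inv b))"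
        using commutator_inv[of "inv b" x] car e(1) by (simp add: \<theta>_def)
      also have "\<dots> = \<theta> b" using \<theta>_inv[OF bZ(1)] car by simp
      finally have "conj_by G (inv b) x = x \<otimes> \<theta> b"
        using conj_by_conv_commutator[of x "inv b"] e(1) car by simp
      then have "commutator G (conj_by G (inv b) x) x = conj_by G (\<theta> b) (commutator G x x) \<otimes> commutator G (\<theta> b) x"
        using commutator_mult_left[of x "\<theta> b" x] e(1) car by simp
      also have "commutator G x x = \<one>" using commutator_eq_one_iff[of x x] e(1) by simp
      finally have "y = commutator G (conj_by G (inv b) x) x"
        using car e(1) b(2) by (simp add: \<theta>_def)
      moreover have "conj_by G (inv b) x \<in> p_elements G r"
        using conj_closedD(2)[OF conj_closed_p_elements car(2) x] .
      ultimately have "y \<in> comm_values (Suc (Suc 0)) G (p_elements G r)"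
        using comm_values_SucI[of "Suc 0" "conj_by G (inv b) x" G "p_elements G r" x] x by simp
      then show "y \<in> comm_values 2 G (p_elements G r)" by (simp add: numeral_2_eq_2)
    qed
  next
    \<comment> \<open>Since \<open>\<theta>\<close> maps its image onto itself, every element there
      is \<open>[u, x]\<close> with \<open>u\<close> a value of length \<open>n\<close>.\<close>
    case (step n)
    show ?case
    proof
      fix y assume "y \<in> \<theta> ` B"
      then have "y \<in> \<theta> ` \<theta> ` B" using \<theta>\<theta> by simp
      then obtain u where "u \<in> \<theta> ` B" "y = commutator G u x" by (auto simp: \<theta>_def)
      then show "y \<in> comm_values (Suc n) G (p_elements G r)"
        using step x by (auto intro!: comm_values_SucI)
    qed
  qed
  \<comment> \<open>\<open>\<theta>\<close> turns powers of \<open>z\<close> into powers of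
    \<open>[z, x]\<close>, so all of these are values and the pigeonhole principle applies.\<close>
  moreover have "commutator G z x [^] i \<in> \<theta> ` B" for i :: nat
  proof -
    have "commutator G z x [^] i = \<theta> (z [^] i)" using \<theta>_pow[OF z(1)] by (simp add: \<theta>_def)
    moreover have "z [^] i \<in> B"
      using subgroup_nat_pow_closed[OF Zs z(1)] z Zc[OF z(1)] 
      by (auto simp: B_def nat_pow_pow mult.commute[of i t]) (simp flip: nat_pow_pow)
    ultimately show ?thesis by blast
  qed
  ultimately have "commutator G z x [^] i \<in> comm_values k G (p_elements G r)" for i :: nat by blast
  then obtain l where "0 < l" "l \<le> m" "commutator G z x [^] l = \<one>"
    using pow_eq_one_ex[OF _ V, of "commutator G z x"] Zc[OF z(1)] e(1) by auto
  then show ?thesis using Zc[OF z(1)] e(1) by (intro fact_pow_eq_one) auto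
qed

end

section \<open>Transfer into a central subgroup\<close>

text \<open>\<open>R\<close> is a transversal of the central subgroup \<open>Z\<close> in \<open>H\<close>.\<close>

definition transfer_map :: "('a, 'b) monoid_scheme \<Rightarrow> 'a set \<Rightarrow> 'a set \<Rightarrow> 'a set \<Rightarrow> ('a \<Rightarrow> 'a) \<Rightarrow> bool" where
  "transfer_map G H Z R \<tau> \<longleftrightarrow> R \<subseteq> H \<and> R \<noteq> {} \<and>
    (\<forall>t\<in>R. \<forall>u\<in>R. t \<otimes>\<^bsub>G\<^esub> inv\<^bsub>G\<^esub> u \<in> Z \<longrightarrow> t = u) \<and>
    (\<forall>h\<in>H. \<tau> h \<in> Z) \<and> (\<forall>h\<in>H. \<forall>k\<in>H. \<tau> (h \<otimes>\<^bsub>G\<^esub> k) = \<tau> h \<otimes>\<^bsub>G\<^esub> \<tau> k) \<and>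
    (\<forall>g\<in>carrier G. \<forall>h\<in>H. \<tau> (conj_by G g h) = conj_by G g (\<tau> h)) \<and>
    (\<forall>z\<in>Z. \<tau> z = z [^]\<^bsub>G\<^esub> card R)"

context group begin

text \<open>The transfer is the product of the elements \<open>t h (\<rho> (t h))^(-1)\<close> of
  \<open>Z\<close> over the transversal. It does not depend on the transversal, and this yields
  equivariance, since conjugation carries one transversal to another.\<close>

lemma central_transfer:
  assumes finH: "finite H" and H: "H \<lhd> G" and Z: "Z \<lhd> G" "Z \<subseteq> H"
    and cent: "\<And>z h. z \<in> Z \<Longrightarrow> h \<in> H \<Longrightarrow> z \<otimes> h = h \<otimes> z"
  shows "\<exists>R \<tau>. transfer_map G H Z R \<tau>"
proof -
  have Hs: "subgroup H G" and Zs: "subgroup Z G" using H Z(1) by (auto dest: normal_imp_subgroup)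
  have Hc: "x \<in> carrier G" if "x \<in> H" for x using subgroup.mem_carrier[OF Hs that] .
  have Zc: "x \<in> carrier G" if "x \<in> Z" for x using subgroup.mem_carrier[OF Zs that] .
  have ZH: "x \<in> H" if "x \<in> Z" for x using that Z(2) by auto
  note Hm = subgroup.m_closed[OF Hs] and Hi = subgroup.m_inv_closed[OF Hs]
  note Zm = subgroup.m_closed[OF Zs] and Zi = subgroup.m_inv_closed[OF Zs]
  let ?Z = "G\<lparr>carrier := Z\<rparr>"
  interpret ZZ: comm_group ?Z
    by (rule group.group_comm_groupI[OF subgroup_imp_group[OF Zs]]) (use cent ZH in auto)
  \<comment> \<open>Cosets of \<open>Z\<close> are represented by a function \<open>\<rho>\<close> on \<open>H\<close> that is constant on them, with transversal \<open>\<rho> ` H\<close>.\<close>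
  define transversal where "transversal = (\<lambda>\<rho>. \<forall>x\<in>H. \<rho> x \<in> H \<and> \<rho> x \<otimes> inv x \<in> Z \<and> (\<forall>z\<in>Z. \<rho> (z \<otimes> x) = \<rho> x))"
  define F where "F = (\<lambda>\<rho> h. finprod ?Z (\<lambda>t. t \<otimes> h \<otimes> inv (\<rho> (t \<otimes> h))) (\<rho> ` H))"
  have T: "\<rho> x \<in> H" "\<rho> x \<otimes> inv x \<in> Z" "\<And>z. z \<in> Z \<Longrightarrow> \<rho> (z \<otimes> x) = \<rho> x"
    if "transversal \<rho>" "x \<in> H" for \<rho> x using that by (auto simp: transversal_def)
  have rep: "\<sigma> (\<rho> x \<otimes> y) = \<sigma> (x \<otimes> y)" if "transversal \<rho>" "transversal \<sigma>" "x \<in> H" "y \<in> H" for \<rho> \<sigma> x y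
  proof -
    have "\<rho> x \<otimes> y = (\<rho> x \<otimes> inv x) \<otimes> (x \<otimes> y)"
      using that T(1)[OF that(1,3)] Hc by (simp add: m_assoc)
    then show ?thesis using T(3)[OF that(2) Hm[OF that(3,4)] T(2)[OF that(1,3)]] by simp
  qed
  have rep': "\<sigma> (\<rho> x) = \<sigma> x" if "transversal \<rho>" "transversal \<sigma>" "x \<in> H" for \<rho> \<sigma> x
    using rep[OF that subgroup.one_closed[OF Hs]] that T(1)[OF that(1,3)] Hc by simp
  have RH: "t \<in> H" "\<rho> t = t" if "transversal \<rho>" "t \<in> \<rho> ` H" for \<rho> t
    using that T(1)[OF that(1)] rep'[OF that(1,1)] by auto
  have termZ: "t \<otimes> h \<otimes> inv (\<rho> (t \<otimes> h)) \<in> Z" if "transversal \<rho>" "t \<in> H" "h \<in> H" for \<rho> t h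
  proof -
    have th: "t \<otimes> h \<in> H" using Hm that by auto
    have "inv (\<rho> (t \<otimes> h) \<otimes> inv (t \<otimes> h)) \<in> Z" by (rule Zi[OF T(2)[OF that(1) th]])
    then show ?thesis using th T(1)[OF that(1) th] Hc by (simp add: inv_mult_group)
  qed
  have perm: "inj_on (\<lambda>t. \<rho> (t \<otimes> k)) (\<rho> ` H)" "(\<lambda>t. \<rho> (t \<otimes> k)) ` \<rho> ` H = \<rho> ` H" 
    if \<rho>: "transversal \<rho>" and k: "k \<in> H" for \<rho> k
  proof -
    show inj: "inj_on (\<lambda>t. \<rho> (t \<otimes> k)) (\<rho> ` H)"
    proof (rule inj_on_inverseI[where g = "\<lambda>t. \<rho> (t \<otimes> inv k)"])
      fix t assume t: "t \<in> \<rho> ` H"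
      note t = RH[OF \<rho> t]
      have "\<rho> (\<rho> (t \<otimes> k) \<otimes> inv k) = \<rho> (t \<otimes> k \<otimes> inv k)"
        by (rule rep[OF \<rho> \<rho> Hm[OF t(1) k] Hi[OF k]])
      then show "\<rho> (\<rho> (t \<otimes> k) \<otimes> inv k) = t" using t k Hc by (simp add: m_assoc)
    qed
    have "(\<lambda>t. \<rho> (t \<otimes> k)) ` \<rho> ` H \<subseteq> \<rho> ` H"
      by (rule image_subsetI, rule imageI) (rule Hm[OF RH(1)[OF \<rho>] k])
    then show "(\<lambda>t. \<rho> (t \<otimes> k)) ` \<rho> ` H = \<rho> ` H"
      using finH inj by (intro endo_inj_surj) auto
  qed
  have reindex: "finprod ?Z (\<lambda>t. f (\<rho> (t \<otimes> k))) (\<rho> ` H) = finprod ?Z f (\<rho> ` H)"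
    if \<rho>: "transversal \<rho>" and k: "k \<in> H" and f: "\<And>t. t \<in> \<rho> ` H \<Longrightarrow> f t \<in> Z" for \<rho> k f
  proof -
    have "f \<in> (\<lambda>t. \<rho> (t \<otimes> k)) ` (\<rho> ` H) \<rightarrow> carrier ?Z"
      unfolding perm(2)[OF \<rho> k] using f by simp
    from ZZ.finprod_reindex[OF this perm(1)[OF \<rho> k]] show ?thesis
      unfolding perm(2)[OF \<rho> k] by simp
  qed
  have FZ: "F \<rho> h \<in> Z" if "transversal \<rho>" "h \<in> H" for \<rho> h
    using ZZ.finprod_closed[of "\<lambda>t. t \<otimes> h \<otimes> inv (\<rho> (t \<otimes> h))" "\<rho> ` H"] termZ[OF that(1) _ that(2)] RH(1)[OF that(1)]
    by (auto simp: F_def)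
  \<comment> \<open>The factor for \<open>h k\<close> at \<open>t\<close> splits into the factor for
    \<open>h\<close> at \<open>t\<close> and the factor for \<open>k\<close> at
    \<open>\<rho> (t h)\<close>; the latter points run through the transversal once.\<close>
  have hom: "F \<rho> (h \<otimes> k) = F \<rho> h \<otimes> F \<rho> k" if \<rho>: "transversal \<rho>" and h: "h \<in> H" and k: "k \<in> H" for \<rho> h k
  proof -
    let ?g = "\<lambda>t. t \<otimes> k \<otimes> inv (\<rho> (t \<otimes> k))"
    have eq: "t \<otimes> (h \<otimes> k) \<otimes> inv (\<rho> (t \<otimes> (h \<otimes> k))) = (t \<otimes> h \<otimes> inv (\<rho> (t \<otimes> h))) \<otimes>\<^bsub>?Z\<^esub> ?g (\<rho> (t \<otimes> h))"
      if "t \<in> \<rho> ` H" for t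
    proof -
      have t: "t \<in> H" using RH(1)[OF \<rho> that] .
      have th: "t \<otimes> h \<in> H" "\<rho> (t \<otimes> h) \<in> H" "\<rho> (t \<otimes> h \<otimes> k) \<in> H" using Hm t h k T(1)[OF \<rho>] by auto
      have "\<rho> (\<rho> (t \<otimes> h) \<otimes> k) = \<rho> (t \<otimes> h \<otimes> k)" by (rule rep[OF \<rho> \<rho> th(1) k])
      then show ?thesis using t h k th Hc by (simp add: m_assoc)
    qed
    have "F \<rho> (h \<otimes> k) = finprod ?Z (\<lambda>t. (t \<otimes> h \<otimes> inv (\<rho> (t \<otimes> h))) \<otimes>\<^bsub>?Z\<^esub> ?g (\<rho> (t \<otimes> h))) (\<rho> ` H)"
      unfolding F_def
      by (rule ZZ.finprod_cong'[OF refl _ eq]) 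
        (use termZ[OF \<rho>] RH(1)[OF \<rho>] h k Hm Zm T(1)[OF \<rho>] in auto)
    also have "\<dots> = F \<rho> h \<otimes>\<^bsub>?Z\<^esub> finprod ?Z (\<lambda>t. ?g (\<rho> (t \<otimes> h))) (\<rho> ` H)"
      unfolding F_def
      by (rule ZZ.finprod_multf) (use termZ[OF \<rho>] RH(1)[OF \<rho>] h k Hm Zm T(1)[OF \<rho>] in auto)
    also have "finprod ?Z (\<lambda>t. ?g (\<rho> (t \<otimes> h))) (\<rho> ` H) = F \<rho> k"
      unfolding F_def
      by (rule reindex[OF \<rho> h, where f = ?g]) (use termZ[OF \<rho>] RH(1)[OF \<rho>] k in auto)
    finally show ?thesis by simp
  qed
  \<comment> \<open>Changing the representative of \<open>t\<close> by the central element
    \<open>?z t\<close> multiplies each factor by \<open>?z t\<close> and divides it by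
    \<open>?z (\<rho> (t h))\<close>. These corrections cancel, because
    \<open>t \<mapsto> \<rho> (t h)\<close> is a permutation.\<close>
  have indep: "F \<rho>' h = F \<rho> h" if \<rho>: "transversal \<rho>" and \<rho>': "transversal \<rho>'" and h: "h \<in> H" for \<rho> \<rho>' h
  proof -
    let ?z = "\<lambda>t. \<rho>' t \<otimes> inv t"
    let ?f = "\<lambda>t. t \<otimes> h \<otimes> inv (\<rho> (t \<otimes> h))" and ?f' = "\<lambda>t. t \<otimes> h \<otimes> inv (\<rho>' (t \<otimes> h))"
    have inj: "inj_on \<rho>' (\<rho> ` H)"
    proof (rule inj_on_inverseI[where g = \<rho>])
      fix t assume "t \<in> \<rho> ` H"
      then show "\<rho> (\<rho>' t) = t" using rep'[OF \<rho>' \<rho>, of t] RH[OF \<rho>, of t] by simp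
    qed
    have img: "\<rho>' ` \<rho> ` H = \<rho>' ` H" using rep'[OF \<rho> \<rho>'] by (auto simp: image_image)
    have zZ: "?z t \<in> Z" if "t \<in> \<rho> ` H" for t using T(2)[OF \<rho>'] RH(1)[OF \<rho> that] by auto
    have f'Z: "?f' (\<rho>' t) \<in> Z" if "t \<in> \<rho> ` H" for t
      using termZ[OF \<rho>' _ h] T(1)[OF \<rho>'] RH(1)[OF \<rho> that] by auto
    have fZ: "?f t \<in> Z" if "t \<in> \<rho> ` H" for t using termZ[OF \<rho> _ h] RH(1)[OF \<rho> that] by auto
    have uR: "\<rho> (t \<otimes> h) \<in> \<rho> ` H" if "t \<in> \<rho> ` H" for t using RH(1)[OF \<rho> that] Hm h by auto
    have eq: "?f' (\<rho>' t) \<otimes>\<^bsub>?Z\<^esub> ?z (\<rho> (t \<otimes> h)) = ?z t \<otimes>\<^bsub>?Z\<^esub> ?f t" if "t \<in> \<rho> ` H" for t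
    proof -
      have t: "t \<in> H" using RH(1)[OF \<rho> that] .
      have th: "t \<otimes> h \<in> H" "\<rho> (t \<otimes> h) \<in> H" "\<rho>' (t \<otimes> h) \<in> H" "\<rho>' t \<in> H" 
        using Hm t h T(1)[OF \<rho>] T(1)[OF \<rho>'] by auto
      have "\<rho>' (\<rho>' t \<otimes> h) = \<rho>' (t \<otimes> h)" "\<rho>' (\<rho> (t \<otimes> h)) = \<rho>' (t \<otimes> h)"
        using rep[OF \<rho>' \<rho>' t h] rep'[OF \<rho> \<rho>' th(1)] by auto
      then show ?thesis using t h th Hc by (simp add: m_assoc)
    qed
    have "F \<rho>' h = finprod ?Z (\<lambda>t. ?f' (\<rho>' t)) (\<rho> ` H)"
      unfolding F_def img[symmetric]
      by (rule ZZ.finprod_reindex[OF _ inj]) (use f'Z in auto)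
    moreover have "finprod ?Z (\<lambda>t. ?z (\<rho> (t \<otimes> h))) (\<rho> ` H) = finprod ?Z ?z (\<rho> ` H)"
      by (rule reindex[OF \<rho> h, where f = ?z]) (use zZ in auto)
    moreover have "finprod ?Z (\<lambda>t. ?f' (\<rho>' t)) (\<rho> ` H) \<otimes>\<^bsub>?Z\<^esub> finprod ?Z (\<lambda>t. ?z (\<rho> (t \<otimes> h))) (\<rho> ` H)
        = finprod ?Z (\<lambda>t. ?f' (\<rho>' t) \<otimes>\<^bsub>?Z\<^esub> ?z (\<rho> (t \<otimes> h))) (\<rho> ` H)"
      by (rule ZZ.finprod_multf[symmetric]) (use f'Z zZ uR in auto)
    moreover have "\<dots> = finprod ?Z (\<lambda>t. ?z t \<otimes>\<^bsub>?Z\<^esub> ?f t) (\<rho> ` H)"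
      by (rule ZZ.finprod_cong'[OF refl _ eq]) (use zZ fZ Zm in auto)
    moreover have "\<dots> = finprod ?Z ?z (\<rho> ` H) \<otimes>\<^bsub>?Z\<^esub> F \<rho> h"
      unfolding F_def by (rule ZZ.finprod_multf) (use zZ fZ in auto)
    ultimately have "F \<rho>' h \<otimes> finprod ?Z ?z (\<rho> ` H) = finprod ?Z ?z (\<rho> ` H) \<otimes> F \<rho> h" by simp
    moreover have zp: "finprod ?Z ?z (\<rho> ` H) \<in> Z"
      using ZZ.finprod_closed[of ?z "\<rho> ` H"] zZ by auto
    ultimately have "F \<rho>' h \<otimes> finprod ?Z ?z (\<rho> ` H) = F \<rho> h \<otimes> finprod ?Z ?z (\<rho> ` H)"
      using cent[OF zp ZH[OF FZ[OF \<rho> h]]] by simp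
    then show ?thesis using right_cancel Zc[OF zp] Zc[OF FZ[OF \<rho> h]] Zc[OF FZ[OF \<rho>' h]] by simp
  qed
  have conj_finprod: "conj_by G g (finprod ?Z f A) = finprod ?Z (\<lambda>t. conj_by G g (f t)) A"
    if g: "g \<in> carrier G" and "finite A" "\<And>t. t \<in> A \<Longrightarrow> f t \<in> Z" for g f and A :: "'a set"
    using that(2,3)
  proof (induction A rule: finite_induct)
    case empty
    then show ?case using g by simp
  next
    case (insert a A)
    have "finprod ?Z f A \<in> Z" using ZZ.finprod_closed[of f A] insert.prems by auto
    moreover have "finprod ?Z f (insert a A) = f a \<otimes> finprod ?Z f A"
      using insert by (subst ZZ.finprod_insert) auto
    moreover have "finprod ?Z (\<lambda>t. conj_by G g (f t)) (insert a A) =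
        conj_by G g (f a) \<otimes> finprod ?Z (\<lambda>t. conj_by G g (f t)) A"
      using insert normal_conj_by[OF Z(1) g] by (subst ZZ.finprod_insert) auto
    ultimately show ?case using insert g Zc by (simp add: conj_by_mult)
  qed
  \<comment> \<open>\<open>\<rho>'\<close> is the transversal conjugated by \<open>g\<close>. Its
    transfer at the conjugate of \<open>h\<close> is the conjugate of the transfer of
    \<open>h\<close>, factor by factor.\<close>
  have equi: "F \<rho> (conj_by G g h) = conj_by G g (F \<rho> h)" 
    if \<rho>: "transversal \<rho>" and g: "g \<in> carrier G" and h: "h \<in> H" for \<rho> g h
  proof -
    define \<rho>' where "\<rho>' = (\<lambda>x. conj_by G g (\<rho> (conj_by G (inv g) x)))"
    have cH: "conj_by G g x \<in> H" "conj_by G (inv g) x \<in> H" if "x \<in> H" for x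
      using normal_conj_by[OF H] g that by auto
    have "transversal \<rho>'" unfolding transversal_def
    proof (intro ballI conjI)
      fix x assume x: "x \<in> H"
      let ?y = "conj_by G (inv g) x"
      have y: "?y \<in> H" "\<rho> ?y \<in> H" using cH x T(1)[OF \<rho>] by auto
      then show "\<rho>' x \<in> H" using cH by (simp add: \<rho>'_def)
      have "conj_by G g (\<rho> ?y \<otimes> inv ?y) \<in> Z" using normal_conj_by[OF Z(1) g T(2)[OF \<rho> y(1)]] .
      then show "\<rho>' x \<otimes> inv x \<in> Z" using x y g Hc by (simp add: \<rho>'_def conj_by_mult conj_by_inv)
      fix z assume z: "z \<in> Z"
      have "conj_by G (inv g) (z \<otimes> x) = conj_by G (inv g) z \<otimes> ?y"
        using z x g Zc Hc by (simp add: conj_by_mult)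
      then show "\<rho>' (z \<otimes> x) = \<rho>' x"
        using T(3)[OF \<rho> y(1)] normal_conj_by[OF Z(1) _ z, of "inv g"] g by (simp add: \<rho>'_def)
    qed
    then have "F \<rho> (conj_by G g h) = F \<rho>' (conj_by G g h)"
      using indep[OF \<rho>] cH h by auto
    have img: "\<rho>' ` H = conj_by G g ` \<rho> ` H"
    proof (intro equalityI subsetI)
      fix y assume "y \<in> \<rho>' ` H"
      then show "y \<in> conj_by G g ` \<rho> ` H" using cH by (auto simp: \<rho>'_def)
    next
      fix y assume "y \<in> conj_by G g ` \<rho> ` H"
      then obtain x where x: "x \<in> H" "y = conj_by G g (\<rho> x)" by auto
      then have "y = \<rho>' (conj_by G g x)" using g Hc by (simp add: \<rho>'_def)
      then show "y \<in> \<rho>' ` H" using cH x by auto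
    qed
    let ?f' = "\<lambda>s. s \<otimes> conj_by G g h \<otimes> inv (\<rho>' (s \<otimes> conj_by G g h))"
    have f': "?f' (conj_by G g t) = conj_by G g (t \<otimes> h \<otimes> inv (\<rho> (t \<otimes> h)))" if "t \<in> \<rho> ` H" for t
    proof -
      have t: "t \<in> H" "t \<otimes> h \<in> H" "\<rho> (t \<otimes> h) \<in> H" using RH(1)[OF \<rho> that] Hm h T(1)[OF \<rho>] by auto
      have e: "conj_by G g t \<otimes> conj_by G g h = conj_by G g (t \<otimes> h)" using t h g Hc by (simp add: conj_by_mult)
      have "\<rho>' (conj_by G g (t \<otimes> h)) = conj_by G g (\<rho> (t \<otimes> h))" using t g Hc by (simp add: \<rho>'_def)
      then show ?thesis unfolding e using t g Hc by (simp add: conj_by_mult conj_by_inv)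
    qed
    have inj: "inj_on (conj_by G g) (\<rho> ` H)"
      using inj_on_conj_by[OF g] RH(1)[OF \<rho>] Hc by (meson inj_on_subset subsetI)
    have tZ: "conj_by G g (t \<otimes> h \<otimes> inv (\<rho> (t \<otimes> h))) \<in> Z" if "t \<in> \<rho> ` H" for t
      using normal_conj_by[OF Z(1) g termZ[OF \<rho> RH(1)[OF \<rho> that] h]] .
    have "F \<rho>' (conj_by G g h) = finprod ?Z (\<lambda>t. ?f' (conj_by G g t)) (\<rho> ` H)"
      unfolding F_def img by (rule ZZ.finprod_reindex[OF _ inj]) (use f' tZ in auto)
    also have "\<dots> = finprod ?Z (\<lambda>t. conj_by G g (t \<otimes> h \<otimes> inv (\<rho> (t \<otimes> h)))) (\<rho> ` H)"
      by (rule ZZ.finprod_cong'[OF refl _ f']) (use tZ in auto)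
    also have "\<dots> = conj_by G g (F \<rho> h)"
      unfolding F_def using finH termZ[OF \<rho> RH(1)[OF \<rho>] h] by (intro conj_finprod[OF g, symmetric]) auto
    finally show ?thesis using \<open>F \<rho> (conj_by G g h) = F \<rho>' (conj_by G g h)\<close> by simp
  qed
  have pow: "F \<rho> z = z [^] card (\<rho> ` H)" if \<rho>: "transversal \<rho>" and z: "z \<in> Z" for \<rho> z
  proof -
    have "t \<otimes> z \<otimes> inv (\<rho> (t \<otimes> z)) = z" if "t \<in> \<rho> ` H" for t
    proof -
      note t = RH[OF \<rho> that]
      have "t \<otimes> z = z \<otimes> t" using cent[OF z t(1)] by simp
      then have "\<rho> (t \<otimes> z) = t" using T(3)[OF \<rho> t(1) z] t by simp
      then show ?thesis using \<open>t \<otimes> z = z \<otimes> t\<close> t Hc Zc z by (simp add: m_assoc)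
    qed
    then have "F \<rho> z = finprod ?Z (\<lambda>t. z) (\<rho> ` H)"
      unfolding F_def using z by (intro ZZ.finprod_cong') auto
    also have "\<dots> = z [^]\<^bsub>?Z\<^esub> card (\<rho> ` H)" using z by (intro ZZ.finprod_const) simp
    finally show ?thesis by (simp add: subgroup_pow_carrier_update)
  qed
  \<comment> \<open>The choice is made from the coset as a set, so equal cosets receive the same
    representative.\<close>
  define \<rho> where "\<rho> = (\<lambda>x. SOME y. y \<in> {z \<otimes> x | z. z \<in> Z})"
  have \<rho>: "transversal \<rho>" unfolding transversal_def
  proof (intro ballI conjI)
    fix x assume x: "x \<in> H"
    have "\<one> \<otimes> x \<in> {z \<otimes> x | z. z \<in> Z}" using subgroup.one_closed[OF Zs] by blast
    then have "\<rho> x \<in> {z \<otimes> x | z. z \<in> Z}" unfolding \<rho>_def by (rule someI)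
    then obtain z where z: "z \<in> Z" "\<rho> x = z \<otimes> x" by blast
    then show "\<rho> x \<in> H" using ZH Hm x by simp
    show "\<rho> x \<otimes> inv x \<in> Z" using z x Zc Hc by (simp add: m_assoc)
    fix w assume w: "w \<in> Z"
    have "{z \<otimes> (w \<otimes> x) | z. z \<in> Z} = {z \<otimes> x | z. z \<in> Z}"
    proof (intro equalityI subsetI)
      fix y assume "y \<in> {z \<otimes> (w \<otimes> x) | z. z \<in> Z}"
      then obtain z where "z \<in> Z" "y = (z \<otimes> w) \<otimes> x" using w x Zc Hc by (auto simp: m_assoc)
      then show "y \<in> {z \<otimes> x | z. z \<in> Z}" using Zm[OF _ w] by blast
    next
      fix y assume "y \<in> {z \<otimes> x | z. z \<in> Z}"
      then obtain z where z: "z \<in> Z" "y = z \<otimes> x" by blast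
      then have "y = (z \<otimes> inv w) \<otimes> (w \<otimes> x)" using w x Zc Hc by (simp add: m_assoc)
      then show "y \<in> {z \<otimes> (w \<otimes> x) | z. z \<in> Z}" using Zm[OF z(1) Zi[OF w]] by blast
    qed
    then show "\<rho> (w \<otimes> x) = \<rho> x" by (simp only: \<rho>_def)
  qed
  have sep: "t = u" if "t \<in> \<rho> ` H" "u \<in> \<rho> ` H" "t \<otimes> inv u \<in> Z" for t u
  proof -
    note tu = RH[OF \<rho> that(1)] RH[OF \<rho> that(2)]
    have "t = (t \<otimes> inv u) \<otimes> u" using tu Hc by (simp add: m_assoc)
    then show ?thesis using T(3)[OF \<rho> tu(3) that(3)] tu by simp
  qed
  have "\<rho> ` H \<subseteq> H" "\<rho> ` H \<noteq> {}" using T(1)[OF \<rho>] subgroup.one_closed[OF Hs] by auto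
  then have "transfer_map G H Z (\<rho> ` H) (F \<rho>)"
    unfolding transfer_map_def using sep FZ[OF \<rho>] hom[OF \<rho>] equi[OF \<rho>] pow[OF \<rho>] by simp
  then show ?thesis by blast
qed

end

section \<open>Finite groups\<close>

text \<open>The first factor raises an element of \<open>\<langle>V\<rangle>\<close> into the centre, the second is a multiple of the index of
  the centre, and the last kills the transfer of every element of \<open>V\<close>.\<close>

definition exponent_bound :: "nat \<Rightarrow> nat" where
  "exponent_bound m = fact m * fact (m ^ m) * (fact m * fact m ^ m)"

context group begin

text \<open>The hypothesis \<open>k \<ge> 2\<close> makes every value a genuine commutator
  \<open>[c, x]\<close>, to which the comparison of \<open>[c, x^i]\<close> with powers of
  \<open>v\<close> applies.\<close>

lemma p_comm_values_exponent:
  assumes fin: "finite (carrier G)" and k: "k \<ge> 2" and m: "card (p_comm_values k G) \<le> m"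
    and v: "v \<in> p_comm_values k G"
  shows "v [^] exponent_bound m = \<one>"
proof -
  define V where "V = p_comm_values k G"
  have k0: "k > 0" using k by simp
  have V: "conj_closed G V" unfolding V_def using k0 by (rule conj_closed_p_comm_values)
  have Vc: "V \<subseteq> carrier G" using V by (rule conj_closedD)
  have finV: "finite V" using finite_subset[OF Vc fin] .
  have mV: "card V \<le> m" using m by (simp add: V_def)
  have "V \<noteq> {}" using one_p_comm_values[OF k0] by (auto simp: V_def)
  then have "card V > 0" using finV by (simp add: card_gt_0_iff)
  then have "m > 0" using mV by linarith
  have Vp: "comm_values k G (p_elements G p) \<subseteq> V" if "prime p" for p
    using that by (auto simp: V_def p_comm_values_def)
  have Vp_fin: "finite (comm_values k G (p_elements G p))" "card (comm_values k G (p_elements G p)) \<le> m"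
    if "prime p" for p
    using finite_subset[OF Vp[OF that] finV] card_mono[OF finV Vp[OF that]] mV by auto
  define H where "H = generate G V"
  have H: "H \<lhd> G" unfolding H_def by (rule conj_closed_generate_normal[OF V])
  have Hs: "subgroup H G" using H by (rule normal_imp_subgroup)
  have Hc: "x \<in> carrier G" if "x \<in> H" for x using subgroup.mem_carrier[OF Hs that] .
  have finH: "finite H" using finite_subset[OF subgroup.subset[OF Hs] fin] .
  have VH: "V \<subseteq> H" unfolding H_def by (auto intro: generate.incl)
  \<comment> \<open>This is the centre of \<open>H\<close>, as \<open>V\<close> generates
    \<open>H\<close>.\<close>
  define Z where "Z = {z \<in> H. \<forall>u\<in>V. commutator G z u = \<one>}"
  have ZH: "Z \<subseteq> H" by (auto simp: Z_def)
  have cent1: "commutator G z h = \<one>" if "z \<in> Z" "h \<in> H" for z h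
  proof -
    have "commutator G z h \<in> {\<one>}"
    proof (rule commutator_generate_in_normal[OF one_is_normal Vc])
      show "z \<in> carrier G" using that Hc ZH by blast
      show "h \<in> generate G V" using that by (simp add: H_def)
    qed (use that in \<open>simp add: Z_def\<close>)
    then show ?thesis by simp
  qed
  have cent: "z \<otimes> h = h \<otimes> z" if "z \<in> Z" "h \<in> H" for z h
    using cent1[OF that] commutator_eq_one_iff[of z h] Hc that ZH by (simp add: subset_iff)
  have Z: "Z \<lhd> G"
  proof (rule normalI_conj_by)
    show "subgroup Z G"
    proof (rule subgroupI)
      show "Z \<subseteq> carrier G" using ZH Hc by auto
      have "\<one> \<in> Z" using subgroup.one_closed[OF Hs] Vc by (auto simp: Z_def)
      then show "Z \<noteq> {}" by blast
    next
      fix z assume z: "z \<in> Z"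
      then have "inv z \<in> H" using subgroup.m_inv_closed[OF Hs] by (auto simp: Z_def)
      then show "inv z \<in> Z" using z Vc Hc by (auto simp: Z_def commutator_inv_left)
    next
      fix z w assume z: "z \<in> Z" "w \<in> Z"
      then have "z \<otimes> w \<in> H" using subgroup.m_closed[OF Hs] by (auto simp: Z_def)
      then show "z \<otimes> w \<in> Z" using z Vc Hc by (auto simp: Z_def commutator_mult_left)
    qed
  next
    fix g z assume g: "g \<in> carrier G" and z: "z \<in> Z"
    have zH: "z \<in> H" using z ZH by auto
    have "commutator G (conj_by G g z) u = \<one>" if u: "u \<in> V" for u
    proof -
      have u': "conj_by G (inv g) u \<in> V" using conj_closedD(2)[OF V _ u] g by simp
      have "commutator G z (conj_by G (inv g) u) = \<one>" using z u' by (auto simp: Z_def)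
      then have "conj_by G g (commutator G z (conj_by G (inv g) u)) = \<one>" using g by simp
      then show ?thesis using g Hc[OF zH] u Vc by (simp add: conj_by_commutator subset_iff)
    qed
    then show "conj_by G g z \<in> Z" using normal_conj_by[OF H g zH] by (simp add: Z_def)
  qed
  have Zs: "subgroup Z G" using Z by (rule normal_imp_subgroup)
  have Zc: "x \<in> carrier G" if "x \<in> Z" for x using subgroup.mem_carrier[OF Zs that] .
  have Zcomm: "a \<otimes> b = b \<otimes> a" if "a \<in> Z" "b \<in> Z" for a b using cent[OF that(1)] that(2) ZH by auto
  have finZ: "finite Z" using finite_subset[OF ZH finH] .
  obtain R \<tau> where transfer: "transfer_map G H Z R \<tau>"
    using central_transfer[OF finH H Z ZH] cent by blast
  have R: "R \<subseteq> H" "R \<noteq> {}" "\<And>t u. t \<in> R \<Longrightarrow> u \<in> R \<Longrightarrow> t \<otimes> inv u \<in> Z \<Longrightarrow> t = u"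
    and \<tau>Z: "\<And>h. h \<in> H \<Longrightarrow> \<tau> h \<in> Z"
    and \<tau>_mult: "\<And>h k. h \<in> H \<Longrightarrow> k \<in> H \<Longrightarrow> \<tau> (h \<otimes> k) = \<tau> h \<otimes> \<tau> k"
    and \<tau>_conj: "\<And>g h. g \<in> carrier G \<Longrightarrow> h \<in> H \<Longrightarrow> \<tau> (conj_by G g h) = conj_by G g (\<tau> h)"
    and \<tau>_cent: "\<And>z. z \<in> Z \<Longrightarrow> \<tau> z = z [^] card R"
    using transfer unfolding transfer_map_def by simp_all
  \<comment> \<open>Elements of the transversal that conjugate \<open>V\<close> in the same way
    differ by an element of \<open>Z\<close>, so \<open>R\<close> embeds into the self-maps of
    \<open>V\<close>.\<close>
  have cardR: "0 < card R" "card R \<le> m ^ m"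
  proof -
    show "0 < card R" using R(2) finite_subset[OF R(1) finH] by (simp add: card_gt_0_iff)
    let ?f = "\<lambda>t. restrict (conj_by G t) V"
    have "inj_on ?f R"
    proof (rule inj_onI)
      fix t u assume t: "t \<in> R" "u \<in> R" and eq: "?f t = ?f u"
      have tu: "t \<in> H" "u \<in> H" "t \<otimes> inv u \<in> H" 
        using t R(1) by (auto intro!: subgroup.m_closed[OF Hs] subgroup.m_inv_closed[OF Hs])
      have car: "t \<in> carrier G" "u \<in> carrier G" "t \<otimes> inv u \<in> carrier G" using tu Hc by auto
      have "commutator G (t \<otimes> inv u) w = \<one>" if w: "w \<in> V" for w
      proof -
        have wc: "w \<in> carrier G" using w Vc by auto
        have "conj_by G t w = conj_by G u w" using fun_cong[OF eq, of w] w by simp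
        then have "conj_by G (t \<otimes> inv u) w = w"
          using car wc by (simp flip: conj_by_conj_by)
        then have "w \<otimes> (t \<otimes> inv u) = (t \<otimes> inv u) \<otimes> w" using conj_by_eq_self_iff[OF car(3) wc] by simp
        then show ?thesis using commutator_eq_one_iff[OF car(3) wc] by simp
      qed
      then show "t = u" using R(3)[OF t] tu by (simp add: Z_def)
    qed
    moreover have "?f ` R \<subseteq> V \<rightarrow>\<^sub>E V"
      using conj_closedD(2)[OF V] R(1) Hc by (auto simp: subset_iff)
    moreover have finE: "finite (V \<rightarrow>\<^sub>E V)" using finV by (intro finite_PiE) auto
    ultimately have "card R \<le> card (V \<rightarrow>\<^sub>E V)" by (rule card_inj_on_le)
    also have "\<dots> = card V ^ card V" using finV by (simp add: card_PiE)
    also have "\<dots> \<le> m ^ card V" using mV by (rule power_mono) simp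
    also have "\<dots> \<le> m ^ m" using mV \<open>m > 0\<close> by (intro power_increasing) auto
    finally show "card R \<le> m ^ m" .
  qed
  define y where "y = \<tau> v"
  have vV: "v \<in> V" using v by (simp add: V_def)
  have vH: "v \<in> H" using vV VH by auto
  have vc: "v \<in> carrier G" using vH Hc by auto
  have yZ: "y \<in> Z" unfolding y_def by (rule \<tau>Z[OF vH])
  have yc: "y \<in> carrier G" using yZ Zc by auto
  obtain r where r: "prime r" "v \<in> comm_values k G (p_elements G r)"
    using v by (auto simp: p_comm_values_def)
  \<comment> \<open>The exponent may depend on \<open>G\<close> through \<open>t\<close>, but only
    outside \<open>q\<close>; letting \<open>q\<close> vary removes \<open>t\<close>
    altogether.\<close>
  have local_part: "\<exists>t. \<not> q dvd t \<and> y [^] ((fact m * fact m ^ m) * t :: nat) = \<one>" if q: "prime q" for q :: nat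
  proof -
    have "order G \<noteq> 0" using fin order_gt_0_iff_finite by simp
    moreover have "\<not> is_unit q" using q by auto
    ultimately obtain t where t: "order G = q ^ multiplicity q (order G) * t" "\<not> q dvd t"
      using multiplicity_decompose'[of "order G" q] by blast
    \<comment> \<open>The factor \<open>t\<close> projects onto the \<open>q\<close>-part. The
      factor \<open>fact m\<close> makes elements of order prime to \<open>q\<close> act trivially
      on the image.\<close>
    define \<sigma> where "\<sigma> = (\<lambda>h. \<tau> h [^] (t * fact m))"
    have \<sigma>Z: "\<sigma> h \<in> Z" if "h \<in> H" for h
      unfolding \<sigma>_def by (rule subgroup_nat_pow_closed[OF Zs \<tau>Z[OF that]])
    have \<sigma>_mult: "\<sigma> (h \<otimes> h') = \<sigma> h \<otimes> \<sigma> h'" if "h \<in> H" "h' \<in> H" for h h'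
      unfolding \<sigma>_def \<tau>_mult[OF that]
      by (rule pow_mult_distrib[OF Zcomm[OF \<tau>Z \<tau>Z] Zc[OF \<tau>Z] Zc[OF \<tau>Z]]) (use that in auto)
    have \<sigma>_conj: "\<sigma> (conj_by G g h) = conj_by G g (\<sigma> h)" if "g \<in> carrier G" "h \<in> H" for g h
      using \<tau>_conj[OF that] conj_by_pow[OF that(1) Zc[OF \<tau>Z[OF that(2)]]] by (simp add: \<sigma>_def)
    have \<sigma>_one: "\<sigma> \<one> = \<one>"
    proof -
      have o: "\<one> \<in> H" by (rule subgroup.one_closed[OF Hs])
      have "\<sigma> \<one> \<otimes> \<sigma> \<one> = \<sigma> \<one>" using \<sigma>_mult[OF o o] by simp
      then show ?thesis using Zc[OF \<sigma>Z[OF o]] by simp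
    qed
    have \<sigma>_pow: "\<sigma> (h [^] (n::nat)) = \<sigma> h [^] n" if "h \<in> H" for h n
      by (induction n) (use that \<sigma>_one \<sigma>_mult subgroup_nat_pow_closed[OF Hs that] in auto)
    have \<sigma>_inv: "\<sigma> (inv h) = inv (\<sigma> h)" if "h \<in> H" for h
    proof -
      have i: "inv h \<in> H" by (rule subgroup.m_inv_closed[OF Hs that])
      have "\<sigma> (inv h) \<otimes> \<sigma> h = \<one>" using \<sigma>_mult[OF i that] \<sigma>_one Hc[OF that] by simp
      then show ?thesis using inv_equality Zc[OF \<sigma>Z[OF i]] Zc[OF \<sigma>Z[OF that]] by simp
    qed
    have \<sigma>_comm: "\<sigma> (commutator G h g) = commutator G (\<sigma> h) g" if "h \<in> H" "g \<in> carrier G" for h g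
    proof -
      have "conj_by G g h \<in> H" by (rule normal_conj_by[OF H that(2,1)])
      then show ?thesis
        using that Hc Zc[OF \<sigma>Z[OF that(1)]] \<sigma>_mult[OF subgroup.m_inv_closed[OF Hs that(1)]] \<sigma>_inv \<sigma>_conj
        by (simp add: commutator_conv_conj_by)
    qed
    have \<tau>q: "(\<tau> h [^] t) [^] (q ^ multiplicity q (order G)) = \<one>" if "h \<in> H" for h
    proof -
      have "(\<tau> h [^] t) [^] (q ^ multiplicity q (order G)) = \<tau> h [^] order G"
        using Zc[OF \<tau>Z[OF that]] by (subst t(1)) (simp add: nat_pow_pow mult.commute)
      then show ?thesis using pow_order_eq_1[OF Zc[OF \<tau>Z[OF that]]] by simp
    qed
    have \<sigma>q: "\<sigma> h \<in> p_elements G q" if "h \<in> H" for h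
    proof -
      have c: "\<tau> h \<in> carrier G" by (rule Zc[OF \<tau>Z[OF that]])
      have "\<sigma> h [^] (q ^ multiplicity q (order G)) = ((\<tau> h [^] t) [^] (q ^ multiplicity q (order G))) [^] (fact m :: nat)"
        using c by (simp add: \<sigma>_def nat_pow_pow mult_ac)
      then have "\<sigma> h [^] (q ^ multiplicity q (order G)) = \<one>" using \<tau>q[OF that] by simp
      then show ?thesis using Zc[OF \<sigma>Z[OF that]] by (auto simp: p_elements_def)
    qed
    \<comment> \<open>\<open>coprime_action_exponent\<close> kills \<open>[z, x]\<close> by the
      power \<open>fact m\<close>; as \<open>Z\<close> is abelian and normal, that power can be
      moved onto \<open>z\<close>.\<close>
    have \<sigma>_cent: "commutator G (\<sigma> h) x = \<one>" if h: "h \<in> H" and p: "prime p" "p \<noteq> q" "x \<in> p_elements G p" for h p x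
    proof -
      define z where "z = \<tau> h [^] t"
      have z: "z \<in> Z" unfolding z_def by (rule subgroup_nat_pow_closed[OF Zs \<tau>Z[OF h]])
      have x: "x \<in> carrier G" using p(3) by (simp add: p_elements_def)
      have "coprime (q ^ multiplicity q (order G)) p" using p q by (simp add: primes_coprime)
      then have 1: "commutator G z x [^] (fact m :: nat) = \<one>"
        using coprime_action_exponent[OF Z Zcomm finZ k Vp_fin[OF p(1)] p(3) z] \<tau>q[OF h] by (simp add: z_def)
      have "commutator G z x \<in> Z" by (rule commutator_in_normal(1)[OF Z x z])
      then have "commutator G (z [^] (fact m :: nat)) x = commutator G z x [^] (fact m :: nat)"
        using Zcomm z by (intro commutator_pow_left Zc x) auto
      moreover have "z [^] (fact m :: nat) = \<sigma> h"
        using Zc[OF \<tau>Z[OF h]] by (simp add: z_def \<sigma>_def nat_pow_pow)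
      ultimately show ?thesis using 1 by simp
    qed
    have "\<sigma> v [^] (fact m ^ m :: nat) = \<one>"
    proof (cases "q = r")
      case False
      obtain c x where cx: "v = commutator G c x" "c \<in> comm_values (k - 1) G (p_elements G r)" "x \<in> p_elements G r"
        using r(2) comm_values_Suc[of "k - 1" G "p_elements G r"] k by auto
      have car: "c \<in> carrier G" "x \<in> carrier G"
        using cx comm_values_closed[OF p_elements_closed, of "k - 1" r] k by (auto simp: p_elements_def)
      have xi: "x [^] i \<in> p_elements G r" for i :: nat
      proof -
        obtain a where a: "x [^] (r ^ a) = \<one>" using cx(3) by (auto simp: p_elements_def)
        have "(x [^] i) [^] (r ^ a) = (x [^] (r ^ a)) [^] i" using car by (simp add: nat_pow_pow mult.commute)
        then show ?thesis using a car by (auto simp: p_elements_def)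
      qed
      have inV: "commutator G c (x [^] i) \<in> V" for i :: nat
        using comm_values_SucI[OF _ cx(2) xi, of i] k Vp[OF r(1)] by auto
      then obtain l where l: "0 < l" "l \<le> m" "commutator G c (x [^] l) = \<one>"
        using commutator_pow_eq_one_ex[OF car finV mV] by blast
      \<comment> \<open>Here \<open>x\<close> is an \<open>r\<close>-element with \<open>r\<close>
        different from \<open>q\<close>, so it centralizes the image of \<open>\<sigma>\<close> and
        no error term arises.\<close>
      have "\<sigma> (commutator G c (x [^] i)) = \<sigma> v [^] i" for i :: nat
      proof (induction i)
        case 0
        then show ?case using car \<sigma>_one by simp
      next
        case (Suc i)
        let ?w = "commutator G c (x [^] i)"
        have w: "?w \<in> H" using inV VH by auto
        have "commutator G c (x [^] Suc i) = v \<otimes> conj_by G x ?w"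
          using car by (simp add: commutator_mult_right cx(1))
        then have "\<sigma> (commutator G c (x [^] Suc i)) = \<sigma> v \<otimes> conj_by G x (\<sigma> ?w)"
          using \<sigma>_mult[OF vH normal_conj_by[OF H car(2) w]] \<sigma>_conj[OF car(2) w] by simp
        also have "conj_by G x (\<sigma> ?w) = \<sigma> ?w"
          using conj_by_conv_commutator[OF Zc[OF \<sigma>Z[OF w]] car(2)] \<sigma>_cent[OF w r(1) _ cx(3)] False Zc[OF \<sigma>Z[OF w]] by simp
        finally show ?case using Suc.IH Zc[OF \<sigma>Z[OF vH]] by (simp add: nat_pow_Suc2[symmetric])
      qed
      from this[of l] have "\<sigma> v [^] l = \<one>" using l(3) \<sigma>_one by simp
      then have "\<sigma> v [^] (fact m :: nat) = \<one>" using fact_pow_eq_one[OF Zc[OF \<sigma>Z[OF vH]] l(1,2)] by simp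
      then show ?thesis
        using pow_mult_exponent_one[OF Zc[OF \<sigma>Z[OF vH]]] \<open>m > 0\<close> by (metis dvd_power)
    next
      case True
      \<comment> \<open>The \<open>q\<close>-elements form a nilpotent group modulo \<open>N\<close>, in which \<open>\<gamma>\<^sub>k\<close> becomes abelian.\<close>
      define N where "N = {h \<in> H. \<sigma> h = \<one>}"
      have N: "N \<lhd> G"
      proof (rule normalI_conj_by)
        show "subgroup N G"
        proof (rule subgroupI)
          show "N \<subseteq> carrier G" using Hc by (auto simp: N_def)
          have "\<one> \<in> N" using \<sigma>_one subgroup.one_closed[OF Hs] by (simp add: N_def)
          then show "N \<noteq> {}" by blast
        qed (use \<sigma>_inv \<sigma>_mult subgroup.m_inv_closed[OF Hs] subgroup.m_closed[OF Hs] in \<open>auto simp: N_def\<close>)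
      qed (use \<sigma>_conj normal_conj_by[OF H] in \<open>auto simp: N_def\<close>)
      interpret Q: group_hom G "G Mod N" "\<lambda>a. N #> a" by (rule quotient_hom[OF N])
      have surj: "(\<lambda>a. N #> a) ` carrier G = carrier (G Mod N)" by (simp add: carrier_FactGroup)
      \<comment> \<open>A normal group of \<open>q\<close>-elements centralized by all elements of
        other prime power orders, hence hypercentral in \<open>G\<close>.\<close>
      define D where "D = \<sigma> ` H"
      have Ds: "subgroup D G"
      proof (rule subgroupI)
        show "D \<subseteq> carrier G" using \<sigma>Z Zc by (auto simp: D_def)
        show "D \<noteq> {}" using subgroup.one_closed[OF Hs] by (auto simp: D_def)
      next
        fix d assume "d \<in> D"
        then obtain h where "h \<in> H" "d = \<sigma> h" by (auto simp: D_def)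
        then show "inv d \<in> D" unfolding D_def
          using \<sigma>_inv subgroup.m_inv_closed[OF Hs] by (intro image_eqI[of _ _ "inv h"]) auto
      next
        fix d e assume "d \<in> D" "e \<in> D"
        then obtain h k where "h \<in> H" "d = \<sigma> h" "k \<in> H" "e = \<sigma> k" by (auto simp: D_def)
        then show "d \<otimes> e \<in> D" unfolding D_def
          using \<sigma>_mult subgroup.m_closed[OF Hs] by (intro image_eqI[of _ _ "h \<otimes> k"]) auto
      qed
      have D: "D \<lhd> G"
      proof (rule normalI_conj_by[OF Ds])
        fix g d assume g: "g \<in> carrier G" and "d \<in> D"
        then obtain h where "h \<in> H" "d = \<sigma> h" by (auto simp: D_def)
        then show "conj_by G g d \<in> D" unfolding D_def
          using \<sigma>_conj[OF g] normal_conj_by[OF H g] by (intro image_eqI[of _ _ "conj_by G g h"]) auto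
      qed
      define s where "s = card D"
      have Dhyp: "D \<subseteq> upper_central G (carrier G) s"
        unfolding s_def
        by (rule normal_p_subgroup_hypercentral[OF fin q D]) (use \<sigma>q \<sigma>_cent in \<open>auto simp: D_def\<close>)
      have cc: "conj_closed G (carrier G)" by (auto simp: conj_closed_def)
      have gen_all: "generate G (carrier G) = carrier G"
        using generate_incl[of "carrier G"] generate.incl[of _ "carrier G" G] by auto
      \<comment> \<open>\<open>\<sigma>\<close> is multiplicative on \<open>H\<close> only; values
        with arbitrary entries lie there by \<open>generate_comm_values_eq\<close>.\<close>
      have "comm_values k G (carrier G) \<subseteq> generate G (comm_values k G (carrier G))"
        by (auto intro: generate.incl)
      then have kH: "comm_values k G (carrier G) \<subseteq> H"
        unfolding generate_comm_values_eq[OF fin k0] H_def V_def .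
      \<comment> \<open>Each further entry lowers the image under \<open>\<sigma>\<close> by one
        level, so values of length \<open>k + s\<close> lie in the kernel \<open>N\<close>. Modulo
        \<open>N\<close> the \<open>q\<close>-elements therefore satisfy a nilpotency law.\<close>
      have "\<forall>c\<in>comm_values (k + i) G (carrier G). c \<in> H \<and> \<sigma> c \<in> upper_central G (carrier G) (s - i)" if "i \<le> s" for i
        using that
      proof (induction i)
        case 0
        then show ?case using kH Dhyp by (auto simp: D_def)
      next
        case (Suc i)
        have "commutator G c g \<in> H \<and> \<sigma> (commutator G c g) \<in> upper_central G (carrier G) (s - Suc i)"
          if c: "c \<in> comm_values (k + i) G (carrier G)" and g: "g \<in> carrier G" for c g
        proof -
          have cH: "c \<in> H" and \<sigma>c: "\<sigma> c \<in> upper_central G (carrier G) (Suc (s - Suc i))"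
            using Suc c by (auto simp: Suc_diff_Suc)
          have "commutator G (\<sigma> c) g \<in> upper_central G (carrier G) (s - Suc i)"
            by (rule upper_central_commutator[OF cc \<sigma>c]) (simp add: gen_all g)
          then show ?thesis using \<sigma>_comm[OF cH g] commutator_in_normal(1)[OF H g cH] by simp
        qed
        moreover have "comm_values (k + Suc i) G (carrier G) = 
            {commutator G c x | c x. c \<in> comm_values (k + i) G (carrier G) \<and> x \<in> carrier G}"
          using comm_values_Suc[of "k + i" G "carrier G"] k0 by simp
        ultimately show ?case by auto
      qed
      from this[of s] have "comm_values (k + s) G (carrier G) \<subseteq> N" by (auto simp: N_def)
      then have ksN: "comm_values (k + s) G (p_elements G q) \<subseteq> N"
        using comm_values_mono[OF p_elements_closed] by blast
      define P where "P = p_elements (G Mod N) q"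
      have imP: "(\<lambda>a. N #> a) ` p_elements G q = P"
        unfolding P_def by (rule Q.image_p_elements[OF fin surj prime_gt_0_nat[OF q]])
      have imW: "comm_values j (G Mod N) P = (\<lambda>a. N #> a) ` comm_values j G (p_elements G q)" if "j > 0" for j
        unfolding Q.image_comm_values[OF p_elements_closed that] imP ..
      have triv: "comm_values (k + s) (G Mod N) P \<subseteq> {\<one>\<^bsub>G Mod N\<^esub>}"
      proof -
        have "N #> c = \<one>\<^bsub>G Mod N\<^esub>" if "c \<in> comm_values (k + s) G (p_elements G q)" for c
        proof -
          have "c \<in> N" using that ksN by blast
          moreover have "c \<in> carrier G" using \<open>c \<in> N\<close> Hc by (simp add: N_def)
          ultimately show ?thesis using quotient_eq_one_iff[OF N] by blast
        qed
        moreover have "k + s > 0" using k0 by simp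
        ultimately show ?thesis unfolding imW[OF \<open>k + s > 0\<close>] by blast
      qed
      have Ps: "subgroup P (G Mod N)"
        unfolding P_def 
        by (rule Q.H.subgroup_p_elements[OF finite_quotient[OF fin] q, of "k + s"]) (use triv k0 in \<open>simp_all add: P_def\<close>)
      have W: "finite (comm_values k (G Mod N) P)" "card (comm_values k (G Mod N) P) \<le> m"
        unfolding imW[OF k0] using Vp_fin[OF q] by (auto intro: order_trans[OF card_image_le])
      \<comment> \<open>\<open>H\<close> becomes abelian modulo \<open>N\<close>, since
        \<open>\<sigma>\<close> maps \<open>H\<close> into its centre:
        \<open>\<sigma> [h, h'] = [\<sigma> h, h'] = \<one>\<close>.\<close>
      let ?A = "(\<lambda>a. N #> a) ` H"
      have A: "subgroup ?A (G Mod N)" by (rule Q.subgroup_img_is_subgroup[OF Hs])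
      have WA: "comm_values k (G Mod N) P \<subseteq> ?A"
        unfolding imW[OF k0] using Vp[OF q] VH by blast
      have Acomm: "a \<otimes>\<^bsub>G Mod N\<^esub> b = b \<otimes>\<^bsub>G Mod N\<^esub> a" if ab: "a \<in> ?A" "b \<in> ?A" for a b
      proof -
        obtain h where h: "h \<in> H" "a = N #> h" using ab(1) by (elim imageE)
        obtain h' where h': "h' \<in> H" "b = N #> h'" using ab(2) by (elim imageE)
        have "h \<otimes> h' \<in> H" "h' \<otimes> h \<in> H" using h h' subgroup.m_closed[OF Hs] by auto
        have "\<sigma> (commutator G h h') = commutator G (\<sigma> h) h'" by (rule \<sigma>_comm[OF h(1) Hc[OF h'(1)]])
        also have "\<dots> = \<one>" by (rule cent1[OF \<sigma>Z[OF h(1)] h'(1)])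
        finally have "commutator G h h' \<in> N"
          using commutator_in_normal(1)[OF H Hc[OF h'(1)] h(1)] by (simp add: N_def)
        then have "N #> commutator G h h' = \<one>\<^bsub>G Mod N\<^esub>"
          using quotient_eq_one_iff[OF N] Hc h h' commutator_closed by blast
        then have "commutator (G Mod N) a b = \<one>\<^bsub>G Mod N\<^esub>"
          using Q.hom_commutator[OF Hc[OF h(1)] Hc[OF h'(1)]] h h' by simp
        then show ?thesis
          using Q.H.commutator_eq_one_iff[of a b] Q.hom_closed[OF Hc[OF h(1)]] Q.hom_closed[OF Hc[OF h'(1)]] h h' by simp
      qed
      have "N #> v \<in> comm_values k (G Mod N) P" unfolding imW[OF k0] using r(2) True by blast
      then have "(N #> v) [^]\<^bsub>G Mod N\<^esub> (fact m ^ m :: nat) = \<one>\<^bsub>G Mod N\<^esub>"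
        using Q.H.nilpotent_comm_values_exponent[OF Ps k W A WA Acomm _ triv] k0 by simp
      then have "N #> (v [^] (fact m ^ m :: nat)) = \<one>\<^bsub>G Mod N\<^esub>"
        using Q.hom_nat_pow[OF vc] by simp
      then have "v [^] (fact m ^ m :: nat) \<in> N" using quotient_eq_one_iff[OF N] vc nat_pow_closed by blast
      then show ?thesis using \<sigma>_pow[OF vH] by (simp add: N_def)
    qed
    then have "y [^] ((fact m * fact m ^ m) * t :: nat) = \<one>"
      using yc by (simp add: \<sigma>_def y_def[symmetric] nat_pow_pow mult_ac)
    then show ?thesis using t(2) by blast
  qed
  \<comment> \<open>For each prime \<open>q\<close> some exponent prime to \<open>q\<close> kills
    \<open>u\<close>, so no prime divides the order of \<open>u\<close>.\<close>
  define u where "u = y [^] (fact m * fact m ^ m :: nat)"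
  have uc: "u \<in> carrier G" using yc by (simp add: u_def)
  have "ord u = 1"
  proof (rule ccontr)
    assume "ord u \<noteq> 1"
    then obtain q where q: "prime q" "q dvd ord u" using prime_factor_nat by blast
    obtain t where t: "\<not> q dvd t" "y [^] ((fact m * fact m ^ m) * t :: nat) = \<one>" using local_part[OF q(1)] by blast
    then have "u [^] t = \<one>" using yc by (simp add: u_def nat_pow_pow)
    then have "ord u dvd t" using pow_eq_id[OF uc] by simp
    then show False using q t(1) dvd_trans by blast
  qed
  then have u1: "u = \<one>" using uc ord_eq_1 by blast
  have vZ: "v [^] (fact m :: nat) \<in> Z"
  proof -
    have "commutator G (v [^] (fact m :: nat)) w = \<one>" if w: "w \<in> V" for w
    proof -
      have "commutator G w (v [^] (fact m :: nat)) = \<one>"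
        by (rule fact_pow_centralizes[OF V finV mV w vc])
      then show ?thesis using commutator_inv[of w "v [^] (fact m :: nat)"] w Vc vc by auto
    qed
    then show ?thesis using subgroup_nat_pow_closed[OF Hs vH] by (simp add: Z_def)
  qed
  have \<tau>_pow: "\<tau> (v [^] (n::nat)) = y [^] n" for n
  proof (induction n)
    case 0
    have o: "\<one> \<in> H" by (rule subgroup.one_closed[OF Hs])
    have "\<tau> \<one> \<otimes> \<tau> \<one> = \<tau> \<one>" using \<tau>_mult[OF o o] by simp
    then show ?case using Zc[OF \<tau>Z[OF o]] by simp
  next
    case (Suc n)
    then show ?case using \<tau>_mult[OF subgroup_nat_pow_closed[OF Hs vH] vH] by (simp add: y_def)
  qed
  \<comment> \<open>\<open>\<tau>\<close> at \<open>v^(fact m)\<close> is evaluated twice: by the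
    power map on \<open>Z\<close>, and by multiplicativity.\<close>
  have "v [^] (fact m * card R) = y [^] (fact m :: nat)"
    using \<tau>_cent[OF vZ] \<tau>_pow vc by (simp add: nat_pow_pow)
  then have "(v [^] (fact m * card R)) [^] (fact m * fact m ^ m :: nat) = u [^] (fact m :: nat)"
    using yc by (simp add: u_def nat_pow_pow mult_ac)
  then have "v [^] (fact m * card R * (fact m * fact m ^ m)) = \<one>"
    using u1 vc by (simp add: nat_pow_pow)
  moreover have "fact m * card R * (fact m * fact m ^ m) dvd exponent_bound m"
    unfolding exponent_bound_def using cardR by (intro mult_dvd_mono dvd_refl dvd_fact) auto
  ultimately show ?thesis using pow_mult_exponent_one[OF vc] by blast
qed

text \<open>For \<open>k = 1\<close> the set \<open>V\<close> contains all powers of its elements,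
  so the pigeonhole principle applies to the powers of \<open>v\<close> themselves.\<close>

lemma p_elements_exponent:
  assumes fin: "finite (carrier G)" and m: "card (p_comm_values 1 G) \<le> m"
    and v: "v \<in> p_comm_values 1 G"
  shows "v [^] (fact m :: nat) = \<one>"
proof -
  obtain p where p: "prime p" "v \<in> p_elements G p" using v by (auto simp: p_comm_values_def)
  have Vc: "p_comm_values 1 G \<subseteq> carrier G"
    using conj_closedD(1)[OF conj_closed_p_comm_values] by simp
  have vc: "v \<in> carrier G" using v Vc by blast
  obtain a where a: "v [^] (p ^ a) = \<one>" using p by (auto simp: p_elements_def)
  have "v [^] i \<in> p_comm_values 1 G" for i :: nat
  proof -
    have "(v [^] i) [^] (p ^ a) = (v [^] (p ^ a)) [^] i" using vc by (simp add: nat_pow_pow mult.commute)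
    then have "v [^] i \<in> p_elements G p" using a vc by (auto simp: p_elements_def)
    then show ?thesis using p by (auto simp: p_comm_values_def)
  qed
  then obtain l where "0 < l" "l \<le> m" "v [^] l = \<one>"
    using pow_eq_one_ex[OF vc finite_subset[OF Vc fin] m] by blast
  then show ?thesis using fact_pow_eq_one[OF vc] by blast
qed

theorem finite_group_comm_values_bound:
  assumes fin: "finite (carrier G)" and k: "k > 0" and m: "card (p_comm_values k G) \<le> m"
  shows "card (generate G (comm_values k G (carrier G))) \<le> m ^ (m * exponent_bound m)"
proof -
  have V: "conj_closed G (p_comm_values k G)" using k by (rule conj_closed_p_comm_values)
  have Vc: "p_comm_values k G \<subseteq> carrier G" using V by (rule conj_closedD)
  have "v [^] exponent_bound m = \<one>" if v: "v \<in> p_comm_values k G" for v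
  proof (cases "k = 1")
    case True
    have "fact m dvd exponent_bound m" unfolding exponent_bound_def by simp
    then show ?thesis using p_elements_exponent[OF fin] m v True pow_mult_exponent_one Vc by blast
  next
    case False
    then show ?thesis using p_comm_values_exponent[OF fin _ m v] k by simp
  qed
  moreover have "exponent_bound m > 0" by (simp add: exponent_bound_def)
  ultimately show ?thesis
    using dietzmann[OF V finite_subset[OF Vc fin] m one_p_comm_values[OF k]]
    unfolding generate_comm_values_eq[OF fin k] by blast
qed

end

section \<open>Profinite groups\<close>

text \<open>Stating orders of images through membership of powers allows quotients of different
  groups to be compared.\<close>

lemma (in group) quotient_pow_iff:
  assumes "N \<lhd> G" "y \<in> carrier G"
  shows "y [^] (n::nat) \<in> N \<longleftrightarrow> group.ord (G Mod N) (N #> y) dvd n"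
proof -
  interpret q: group_hom G "G Mod N" "\<lambda>a. N #> a" by (rule quotient_hom[OF assms(1)])
  have "y [^] n \<in> N \<longleftrightarrow> N #> (y [^] n) = \<one>\<^bsub>G Mod N\<^esub>"
    using quotient_eq_one_iff[OF assms(1), of "y [^] n"] assms(2) nat_pow_closed by metis
  also have "\<dots> \<longleftrightarrow> (N #> y) [^]\<^bsub>G Mod N\<^esub> n = \<one>\<^bsub>G Mod N\<^esub>"
    using q.hom_nat_pow[OF assms(2)] by simp
  also have "\<dots> \<longleftrightarrow> group.ord (G Mod N) (N #> y) dvd n"
    using q.H.pow_eq_id[OF q.hom_closed[OF assms(2)]] .
  finally show ?thesis .
qed

section \<open>Open subgroups and closures\<close>

context topological_group begin

lemma continuous_mult_compose:
  assumes "continuous_map X T f" "continuous_map X T g"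
  shows "continuous_map X T (\<lambda>x. f x \<otimes> g x)"
  using continuous_map_compose[OF continuous_map_pairedI[OF assms] continuous_mult] by (simp add: o_def)

lemma continuous_inv_compose:
  assumes "continuous_map X T f"
  shows "continuous_map X T (\<lambda>x. inv (f x))"
  using continuous_map_compose[OF assms continuous_inv] by (simp add: o_def)

lemma continuous_const: "c \<in> carrier G \<Longrightarrow> continuous_map X T (\<lambda>x. c)"
  by (simp add: topspace_eq)

text \<open>\<open>S\<close> is a union of cosets of \<open>N\<close>, and each of them is
  open.\<close>

lemma openin_invariant:
  assumes N: "subgroup N G" "openin T N" and S: "S \<subseteq> carrier G" 
    and inv: "\<And>n s. n \<in> N \<Longrightarrow> s \<in> S \<Longrightarrow> n \<otimes> s \<in> S"
  shows "openin T S"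
proof (subst openin_subopen, rule ballI)
  fix s assume s: "s \<in> S"
  then have sc: "s \<in> carrier G" using S by auto
  let ?U = "{y \<in> topspace T. y \<otimes> inv s \<in> N}"
  have "openin T ?U"
    by (intro openin_continuous_map_preimage[OF _ N(2)] continuous_mult_compose continuous_const) (use sc in auto)
  moreover have "s \<in> ?U" using sc subgroup.one_closed[OF N(1)] by (simp add: topspace_eq)
  moreover have "?U \<subseteq> S"
  proof
    fix y assume y: "y \<in> ?U"
    then have "(y \<otimes> inv s) \<otimes> s \<in> S" using inv s by blast
    then show "y \<in> S" using y sc by (simp add: topspace_eq m_assoc)
  qed
  ultimately show "\<exists>U. openin T U \<and> s \<in> U \<and> U \<subseteq> S" by blast
qed

lemma closedin_invariant:
  assumes N: "subgroup N G" "openin T N" and S: "S \<subseteq> carrier G" 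
    and inv: "\<And>n s. n \<in> N \<Longrightarrow> s \<in> S \<Longrightarrow> n \<otimes> s \<in> S"
  shows "closedin T S"
proof -
  have "openin T (carrier G - S)"
  proof (rule openin_invariant[OF N])
    fix n s assume n: "n \<in> N" and s: "s \<in> carrier G - S"
    have nc: "n \<in> carrier G" using n N(1) by (rule subgroup.mem_carrier[rotated])
    have "n \<otimes> s \<notin> S"
    proof
      assume "n \<otimes> s \<in> S"
      then have "inv n \<otimes> (n \<otimes> s) \<in> S" by (rule inv[OF subgroup.m_inv_closed[OF N(1) n]])
      then show False using nc s by simp
    qed
    then show "n \<otimes> s \<in> carrier G - S" using nc s by simp
  qed auto
  then show ?thesis using S by (simp add: closedin_def topspace_eq)
qed

lemma subgroup_closure:
  assumes H: "subgroup H G"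
  shows "subgroup (T closure_of H) G"
proof (rule subgroupI)
  have Hc: "H \<subseteq> topspace T" using subgroup.subset[OF H] by (simp add: topspace_eq)
  show "T closure_of H \<subseteq> carrier G" using closure_of_subset_topspace[of T H] by (simp add: topspace_eq)
  have "\<one> \<in> T closure_of H" using closure_of_subset[OF Hc] subgroup.one_closed[OF H] by blast
  then show "T closure_of H \<noteq> {}" by blast
next
  fix a assume a: "a \<in> T closure_of H"
  have "(\<lambda>x. inv x) ` (T closure_of H) \<subseteq> T closure_of ((\<lambda>x. inv x) ` H)"
    by (rule continuous_map_image_closure_subset[OF continuous_inv])
  also have "\<dots> \<subseteq> T closure_of H" by (rule closure_of_mono) (use subgroup.m_inv_closed[OF H] in auto)
  finally show "inv a \<in> T closure_of H" using a by blast
next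
  fix a b assume ab: "a \<in> T closure_of H" "b \<in> T closure_of H"
  have "(\<lambda>(x, y). x \<otimes> y) ` (prod_topology T T closure_of (H \<times> H)) \<subseteq> T closure_of ((\<lambda>(x, y). x \<otimes> y) ` (H \<times> H))"
    by (rule continuous_map_image_closure_subset[OF continuous_mult])
  also have "\<dots> \<subseteq> T closure_of H" by (rule closure_of_mono) (use subgroup.m_closed[OF H] in auto)
  finally show "a \<otimes> b \<in> T closure_of H" unfolding closure_of_Times using ab by blast
qed

end

section \<open>Open normal subgroups and finite quotients\<close>

context profinite_group begin

text \<open>A form of the tube lemma: the complement is the projection of a closed set along a
  compact factor.\<close>

lemma openin_all_compact:
  assumes W: "openin (prod_topology T T) W" and C: "closedin T C"
  shows "openin T {g \<in> carrier G. \<forall>c\<in>C. (c, g) \<in> W}"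
proof -
  have "closedin (prod_topology T T) (C \<times> topspace T - W)"
    by (intro closedin_diff W) (simp add: closedin_prod_Times_iff C)
  then have "closedin T (snd ` (C \<times> topspace T - W))"
    using Abstract_Topological_Spaces.closed_map_snd[OF compact, of T] by (simp add: closed_map_def)
  then have "openin T (topspace T - snd ` (C \<times> topspace T - W))" by blast
  moreover have "topspace T - snd ` (C \<times> topspace T - W) = {g \<in> carrier G. \<forall>c\<in>C. (c, g) \<in> W}"
    by (force simp: topspace_eq image_iff)
  ultimately show ?thesis by simp
qed

text \<open>In a compact Hausdorff space components are quasi-components, so that of
  \<open>\<one>\<close> is a point and can be separated from the compact complement of
  \<open>U\<close>.\<close>

lemma clopen_neighbourhood:
  assumes U: "openin T U" "\<one> \<in> U"
  shows "\<exists>C. openin T C \<and> closedin T C \<and> \<one> \<in> C \<and> C \<subseteq> U"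
proof -
  have one: "\<one> \<in> topspace T" by (simp add: topspace_eq)
  let ?Q = "quasi_component_of_set T \<one>"
  have "quasi_component_of T \<one> = connected_component_of T \<one>"
    by (rule quasi_eq_connected_component_of) (use compact Hausdorff in blast)
  then have "connectedin T ?Q" by (simp add: connectedin_connected_component_of)
  then obtain a where "?Q \<subseteq> {a}" using totally_disconnected by blast
  moreover have "\<one> \<in> ?Q" using one by simp
  ultimately have Q: "?Q = {\<one>}" by blast
  have K: "compactin T (topspace T - U)"
    using compact U(1) by (intro closedin_compact_space) auto
  have "?Q \<in> quasi_components_of T"
    using one by (simp only: quasi_component_in_quasi_components_of)
  then have "separated_between T ?Q (topspace T - U)"
    using separated_between_quasi_component_compact[OF _ K] U(2) unfolding Q by (simp add: disjnt_def)
  then obtain A B where AB: "openin T A" "openin T B" "A \<union> B = topspace T" "disjnt A B"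
      "{\<one>} \<subseteq> A" "topspace T - U \<subseteq> B"
    unfolding separated_between_def Q by blast
  have "closedin T A" 
  proof -
    have "topspace T - A = B" using AB by (auto simp: disjnt_def)
    then show ?thesis using AB openin_subset[OF AB(1)] by (simp add: closedin_def)
  qed
  moreover have "A \<subseteq> U" using AB openin_subset[OF AB(1)] by (auto simp: disjnt_def)
  ultimately show ?thesis using AB by blast
qed

text \<open>\<open>L\<close> is the stabilizer of a clopen \<open>C\<close> under right translation;
  it lies in \<open>C\<close> because \<open>\<one>\<close> does, and is open by compactness of
  \<open>C\<close>. \<open>N\<close> is its normal core, open by compactness of
  \<open>G\<close>.\<close>

lemma open_normal_subgroup_in_neighbourhood:
  assumes U: "openin T U" "\<one> \<in> U"
  shows "\<exists>N. N \<lhd> G \<and> openin T N \<and> N \<subseteq> U"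
proof -
  obtain C where C: "openin T C" "closedin T C" "\<one> \<in> C" "C \<subseteq> U" using clopen_neighbourhood[OF U] by blast
  have Cc: "C \<subseteq> carrier G" using openin_subset[OF C(1)] by (simp add: topspace_eq)
  note cont = continuous_mult_compose continuous_inv_compose continuous_const continuous_map_fst continuous_map_snd
  define L where "L = {g \<in> carrier G. \<forall>c\<in>C. c \<otimes> g \<in> C \<and> c \<otimes> inv g \<in> C}"
  have L: "subgroup L G"
  proof (rule subgroupI)
    show "L \<subseteq> carrier G" by (auto simp: L_def)
    have "\<one> \<in> L" using Cc by (auto simp: L_def)
    then show "L \<noteq> {}" by blast
  next
    fix a assume "a \<in> L"
    then show "inv a \<in> L" by (simp add: L_def)
  next
    fix a b assume ab: "a \<in> L" "b \<in> L"
    have "c \<otimes> (a \<otimes> b) = (c \<otimes> a) \<otimes> b" "c \<otimes> inv (a \<otimes> b) = (c \<otimes> inv b) \<otimes> inv a" if "c \<in> C" for c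
      using that ab Cc by (auto simp: L_def group_simps subset_iff)
    then show "a \<otimes> b \<in> L" using ab by (simp add: L_def)
  qed
  have LC: "L \<subseteq> C"
  proof
    fix g assume "g \<in> L"
    then have "\<one> \<otimes> g \<in> C" "g \<in> carrier G" using C(3) by (auto simp: L_def)
    then show "g \<in> C" by simp
  qed
  have "openin T {g \<in> carrier G. \<forall>c\<in>C. (c, g) \<in> {p \<in> topspace (prod_topology T T). fst p \<otimes> snd p \<in> C} \<inter>
      {p \<in> topspace (prod_topology T T). fst p \<otimes> inv (snd p) \<in> C}}"
    by (intro openin_all_compact[OF _ C(2)] openin_Int openin_continuous_map_preimage[OF _ C(1)] cont)
  also have "{g \<in> carrier G. \<forall>c\<in>C. (c, g) \<in> {p \<in> topspace (prod_topology T T). fst p \<otimes> snd p \<in> C} \<inter>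
      {p \<in> topspace (prod_topology T T). fst p \<otimes> inv (snd p) \<in> C}} = L"
    using Cc by (auto simp: L_def topspace_eq)
  finally have Lo: "openin T L" .
  define N where "N = {n \<in> carrier G. \<forall>g\<in>carrier G. conj_by G g n \<in> L}"
  have "openin T {n \<in> carrier G. \<forall>g\<in>topspace T. (g, n) \<in> {p \<in> topspace (prod_topology T T). inv (fst p) \<otimes> snd p \<otimes> fst p \<in> L}}"
    by (intro openin_all_compact closedin_topspace openin_continuous_map_preimage[OF _ Lo] cont)
  also have "{n \<in> carrier G. \<forall>g\<in>topspace T. (g, n) \<in> {p \<in> topspace (prod_topology T T). inv (fst p) \<otimes> snd p \<otimes> fst p \<in> L}} = N"
    by (auto simp: N_def conj_by_def topspace_eq)
  finally have No: "openin T N" .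
  have NL: "N \<subseteq> L"
  proof
    fix n assume "n \<in> N"
    then have n: "n \<in> carrier G" "\<forall>g\<in>carrier G. conj_by G g n \<in> L" by (simp_all add: N_def)
    show "n \<in> L" using bspec[OF n(2) one_closed] n(1) by simp
  qed
  have "N \<lhd> G"
  proof (rule normalI_conj_by)
    show "subgroup N G"
    proof (rule subgroupI)
      show "N \<subseteq> carrier G" by (auto simp: N_def)
      have "\<one> \<in> N" using subgroup.one_closed[OF L] by (simp add: N_def)
      then show "N \<noteq> {}" by blast
    next
      fix a assume "a \<in> N"
      then show "inv a \<in> N" using subgroup.m_inv_closed[OF L] by (simp add: N_def conj_by_inv)
    next
      fix a b assume "a \<in> N" "b \<in> N"
      then show "a \<otimes> b \<in> N" using subgroup.m_closed[OF L] by (simp add: N_def conj_by_mult)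
    qed
  next
    fix g n assume "g \<in> carrier G" "n \<in> N"
    then show "conj_by G g n \<in> N" by (simp add: N_def conj_by_conj_by)
  qed
  then show ?thesis using No NL LC C(4) by blast
qed

text \<open>The cosets are disjoint and open, so a finite subcover contains all of them.\<close>

lemma finite_open_quotient:
  assumes N: "N \<lhd> G" "openin T N"
  shows "finite (carrier (G Mod N))"
proof -
  interpret N: normal N G by (rule N(1))
  have Ns: "subgroup N G" by (rule normal_imp_subgroup[OF N(1)])
  have "\<forall>c\<in>rcosets N. openin T c"
  proof
    fix c assume "c \<in> rcosets N"
    then obtain a where a: "a \<in> carrier G" "c = N #> a" by (auto simp: RCOSETS_def)
    show "openin T c"
    proof (rule openin_invariant[OF Ns N(2)])
      show "c \<subseteq> carrier G" using a r_coset_subset_G[OF N.subset] by simp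
      fix n s assume n: "n \<in> N" and "s \<in> c"
      then obtain n' where "n' \<in> N" "s = n' \<otimes> a" using a by (auto simp: r_coset_def)
      then have "n \<otimes> s = (n \<otimes> n') \<otimes> a" using n a N.mem_carrier by (simp add: m_assoc)
      then show "n \<otimes> s \<in> c" using n \<open>n' \<in> N\<close> N.m_closed a by (auto simp: r_coset_def)
    qed
  qed
  moreover have "topspace T \<subseteq> \<Union> (rcosets N)" using rcosets_part_G[OF Ns] by (simp add: topspace_eq)
  ultimately obtain \<F> where F: "finite \<F>" "\<F> \<subseteq> rcosets N" "topspace T \<subseteq> \<Union>\<F>"
    using compact[unfolded compact_space_alt] by meson
  have "rcosets N \<subseteq> \<F>"
  proof
    fix c assume c: "c \<in> rcosets N"
    then obtain a where a: "a \<in> carrier G" "c = N #> a" by (auto simp: RCOSETS_def)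
    then have ac: "a \<in> c" using rcos_self[OF a(1) Ns] by simp
    obtain d where d: "d \<in> \<F>" "a \<in> d" using F(3) a(1) by (auto simp: topspace_eq)
    have "c = d"
      using rcos_disjoint[OF Ns] c d F(2) ac by (meson disjnt_iff pairwiseD subsetD)
    then show "c \<in> \<F>" using d by simp
  qed
  then show ?thesis using F(1) finite_subset by (auto simp: FactGroup_def)
qed

section \<open>Prime sets read off from finite quotients\<close>

lemma ord_open_quotient_pos:
  assumes N: "N \<lhd> G" "openin T N" and y: "y \<in> carrier G"
  shows "group.ord (G Mod N) (N #> y) > 0"
proof -
  interpret q: group_hom G "G Mod N" "\<lambda>a. N #> a" by (rule quotient_hom[OF N(1)])
  show ?thesis
    using q.H.ord_ge_1[OF finite_open_quotient[OF N] q.hom_closed[OF y]] by simp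
qed

text \<open>The definition uses open normal subgroups of the procyclic group \<open>C\<close>, this
  form those of \<open>G\<close>. Each open subgroup of \<open>C\<close> contains some
  \<open>M \<inter> C\<close> with \<open>M\<close> open and normal in \<open>G\<close>, and finite
  quotients of \<open>C\<close> are generated by the image of \<open>y\<close>.\<close>

lemma prime_set_eq:
  assumes y: "y \<in> carrier G"
  shows "prime_set G T y =
    {p. prime p \<and> (\<exists>M. M \<lhd> G \<and> openin T M \<and> p dvd group.ord (G Mod M) (M #> y))}"
proof -
  define C where "C = closed_generate G T {y}"
  have gen: "subgroup (generate G {y}) G" by (rule generate_is_subgroup) (use y in auto)
  have C: "subgroup C G" unfolding C_def closed_generate_def by (rule subgroup_closure[OF gen])
  have Cc: "C \<subseteq> carrier G" using C by (rule subgroup.subset)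
  have genC: "generate G {y} \<subseteq> C"
    unfolding C_def closed_generate_def 
    by (rule closure_of_subset) (use subgroup.subset[OF gen] in \<open>simp add: topspace_eq\<close>)
  then have yC: "y \<in> C" using generate.incl[of y "{y}" G] by auto
  let ?K = "G\<lparr>carrier := C\<rparr>" and ?TK = "subtopology T C"
  interpret K: group ?K using subgroup_imp_group[OF C] .
  have iff': "y [^] (n::nat) \<in> N' \<longleftrightarrow> group.ord (?K Mod N') (N' #> y) dvd n" if "N' \<lhd> ?K" for N' n
    using K.quotient_pow_iff[OF that, of y n] yC by (simp add: subgroup_pow_carrier_update)
  have order_eq: "order (?K Mod N') = group.ord (?K Mod N') (N' #> y)" if N': "N' \<lhd> ?K" "openin ?TK N'" for N'
  proof -
    interpret q: group_hom ?K "?K Mod N'" "\<lambda>a. N' #>\<^bsub>?K\<^esub> a" by (rule K.quotient_hom[OF N'(1)])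
    have N's: "subgroup N' ?K" by (rule normal_imp_subgroup[OF N'(1)])
    obtain Ob where O: "openin T Ob" "N' = Ob \<inter> C" using N'(2) by (auto simp: openin_subtopology)
    have oneO: "\<one> \<in> Ob" using subgroup.one_closed[OF N's] O(2) by simp
    have img: "generate (?K Mod N') {N' #> y} = (\<lambda>a. N' #> a) ` generate G {y}"
      using q.generate_img[of "{y}"] yC generate_consistent[of "{y}" C] C by simp
    have "carrier (?K Mod N') = generate (?K Mod N') {N' #> y}"
    proof (intro equalityI subsetI)
      fix z assume "z \<in> carrier (?K Mod N')"
      then obtain c where c: "c \<in> C" "z = N' #> c" by (auto simp: carrier_FactGroup)
      have cc: "c \<in> carrier G" using c Cc by auto
      \<comment> \<open>An open neighbourhood of \<open>c\<close> whose points in \<open>C\<close>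
        are congruent to \<open>c\<close> modulo \<open>N'\<close>; it meets the dense subgroup
        generated by \<open>y\<close>.\<close>
      let ?W = "{x \<in> topspace T. c \<otimes> inv x \<in> Ob}"
      have "openin T ?W"
        by (intro openin_continuous_map_preimage[OF _ O(1)] continuous_mult_compose continuous_inv_compose continuous_const)
          (use cc in auto)
      moreover have "c \<in> ?W" using cc oneO by (simp add: topspace_eq)
      moreover have "\<forall>W. c \<in> W \<and> openin T W \<longrightarrow> (\<exists>g. g \<in> generate G {y} \<and> g \<in> W)"
        using c(1) unfolding C_def closed_generate_def in_closure_of by (rule conjunct2)
      ultimately have "\<exists>g. g \<in> generate G {y} \<and> g \<in> ?W" by (elim allE[of _ ?W] impE) (rule conjI)
      then obtain g where g: "g \<in> generate G {y}" "g \<in> ?W" by (elim exE conjE)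
      have gC: "g \<in> C" "g \<in> carrier G" using g genC Cc by auto
      have cg: "c \<otimes> inv g \<in> N'"
        using g gC c O subgroup.m_closed[OF C] subgroup.m_inv_closed[OF C] by auto
      have cgC: "c \<otimes> inv g \<in> C" using cg O by auto
      have "N' #> c = N' #> ((c \<otimes> inv g) \<otimes> g)" using cc gC by (simp add: m_assoc)
      also have "\<dots> = (N' #> (c \<otimes> inv g)) \<otimes>\<^bsub>?K Mod N'\<^esub> (N' #> g)"
        using q.hom_mult[of "c \<otimes> inv g" g] cgC gC by simp
      also have "N' #> (c \<otimes> inv g) = \<one>\<^bsub>?K Mod N'\<^esub>"
        using K.quotient_eq_one_iff[OF N'(1), of "c \<otimes> inv g"] cg cgC by simp
      also have "\<one>\<^bsub>?K Mod N'\<^esub> \<otimes>\<^bsub>?K Mod N'\<^esub> (N' #> g) = N' #> g"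
        using q.hom_closed[of g] gC by (intro q.H.l_one) simp
      finally show "z \<in> generate (?K Mod N') {N' #> y}" unfolding img using c(2) g(1) by blast
    next
      fix z assume "z \<in> generate (?K Mod N') {N' #> y}"
      then show "z \<in> carrier (?K Mod N')"
        using q.H.generate_in_carrier[of "{N' #> y}"] q.hom_closed[of y] yC by auto
    qed
    then show ?thesis
      using q.H.generate_pow_card[of "N' #> y"] q.hom_closed[of y] yC by (simp add: order_def)
  qed
  have elt: "elt_steinitz_order G T y p \<noteq> 0 \<longleftrightarrow>
      (\<exists>N'. N' \<lhd> ?K \<and> openin ?TK N' \<and> multiplicity p (order (?K Mod N')) \<noteq> 0)" if "prime p" for p
  proof -
    have "elt_steinitz_order G T y p =
        (SUP N \<in> {N. N \<lhd> ?K \<and> openin ?TK N}. enat (multiplicity p (order (?K Mod N))))"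
      using that by (simp add: elt_steinitz_order_def steinitz_order_def Let_def C_def)
    moreover have "\<dots> = 0 \<longleftrightarrow> (\<forall>N\<in>{N. N \<lhd> ?K \<and> openin ?TK N}. enat (multiplicity p (order (?K Mod N))) = 0)"
      unfolding bot_enat_def[symmetric] by (rule SUP_bot_conv)
    ultimately show ?thesis by (auto simp: zero_enat_def)
  qed
  have "(\<exists>N'. N' \<lhd> ?K \<and> openin ?TK N' \<and> multiplicity p (order (?K Mod N')) \<noteq> 0) \<longleftrightarrow>
      (\<exists>M. M \<lhd> G \<and> openin T M \<and> p dvd group.ord (G Mod M) (M #> y))" if p: "prime p" for p
  proof
    assume "\<exists>N'. N' \<lhd> ?K \<and> openin ?TK N' \<and> multiplicity p (order (?K Mod N')) \<noteq> 0"
    then obtain N' where N': "N' \<lhd> ?K" "openin ?TK N'" "multiplicity p (order (?K Mod N')) \<noteq> 0" by blast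
    have N's: "subgroup N' ?K" by (rule normal_imp_subgroup[OF N'(1)])
    obtain Ob where O: "openin T Ob" "N' = Ob \<inter> C" using N'(2) by (auto simp: openin_subtopology)
    have "\<one> \<in> Ob" using subgroup.one_closed[OF N's] O(2) by simp
    then obtain M where M: "M \<lhd> G" "openin T M" "M \<subseteq> Ob"
      using open_normal_subgroup_in_neighbourhood[OF O(1)] by blast
    have "y [^] group.ord (G Mod M) (M #> y) \<in> M" using quotient_pow_iff[OF M(1) y] by simp
    then have "y [^] group.ord (G Mod M) (M #> y) \<in> N'"
      using M(3) O(2) subgroup_nat_pow_closed[OF C yC] by auto
    then have "order (?K Mod N') dvd group.ord (G Mod M) (M #> y)"
      using iff'[OF N'(1)] order_eq[OF N'(1,2)] by simp
    moreover have "p dvd order (?K Mod N')"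
      using not_dvd_imp_multiplicity_0[of p "order (?K Mod N')"] N'(3) by (rule contrapos_np[rotated])
    ultimately have "p dvd group.ord (G Mod M) (M #> y)" by (rule dvd_trans[rotated])
    then show "\<exists>M. M \<lhd> G \<and> openin T M \<and> p dvd group.ord (G Mod M) (M #> y)"
      using M(1,2) by (intro exI[of _ M] conjI)
  next
    assume "\<exists>M. M \<lhd> G \<and> openin T M \<and> p dvd group.ord (G Mod M) (M #> y)"
    then obtain M where M: "M \<lhd> G" "openin T M" "p dvd group.ord (G Mod M) (M #> y)" by blast
    have N': "M \<inter> C \<lhd> ?K" by (rule normal_Int_subgroup[OF C M(1)])
    have N'o: "openin ?TK (M \<inter> C)" using M(2) by (auto simp: openin_subtopology)
    have "group.ord (?K Mod (M \<inter> C)) (M \<inter> C #> y) dvd n \<longleftrightarrow> group.ord (G Mod M) (M #> y) dvd n" for n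
      using iff'[OF N', of n] quotient_pow_iff[OF M(1) y, of n] subgroup_nat_pow_closed[OF C yC, of n] by simp
    then have "group.ord (?K Mod (M \<inter> C)) (M \<inter> C #> y) = group.ord (G Mod M) (M #> y)"
      by (meson dvd_antisym dvd_refl)
    then have "order (?K Mod (M \<inter> C)) = group.ord (G Mod M) (M #> y)" using order_eq[OF N' N'o] by simp
    then have "p ^ 1 dvd order (?K Mod (M \<inter> C))" "order (?K Mod (M \<inter> C)) \<noteq> 0"
      using M(3) ord_open_quotient_pos[OF M(1,2) y] by auto
    then have "multiplicity p (order (?K Mod (M \<inter> C))) \<ge> 1"
      using p by (intro multiplicity_geI) auto
    then show "\<exists>N'. N' \<lhd> ?K \<and> openin ?TK N' \<and> multiplicity p (order (?K Mod N')) \<noteq> 0"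
      using N' N'o by (intro exI[of _ "M \<inter> C"]) auto
  qed
  then show ?thesis using elt by (auto simp: prime_set_def)
qed

text \<open>For a single \<open>M\<close> a suitable power of \<open>x\<close> has the right primes
  in \<open>G Mod M\<close>; compactness makes one element work for all \<open>M\<close>.\<close>

lemma lift_prime_set:
  assumes N: "N \<lhd> G" "openin T N" and x: "x \<in> carrier G"
  shows "\<exists>y\<in>carrier G. N #> y = N #> x \<and> prime_set G T y = {p. prime p \<and> p dvd group.ord (G Mod N) (N #> x)}"
proof -
  define s where "s = group.ord (G Mod N) (N #> x)"
  have s0: "s > 0" unfolding s_def by (rule ord_open_quotient_pos[OF N x])
  have Ns: "subgroup N G" by (rule normal_imp_subgroup[OF N(1)])
  \<comment> \<open>The elements of the coset of \<open>x\<close> whose order modulo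
    \<open>M\<close> involves only primes dividing \<open>s\<close>.\<close>
  define S where "S = (\<lambda>M. {y \<in> carrier G. y \<otimes> inv x \<in> N \<and> (\<exists>j. y [^] (s ^ j) \<in> M)})"
  let ?\<M> = "{M. M \<lhd> G \<and> openin T M}"
  have Int: "A \<inter> B \<in> ?\<M>" if "A \<in> ?\<M>" "B \<in> ?\<M>" for A B
    using that normal_subgroup_intersect openin_Int by auto
  have closed: "closedin T (S M)" if M: "M \<in> ?\<M>" for M
  proof (rule closedin_invariant)
    show MN: "subgroup (M \<inter> N) G" "openin T (M \<inter> N)" 
      using Int[OF M, of N] N by (auto dest: normal_imp_subgroup)
    show "S M \<subseteq> carrier G" by (auto simp: S_def)
    fix n y assume n: "n \<in> M \<inter> N" and y: "y \<in> S M"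
    have nc: "n \<in> carrier G" using subgroup.mem_carrier[OF Ns] n by auto
    obtain j where yj: "y \<in> carrier G" "y \<otimes> inv x \<in> N" "y [^] (s ^ j) \<in> M" using y by (auto simp: S_def)
    interpret q: group_hom G "G Mod M" "\<lambda>a. M #> a" by (rule quotient_hom) (use M in simp)
    have Mn: "M \<lhd> G" using M by simp
    have "M #> n = \<one>\<^bsub>G Mod M\<^esub>" using quotient_eq_one_iff[OF Mn nc] n by simp
    then have "M #> (n \<otimes> y) = M #> y"
      using q.hom_mult[OF nc yj(1)] q.H.l_one[OF q.hom_closed[OF yj(1)]] by simp
    then have "(n \<otimes> y) [^] (s ^ j) \<in> M"
      using quotient_pow_iff[OF Mn, of "n \<otimes> y" "s ^ j"] quotient_pow_iff[OF Mn yj(1), of "s ^ j"] yj nc by simp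
    moreover have "(n \<otimes> y) \<otimes> inv x \<in> N"
      using subgroup.m_closed[OF Ns, of n "y \<otimes> inv x"] n yj nc x by (simp add: m_assoc)
    ultimately show "n \<otimes> y \<in> S M" using nc yj by (auto simp: S_def)
  qed
  have nonempty: "S M \<noteq> {}" if M: "M \<in> ?\<M>" for M
  proof -
    have Mn: "M \<lhd> G" "openin T M" using M by auto
    \<comment> \<open>\<open>x^e\<close> stays in the coset because \<open>x^s\<close> lies in
      \<open>N\<close>, and modulo \<open>M\<close> it loses all primes not dividing
      \<open>s\<close>.\<close>
    obtain e v j where e: "e = s * v + 1" "group.ord (G Mod M) (M #> x) dvd e * s ^ j"
      using torsion_exponent[OF ord_open_quotient_pos[OF Mn x] s0] by blast
    have "x [^] s \<in> N" using quotient_pow_iff[OF N(1) x] by (simp add: s_def)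
    then have "(x [^] s) [^] v \<in> N" by (rule subgroup_nat_pow_closed[OF Ns])
    moreover have "x [^] e \<otimes> inv x = (x [^] s) [^] v"
      using x by (simp add: e(1) nat_pow_pow m_assoc)
    ultimately have "x [^] e \<otimes> inv x \<in> N" by simp
    moreover have "(x [^] e) [^] (s ^ j) \<in> M"
      using quotient_pow_iff[OF Mn(1) x] e(2) x by (simp add: nat_pow_pow)
    ultimately have "x [^] e \<in> S M" using x by (auto simp: S_def)
    then show ?thesis by blast
  qed
  have "\<Inter> (S ` ?\<M>) \<noteq> {}"
  proof (rule compact[unfolded compact_space_fip, rule_format], intro conjI allI impI ballI)
    fix D assume "D \<in> S ` ?\<M>"
    then show "closedin T D" using closed by blast
  next
    fix \<F> assume "finite \<F> \<and> \<F> \<subseteq> S ` ?\<M>"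
    then obtain \<N> where NN: "finite \<N>" "\<N> \<subseteq> ?\<M>" "\<F> = S ` \<N>" by (meson finite_subset_image)
    \<comment> \<open>\<open>S\<close> is monotone, so nonemptiness of finite intersections reduces
      to a single \<open>M\<close>.\<close>
    have "\<exists>M\<in>?\<M>. \<forall>A\<in>\<N>. M \<subseteq> A"
      using NN(1,2)
    proof (induction \<N> rule: finite_induct)
      case empty
      then show ?case using N by blast
    next
      case (insert A \<N>)
      then obtain M where M: "M \<in> ?\<M>" "\<forall>A\<in>\<N>. M \<subseteq> A" by blast
      have "M \<inter> A \<in> ?\<M>" by (rule Int[OF M(1)]) (use insert.prems in blast)
      then show ?case using M(2) by (intro bexI[of _ "M \<inter> A"]) auto
    qed
    then obtain M where M: "M \<in> ?\<M>" "\<And>A. A \<in> \<N> \<Longrightarrow> M \<subseteq> A" by blast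
    have "S M \<subseteq> \<Inter> \<F>" unfolding NN(3) using M(2) by (fastforce simp: S_def)
    then show "\<Inter> \<F> \<noteq> {}" using nonempty[OF M(1)] by blast
  qed
  then obtain y where y: "\<And>M. M \<in> ?\<M> \<Longrightarrow> y \<in> S M" by blast
  have yN: "y \<in> carrier G" "y \<otimes> inv x \<in> N" using y[of N] N by (auto simp: S_def)
  have coset: "N #> y = N #> x"
  proof -
    interpret q: group_hom G "G Mod N" "\<lambda>a. N #> a" by (rule quotient_hom[OF N(1)])
    have "N #> y = N #> ((y \<otimes> inv x) \<otimes> x)" using yN(1) x by (simp add: m_assoc)
    also have "\<dots> = (N #> (y \<otimes> inv x)) \<otimes>\<^bsub>G Mod N\<^esub> (N #> x)"
      by (rule q.hom_mult) (use yN x in auto)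
    also have "N #> (y \<otimes> inv x) = \<one>\<^bsub>G Mod N\<^esub>"
      using quotient_eq_one_iff[OF N(1), of "y \<otimes> inv x"] yN x by simp
    also have "\<one>\<^bsub>G Mod N\<^esub> \<otimes>\<^bsub>G Mod N\<^esub> (N #> x) = N #> x"
      by (rule q.H.l_one[OF q.hom_closed[OF x]])
    finally show ?thesis .
  qed
  have "prime_set G T y = {p. prime p \<and> p dvd s}"
  proof (intro equalityI subsetI)
    fix p assume "p \<in> prime_set G T y"
    then obtain M where p: "prime p" and M: "M \<lhd> G" "openin T M" "p dvd group.ord (G Mod M) (M #> y)"
      unfolding prime_set_eq[OF yN(1)] by blast
    obtain j where "y [^] (s ^ j) \<in> M" using y[of M] M by (auto simp: S_def)
    then have "p dvd s ^ j" 
      using dvd_trans[OF M(3)] quotient_pow_iff[OF M(1) yN(1), of "s ^ j"] by simp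
    then have "p dvd s" by (rule prime_dvd_power[OF p])
    then show "p \<in> {p. prime p \<and> p dvd s}" using p by simp
  next
    fix p assume "p \<in> {p. prime p \<and> p dvd s}"
    then show "p \<in> prime_set G T y"
      unfolding prime_set_eq[OF yN(1)] using N coset by (auto simp: s_def)
  qed
  then show ?thesis using yN(1) coset by (auto simp: s_def)
qed

end

section \<open>Reduction to finite groups\<close>

lemma (in group) left_normed_closed:
  assumes "xs \<noteq> []" "set xs \<subseteq> carrier G"
  shows "left_normed G xs \<in> carrier G"
proof -
  have "left_normed G xs \<in> comm_values (length xs) G (carrier G)"
    using assms by (auto simp: comm_values_def)
  then show ?thesis using comm_values_closed[of "carrier G" "length xs"] assms(1) by auto
qed

lemma (in group) left_normed_eq_one:
  assumes "\<one> \<in> set xs" "set xs \<subseteq> carrier G"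
  shows "left_normed G xs = \<one>"
  using assms
proof (induction xs rule: rev_induct)
  case (snoc x xs)
  show ?case
  proof (cases "xs = []")
    case True
    then show ?thesis using snoc.prems by (simp add: left_normed_def)
  next
    case False
    have c: "x \<in> carrier G" "left_normed G xs \<in> carrier G"
      using snoc.prems left_normed_closed[OF False] by auto
    show ?thesis
    proof (cases "\<one> \<in> set xs")
      case True
      then show ?thesis using snoc False c by (simp add: left_normed_snoc)
    next
      case False
      then have "x = \<one>" using snoc.prems by simp
      then show ?thesis using \<open>xs \<noteq> []\<close> c by (simp add: left_normed_snoc)
    qed
  qed
qed simp

lemma (in group_hom) hom_left_normed:
  assumes "xs \<noteq> []" "set xs \<subseteq> carrier G"
  shows "h (left_normed G xs) = left_normed H (map h xs)"
  using assms
proof (induction xs rule: rev_induct)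
  case (snoc x xs)
  show ?case
  proof (cases "xs = []")
    case True
    then show ?thesis by (simp add: left_normed_def)
  next
    case False
    then show ?thesis using snoc G.left_normed_closed[OF False]
      by (simp add: left_normed_snoc hom_commutator)
  qed
qed simp

lemma (in group_hom) ord_hom_inj:
  assumes "inj_on h (carrier G)" "x \<in> carrier G"
  shows "group.ord H (h x) = group.ord G x"
proof -
  have "h x [^]\<^bsub>H\<^esub> n = \<one>\<^bsub>H\<^esub> \<longleftrightarrow> x [^] n = \<one>" for n :: nat
    using hom_nat_pow[OF assms(2), of n] inj_onD[OF assms(1), of "x [^] n" \<one>] assms(2) by auto
  then have "group.ord H (h x) dvd n \<longleftrightarrow> group.ord G x dvd n" for n
    using H.pow_eq_id[OF hom_closed[OF assms(2)], of n] G.pow_eq_id[OF assms(2), of n] by simp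
  then show ?thesis by (meson dvd_antisym dvd_refl)
qed

text \<open>The elements of a quotient are cosets, so it has another type than \<open>G\<close>.
  Copies on \<open>nat\<close> bring all finite quotients to the type for which a bound is
  available.\<close>

lemma (in group) iso_nat_group:
  assumes "finite (carrier G)"
  shows "\<exists>(H :: nat monoid) h. group_hom G H h \<and> inj_on h (carrier G) \<and> h ` carrier G = carrier H"
proof -
  obtain f where f: "bij_betw f (carrier G) {0..<card (carrier G)}"
    using ex_bij_betw_finite_nat[OF assms] by blast
  have inj: "inj_on f (carrier G)" using f by (rule bij_betw_imp_inj_on)
  \<comment> \<open>\<open>H0\<close> only carries the transported multiplication; its
    \<open>carrier\<close> and \<open>one\<close> are placeholders that \<open>H\<close>
    replaces.\<close>
  define H0 :: "nat monoid" where "H0 = \<lparr>carrier = UNIV,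
    mult = (\<lambda>a b. f (inv_into (carrier G) f a \<otimes> inv_into (carrier G) f b)), one = 0\<rparr>"
  have hom: "f \<in> hom G H0" by (rule homI) (use inj in \<open>auto simp: H0_def\<close>)
  define H where "H = H0\<lparr>carrier := f ` carrier G, one := f \<one>\<rparr>"
  have "group H" unfolding H_def by (rule hom_imp_img_group[OF hom])
  moreover have "f \<in> hom G H" using hom by (auto simp: H_def hom_def)
  ultimately have "group_hom G H f" by (simp add: group_hom_def group_hom_axioms_def is_group)
  moreover have "f ` carrier G = carrier H" by (simp add: H_def)
  ultimately show ?thesis using inj by blast
qed

section \<open>Finite groups as discrete profinite groups\<close>

lemma (in group) profinite_group_discrete:
  assumes "finite (carrier G)"
  shows "profinite_group G (discrete_topology (carrier G))"
proof
  show "continuous_map (prod_topology (discrete_topology (carrier G)) (discrete_topology (carrier G)))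
      (discrete_topology (carrier G)) (\<lambda>(x, y). x \<otimes> y)"
    by (auto simp flip: prod_topology_discrete_topology)
  show "compact_space (discrete_topology (carrier G))"
    using assms by (simp add: compact_space_discrete_topology)
  show "\<exists>a. S \<subseteq> {a}" if "connectedin (discrete_topology (carrier G)) S" for S
    using that by (simp add: connectedin_discrete_topology)
qed auto

lemma (in group) prime_set_discrete:
  assumes "finite (carrier G)" "y \<in> carrier G"
  shows "prime_set G (discrete_topology (carrier G)) y = {p. prime p \<and> p dvd ord y}"
proof -
  interpret P: profinite_group G "discrete_topology (carrier G)"
    by (rule profinite_group_discrete[OF assms(1)])
  have dvd: "group.ord (G Mod M) (M #> y) dvd ord y" if "M \<lhd> G" for M
    using quotient_pow_iff[OF that assms(2), of "ord y"] assms(2) 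
      subgroup.one_closed[OF normal_imp_subgroup[OF that]] by simp
  have triv: "group.ord (G Mod {\<one>}) ({\<one>} #> y) = ord y"
  proof -
    have "group.ord (G Mod {\<one>}) ({\<one>} #> y) dvd n \<longleftrightarrow> ord y dvd n" for n
      using quotient_pow_iff[OF one_is_normal assms(2), of n] pow_eq_id[OF assms(2), of n] by simp
    then show ?thesis by (meson dvd_antisym dvd_refl)
  qed
  have "(\<exists>M. M \<lhd> G \<and> openin (discrete_topology (carrier G)) M \<and> p dvd group.ord (G Mod M) (M #> y))
      \<longleftrightarrow> p dvd ord y" for p
  proof
    assume "\<exists>M. M \<lhd> G \<and> openin (discrete_topology (carrier G)) M \<and> p dvd group.ord (G Mod M) (M #> y)"
    then obtain M where "M \<lhd> G" "p dvd group.ord (G Mod M) (M #> y)" by blast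
    then show "p dvd ord y" using dvd dvd_trans by metis
  next
    assume "p dvd ord y"
    then show "\<exists>M. M \<lhd> G \<and> openin (discrete_topology (carrier G)) M \<and> p dvd group.ord (G Mod M) (M #> y)"
      using one_is_normal triv by (intro exI[of _ "{\<one>}"]) simp
  qed
  then show ?thesis unfolding P.prime_set_eq[OF assms(2)] by simp
qed

lemma (in group) lower_central_discrete:
  assumes "k > 0"
  shows "lower_central k G (discrete_topology (carrier G)) = generate G (comm_values k G (carrier G))"
proof -
  have "generate G (comm_values k G (carrier G)) \<subseteq> carrier G"
    by (rule generate_incl[OF comm_values_closed[OF subset_refl assms]])
  then show ?thesis
    by (auto simp: lower_central_def closed_generate_def discrete_topology_closure_of comm_values_def)
qed

text \<open>A nontrivial \<open>p\<close>-element has prime set \<open>{p}\<close>, but that of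
  \<open>\<one>\<close> is empty. An entry \<open>\<one>\<close> may spoil uniformity, yet it makes
  the value \<open>\<one>\<close>, which the constant list of \<open>\<one>\<close> also
  gives.\<close>

lemma (in group) p_comm_values_subset_uniform:
  assumes fin: "finite (carrier G)" and k: "k > 0"
  shows "p_comm_values k G \<subseteq> uniform_commutators k G (discrete_topology (carrier G))"
proof
  let ?T = "discrete_topology (carrier G)"
  fix c assume "c \<in> p_comm_values k G"
  then obtain p xs where p: "prime p" and xs: "c = left_normed G xs" "length xs = k" "set xs \<subseteq> p_elements G p"
    by (auto simp: p_comm_values_def comm_values_def)
  have xc: "set xs \<subseteq> carrier G" using xs(3) p_elements_closed by blast
  have "\<exists>ys. c = left_normed G ys \<and> length ys = k \<and> set ys \<subseteq> carrier G \<and>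
       (\<forall>x\<in>set ys. \<forall>y\<in>set ys. prime_set G ?T x = prime_set G ?T y)"
  proof (cases "\<one> \<in> set xs")
    case True
    have "c = left_normed G (replicate k \<one>)"
      using left_normed_eq_one[OF True xc] left_normed_eq_one[of "replicate k \<one>"] k xs(1) by auto
    then show ?thesis by (intro exI[of _ "replicate k \<one>"]) auto
  next
    case False
    have "prime_set G ?T x = {p}" if x: "x \<in> set xs" for x
    proof -
      have xx: "x \<in> carrier G" "x \<noteq> \<one>" using x xc False by auto
      obtain a where "x [^] (p ^ a) = \<one>" using x xs(3) by (auto simp: p_elements_def)
      then have dvd: "ord x dvd p ^ a" using pow_eq_id[OF xx(1)] by simp
      have q: "q = p" if "prime q" "q dvd ord x" for q
        using that dvd p by (meson dvd_trans prime_dvd_power primes_dvd_imp_eq)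
      have "ord x \<noteq> 1" using ord_eq_1[OF xx(1)] xx(2) by simp
      then obtain q where "prime q" "q dvd ord x" using prime_factor_nat by blast
      then show ?thesis unfolding prime_set_discrete[OF fin xx(1)] using q by blast
    qed
    then show ?thesis using xs xc by (intro exI[of _ xs]) auto
  qed
  then show "c \<in> uniform_commutators k G ?T" by (simp add: uniform_commutators_def)
qed

text \<open>Lifting the entries with their prime sets shows that every uniform commutator of the
  quotient is the image of one of \<open>G\<close>. The bound for finite groups is a hypothesis, so
  that either half of the final statement can supply its own.\<close>

lemma (in profinite_group) card_quotient_generate_comm_values:
  assumes k: "k > 0"
    and bound: "\<And>H :: nat monoid. group H \<Longrightarrow> finite (carrier H) \<Longrightarrow>
      card (uniform_commutators k H (discrete_topology (carrier H))) \<le> m \<Longrightarrow>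
      card (generate H (comm_values k H (carrier H))) \<le> b"
    and U: "finite (uniform_commutators k G T)" "card (uniform_commutators k G T) \<le> m"
    and N: "N \<lhd> G" "openin T N"
  shows "card ((\<lambda>a. N #> a) ` generate G (comm_values k G (carrier G))) \<le> b"
proof -
  interpret q: group_hom G "G Mod N" "\<lambda>a. N #> a" by (rule quotient_hom[OF N(1)])
  have fin: "finite (carrier (G Mod N))" by (rule finite_open_quotient[OF N])
  obtain H :: "nat monoid" and h where "group_hom (G Mod N) H h" 
    and inj: "inj_on h (carrier (G Mod N))" and surj: "h ` carrier (G Mod N) = carrier H"
    using q.H.iso_nat_group[OF fin] by blast
  then interpret h: group_hom "G Mod N" H h by simp
  define \<pi> where "\<pi> = (\<lambda>a. h (N #> a))"
  have \<pi>: "group_hom G H \<pi>"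
    unfolding \<pi>_def group_hom_def group_hom_axioms_def
    by (auto intro!: homI h.hom_closed q.hom_closed simp: q.hom_mult h.hom_mult simp del: mult_FactGroup)
  interpret \<pi>: group_hom G H \<pi> by (rule \<pi>)
  have \<pi>_surj: "\<pi> ` carrier G = carrier H"
    unfolding \<pi>_def surj[symmetric] carrier_FactGroup by (simp add: image_image)
  have finH: "finite (carrier H)" using fin surj by (metis finite_imageI)
  let ?T = "discrete_topology (carrier H)"
  have lift: "\<exists>y. y \<in> carrier G \<and> \<pi> y = z \<and> prime_set G T y = prime_set H ?T z" if "z \<in> carrier H" for z
  proof -
    obtain x where x: "x \<in> carrier G" "\<pi> x = z" using \<open>z \<in> carrier H\<close> unfolding \<pi>_surj[symmetric] by (elim imageE) simp
    have "prime_set H ?T z = {p. prime p \<and> p dvd group.ord (G Mod N) (N #> x)}"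
      unfolding h.H.prime_set_discrete[OF finH that]
      unfolding x(2)[symmetric] \<pi>_def h.ord_hom_inj[OF inj q.hom_closed[OF x(1)]] ..
    moreover obtain y where "y \<in> carrier G" "N #> y = N #> x"
        "prime_set G T y = {p. prime p \<and> p dvd group.ord (G Mod N) (N #> x)}"
      using lift_prime_set[OF N x(1)] by blast
    ultimately show ?thesis using x(2) by (auto simp: \<pi>_def)
  qed
  then obtain l where l: "\<And>z. z \<in> carrier H \<Longrightarrow> l z \<in> carrier G" "\<And>z. z \<in> carrier H \<Longrightarrow> \<pi> (l z) = z"
      "\<And>z. z \<in> carrier H \<Longrightarrow> prime_set G T (l z) = prime_set H ?T z"
    by metis
  have "uniform_commutators k H ?T \<subseteq> \<pi> ` uniform_commutators k G T"
  proof
    fix c assume "c \<in> uniform_commutators k H ?T"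
    then obtain xs where xs: "c = left_normed H xs" "length xs = k" "set xs \<subseteq> carrier H"
      "\<forall>x\<in>set xs. \<forall>y\<in>set xs. prime_set H ?T x = prime_set H ?T y"
      by (auto simp: uniform_commutators_def)
    let ?ys = "map l xs"
    have "map \<pi> ?ys = xs" using xs(3) l(2) by (auto simp: map_idI subset_iff)
    moreover have ys: "?ys \<noteq> []" "set ?ys \<subseteq> carrier G" using xs k l(1) by auto
    ultimately have c: "c = \<pi> (left_normed G ?ys)" using \<pi>.hom_left_normed[OF ys] xs(1) by simp
    have eqs: "\<forall>x\<in>set ?ys. \<forall>y\<in>set ?ys. prime_set G T x = prime_set G T y"
    proof (intro ballI)
      fix x y assume "x \<in> set ?ys" "y \<in> set ?ys"
      then obtain u v where uv: "u \<in> set xs" "x = l u" "v \<in> set xs" "y = l v" by auto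
      have "prime_set H ?T u = prime_set H ?T v" by (rule bspec[OF bspec[OF xs(4) uv(1)] uv(3)])
      then show "prime_set G T x = prime_set G T y"
        unfolding uv(2,4) l(3)[OF subsetD[OF xs(3) uv(1)]] l(3)[OF subsetD[OF xs(3) uv(3)]] .
    qed
    have "left_normed G ?ys \<in> uniform_commutators k G T"
      unfolding uniform_commutators_def
      by (rule CollectI, rule exI[of _ ?ys], intro conjI refl ys(2) eqs) (simp add: xs(2))
    then show "c \<in> \<pi> ` uniform_commutators k G T" unfolding c by (rule imageI)
  qed
  then have "card (uniform_commutators k H ?T) \<le> m"
    using surj_card_le[OF U(1)] U(2) order_trans by blast
  then have "card (generate H (comm_values k H (carrier H))) \<le> b"
    by (rule bound[OF h.H.is_group finH])
  also have "generate H (comm_values k H (carrier H)) = \<pi> ` generate G (comm_values k G (carrier G))"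
    unfolding \<pi>_surj[symmetric] \<pi>.image_comm_values[OF subset_refl k, symmetric]
    by (rule \<pi>.generate_img[OF comm_values_closed[OF subset_refl k]])
  also have "\<dots> = h ` (\<lambda>a. N #> a) ` generate G (comm_values k G (carrier G))"
    by (simp add: \<pi>_def image_image)
  also have "card \<dots> = card ((\<lambda>a. N #> a) ` generate G (comm_values k G (carrier G)))"
  proof (rule card_image)
    have "generate G (comm_values k G (carrier G)) \<subseteq> carrier G"
      by (rule generate_incl[OF comm_values_closed[OF subset_refl k]])
    then have "(\<lambda>a. N #> a) ` generate G (comm_values k G (carrier G)) \<subseteq> carrier (G Mod N)"
      unfolding carrier_FactGroup by (rule image_mono)
    then show "inj_on h ((\<lambda>a. N #> a) ` generate G (comm_values k G (carrier G)))"
      using inj inj_on_subset by blast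
  qed
  finally show ?thesis .
qed

text \<open>The finitely many nontrivial \<open>a (inv b)\<close> form a closed set, and some open
  normal subgroup avoids it.\<close>

lemma (in profinite_group) separating_open_normal_subgroup:
  assumes F: "finite F" "F \<subseteq> carrier G"
  shows "\<exists>N. N \<lhd> G \<and> openin T N \<and> inj_on (\<lambda>a. N #> a) F"
proof -
  define D where "D = (\<lambda>(a, b). a \<otimes> inv b) ` (F \<times> F) - {\<one>}"
  have "finite D" "D \<subseteq> topspace T" using F by (auto simp: D_def topspace_eq)
  then have "closedin T D" using closedin_Hausdorff_finite[OF Hausdorff] by blast
  then have "openin T (topspace T - D)" by blast
  moreover have "\<one> \<in> topspace T - D" by (simp add: D_def topspace_eq)
  ultimately obtain N where N: "N \<lhd> G" "openin T N" "N \<subseteq> topspace T - D"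
    using open_normal_subgroup_in_neighbourhood by blast
  have Ns: "subgroup N G" by (rule normal_imp_subgroup[OF N(1)])
  have "inj_on (\<lambda>a. N #> a) F"
  proof (rule inj_onI)
    fix a b assume ab: "a \<in> F" "b \<in> F" "N #> a = N #> b"
    have c: "a \<in> carrier G" "b \<in> carrier G" using ab F by auto
    have "a \<in> N #> b" using rcos_self[OF c(1) Ns] ab(3) by simp
    then have "a \<otimes> inv b \<in> N" by (rule subgroup.rcos_module_imp[OF Ns is_group c(2)])
    moreover have "a \<otimes> inv b \<in> (\<lambda>(a, b). a \<otimes> inv b) ` (F \<times> F)" using ab by force
    ultimately have "a \<otimes> inv b = \<one>" using N(3) by (auto simp: D_def)
    then show "a = b" using c by (metis inv_inv inv_equality inv_closed)
  qed
  then show ?thesis using N by blast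
qed

text \<open>Every finite subset of the abstractly generated subgroup embeds into a finite quotient
  and so has at most \<open>b\<close> elements. The subgroup is therefore finite, hence closed, and
  the closure adds nothing.\<close>

lemma (in profinite_group) card_lower_central_le:
  assumes k: "k > 0"
    and bound: "\<And>H :: nat monoid. group H \<Longrightarrow> finite (carrier H) \<Longrightarrow>
      card (uniform_commutators k H (discrete_topology (carrier H))) \<le> m \<Longrightarrow>
      card (generate H (comm_values k H (carrier H))) \<le> b"
    and U: "finite (uniform_commutators k G T)" "card (uniform_commutators k G T) \<le> m"
  shows "finite (lower_central k G T) \<and> card (lower_central k G T) \<le> b"
proof -
  let ?\<Gamma> = "generate G (comm_values k G (carrier G))"
  have sub: "?\<Gamma> \<subseteq> carrier G" by (rule generate_incl[OF comm_values_closed[OF subset_refl k]])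
  have fin: "finite ?\<Gamma> \<and> card ?\<Gamma> \<le> b"
  proof (rule finite_if_finite_subsets_card_bdd)
    fix F assume F: "F \<subseteq> ?\<Gamma>" "finite F"
    then obtain N where N: "N \<lhd> G" "openin T N" "inj_on (\<lambda>a. N #> a) F"
      using separating_open_normal_subgroup[OF F(2) order_trans[OF F(1) sub]] by blast
    have "finite ((\<lambda>a. N #> a) ` ?\<Gamma>)"
      by (rule finite_subset[OF _ finite_open_quotient[OF N(1,2)]])
        (unfold carrier_FactGroup, rule image_mono[OF sub])
    then have "card ((\<lambda>a. N #> a) ` F) \<le> card ((\<lambda>a. N #> a) ` ?\<Gamma>)"
      by (rule card_mono) (rule image_mono[OF F(1)])
    also have "\<dots> \<le> b" by (rule card_quotient_generate_comm_values[OF k bound U N(1,2)])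
    finally show "card F \<le> b" using card_image[OF N(3)] by simp
  qed
  then have "closedin T ?\<Gamma>" using closedin_Hausdorff_finite[OF Hausdorff] sub by (simp add: topspace_eq)
  then have "lower_central k G T = ?\<Gamma>"
    by (simp add: lower_central_def closed_generate_def closure_of_closedin comm_values_def)
  then show ?thesis using fin by simp
qed

lemma (in group) finite_uniform_commutators:
  assumes "finite (carrier G)" "k > 0"
  shows "finite (uniform_commutators k G T)"
proof (rule finite_subset[OF _ assms(1)])
  have "uniform_commutators k G T \<subseteq> comm_values k G (carrier G)"
    by (auto simp: uniform_commutators_def comm_values_def)
  then show "uniform_commutators k G T \<subseteq> carrier G"
    using comm_values_closed[OF subset_refl assms(2)] by (rule order_trans)
qed

theorem proposition7p1:
  shows "(\<exists>f :: nat \<Rightarrow> nat. lower_central_bound TYPE('a) f) \<and>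
    (\<forall>f :: nat \<Rightarrow> nat. lower_central_bound TYPE(nat) f \<longrightarrow> lower_central_bound TYPE('a) f)"
proof (intro conjI exI allI impI)
  show "lower_central_bound TYPE('a) (\<lambda>m. m ^ (m * exponent_bound m))"
    unfolding lower_central_bound_def
  proof (intro allI impI)
    fix k m and G :: "'a monoid" and T
    assume k: "k > 0" and G: "profinite_group G T"
      and U: "finite (uniform_commutators k G T)" "card (uniform_commutators k G T) \<le> m"
    show "finite (lower_central k G T) \<and> card (lower_central k G T) \<le> m ^ (m * exponent_bound m)"
    proof (rule profinite_group.card_lower_central_le[OF G k _ U])
      fix H :: "nat monoid"
      assume H: "group H" "finite (carrier H)"
        and m: "card (uniform_commutators k H (discrete_topology (carrier H))) \<le> m"
      have "card (p_comm_values k H) \<le> card (uniform_commutators k H (discrete_topology (carrier H)))"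
        by (rule card_mono[OF group.finite_uniform_commutators[OF H k] 
              group.p_comm_values_subset_uniform[OF H k]])
      then show "card (generate H (comm_values k H (carrier H))) \<le> m ^ (m * exponent_bound m)"
        by (rule group.finite_group_comm_values_bound[OF H k order_trans[OF _ m]])
    qed
  qed
next
  fix f :: "nat \<Rightarrow> nat" assume f: "lower_central_bound TYPE(nat) f"
  show "lower_central_bound TYPE('a) f"
    unfolding lower_central_bound_def
  proof (intro allI impI)
    fix k m and G :: "'a monoid" and T
    assume km: "k > 0" "m > 0" and G: "profinite_group G T"
      and U: "finite (uniform_commutators k G T)" "card (uniform_commutators k G T) \<le> m"
    show "finite (lower_central k G T) \<and> card (lower_central k G T) \<le> f m"
    proof (rule profinite_group.card_lower_central_le[OF G km(1) _ U])
      fix H :: "nat monoid"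
      assume H: "group H" "finite (carrier H)"
        and m: "card (uniform_commutators k H (discrete_topology (carrier H))) \<le> m"
      \<comment> \<open>The finite group \<open>H\<close> on \<open>nat\<close>, with the discrete
        topology, is itself an instance of the property assumed for \<open>f\<close>.\<close>
      have "card (lower_central k H (discrete_topology (carrier H))) \<le> f m"
        using f[unfolded lower_central_bound_def, rule_format, OF km group.profinite_group_discrete[OF H]
            group.finite_uniform_commutators[OF H km(1)] m] by simp
      then show "card (generate H (comm_values k H (carrier H))) \<le> f m"
        by (simp only: group.lower_central_discrete[OF H(1) km(1)])
    qed
  qed
qed

end
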